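(* Let $X$ be a differentiable manifold, $G$ a finite dimensional connected Lie group, and let $(x_t,g_t)_{t\ge0}$ be a diffusion process with values in $X\times G$, with infinite lifetime and infinitesimal generator $\mathcal L$, satisfying the Dévissage, Convergence, Equivariance and Regularity conditions (all four are stated in the context). Let $g_\infty$ denote the almost sure limit of $g_t$ as $t\to+\infty$. Suppose moreover that for all $(x,g)\in X\times G$ the invariant sigma field $\mathrm{Inv}((x_t)_{t\ge0})$ is trivial for $\mathbb P_{(x,g)}$. Then, for all $(x,g)\in X\times G$, the two sigma fields $$\mathrm{Inv}((x_t,g_t)_{t\ge0})\quad\text{and}\quad\sigma(g_\infty)$$ coincide up to $\mathbb P_{(x,g)}$-negligible sets. Equivalently, if $H$ is a bounded $\mathcal L$-harmonic function, there exists a bounded measurable function $\psi$ on $G$ such that $H(x,g)=\mathbb E_{(x,g)}[\psi(g_\infty)]$ for all $(x,g)\in X\times G$.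
   Context: Setting. The process $(x_t,g_t)_{t\ge0}$ is realized as the coordinate process on the path space $\Omega=C(\mathbb R^+,X\times G)$ with its Borel sigma field; $\mathbb P_{(x,g)}$ is the law of the diffusion started from $(x,g)$ and $\mathbb E_{(x,g)}$ the expectation. As usual, a diffusion with generator $\mathcal L$ (acting on $C^\infty(X\times G,\mathbb R)$) means that $(\mathbb P_{(x,g)})$ is a strong Markov family of laws on continuous paths, $\mathbb P_{(x,g)}$ being the unique solution of the martingale problem for $\mathcal L$ (with smooth compactly supported test functions) started at $(x,g)$. Invariant sigma field. Let $\theta_s\omega=(\omega_{t+s})_{t\ge0}$ be the shift operators and $\mathcal F^\infty=\bigcap_{t\ge0}\sigma((x_s,g_s),\,s\ge t)$ the tail sigma field. Then $\mathrm{Inv}((x_t,g_t)_{t\ge0})$ is the sigma field of all $A\in\mathcal F^\infty$ such that $\theta_s^{-1}A=A$ for all $s>0$. $\mathrm{Inv}((x_t)_{t\ge0})$ is defined in the same way from the process $(x_t)_{t\ge 0}$ alone. A sigma field is trivial for $\mathbb P$ if all its events have $\mathbb P$-probability $0$ or $1$. Action of $G$. For $g\in G$ and $f\in C^\infty(X\times G,\mathbb R)$, $(g\cdot f)(x,h):=f(x,gh)$. Harmonic functions. A bounded measurable $H:X\times G\to\mathbb R$ is $\mathcal L$-harmonic if $H(x,g)=\mathbb E_{(x,g)}[H(x_t,g_t)]$ for all $t\ge 0$ and all $(x,g)$; equivalently $H(x,g)=\mathbb E_{(x,g)}[Z]$ for some bounded shift-invariant $\mathrm{Inv}((x_t,g_t)_{t\ge0})$-measurable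 $Z$. Conditions. - Dévissage condition: $(x_t)_{t\ge0}$ is itself a diffusion (a sub-diffusion of the full process) on $X$. Its own invariant sigma field $\mathrm{Inv}((x_t)_{t\ge0})$ is either trivial (the case of this statement), or generated (up to negligible sets) by a random variable $\ell_\infty$ with values in a separable (i.e. countably generated) measure space $(S,\mathcal G,\lambda)$, with $\lambda$ a probability measure, and the law of $\ell_\infty$ (under each starting point) is absolutely continuous with respect to $\lambda$. - Convergence condition: for every $(x,g)\in X\times G$, $g_t$ converges $\mathbb P_{(x,g)}$-almost surely as $t\to\infty$ to a random variable $g_\infty$ in $G$. - Equivariance condition: $\mathcal L(g\cdot f)=g\cdot(\mathcal Lf)$ for all $g\in G$ and $f\in C^\infty(X\times G,\mathbb R)$. - Regularity condition: (bounded) $\mathcal L$-harmonic functions are continuous on $X\times G$.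
   Formalization: The representation of bounded harmonic functions by a single ψ is asserted only for connected X; for disconnected X it is false (the indicator of a component is harmonic but not of this form). The coincidence of the two sigma fields is stated for arbitrary X. *)

theory Defs
  imports "HOL-Probability.Probability"
begin

section \<open>Smooth manifolds and Lie groups\<close>

text \<open>
  The model space of dimension \<open>n\<close> is \<^const>\<open>Euclidean_space\<close> \<open>n\<close>, that is, the sequences
  \<open>nat \<Rightarrow> real\<close> vanishing from index \<open>n\<close> on, with the product topology. The dimension is thus a
  natural number, dimension \<open>0\<close> is allowed, and a product of manifolds has dimension \<open>n + m\<close>.
\<close>

definition partial_deriv :: "nat \<Rightarrow> ((nat \<Rightarrow> real) \<Rightarrow> real) \<Rightarrow> (nat \<Rightarrow> real) \<Rightarrow> real" where
  "partial_deriv i f x = deriv (\<lambda>t. f (x(i := t))) (x i)"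

definition iterated_partial :: "nat list \<Rightarrow> ((nat \<Rightarrow> real) \<Rightarrow> real) \<Rightarrow> (nat \<Rightarrow> real) \<Rightarrow> real" where
  "iterated_partial js f = foldr partial_deriv js f"

text \<open>
  Smoothness on a set \<open>V\<close> that is open in \<^term>\<open>Euclidean_space n\<close>: all iterated partial
  derivatives exist and are continuous on \<open>V\<close>. Since \<open>V\<close> is open, only the restriction of \<open>f\<close>
  to \<open>V\<close> matters.
\<close>

definition smooth_fun_on :: "nat \<Rightarrow> (nat \<Rightarrow> real) set \<Rightarrow> ((nat \<Rightarrow> real) \<Rightarrow> real) \<Rightarrow> bool" where
  "smooth_fun_on n V f \<longleftrightarrow>
     (\<forall>js. set js \<subseteq> {..<n} \<longrightarrow>
        continuous_on V (iterated_partial js f) \<and>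
        (\<forall>i<n. \<forall>x\<in>V. (\<lambda>t. iterated_partial js f (x(i := t))) field_differentiable (at (x i))))"

type_synonym 'm chart = "'m set \<times> ('m \<Rightarrow> nat \<Rightarrow> real)"

definition is_chart :: "nat \<Rightarrow> 'm::topological_space chart \<Rightarrow> bool" where
  "is_chart n = (\<lambda>(U, \<phi>).
     open U \<and> openin (Euclidean_space n) (\<phi> ` U) \<and>
     homeomorphic_map (top_of_set U) (subtopology (Euclidean_space n) (\<phi> ` U)) \<phi>)"

text \<open>An atlas need not be maximal; the Hausdorff and second countability axioms are type classes.\<close>

definition smooth_manifold ::
  "nat \<Rightarrow> 'm::{t2_space, second_countable_topology} chart set \<Rightarrow> bool" where
  "smooth_manifold n \<A> \<longleftrightarrow>
     (\<forall>c\<in>\<A>. is_chart n c) \<and>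
     (\<Union>(U, \<phi>)\<in>\<A>. U) = UNIV \<and>
     (\<forall>(U, \<phi>)\<in>\<A>. \<forall>(V, \<psi>)\<in>\<A>. \<forall>i<n.
        smooth_fun_on n (\<phi> ` (U \<inter> V)) (\<lambda>y. \<psi> (inv_into U \<phi> y) i))"

definition smooth :: "nat \<Rightarrow> 'm chart set \<Rightarrow> ('m \<Rightarrow> real) \<Rightarrow> bool" where
  "smooth n \<A> f \<longleftrightarrow> (\<forall>(U, \<phi>)\<in>\<A>. smooth_fun_on n (\<phi> ` U) (\<lambda>y. f (inv_into U \<phi> y)))"

definition smooth_map ::
  "nat \<Rightarrow> 'm::topological_space chart set \<Rightarrow> nat \<Rightarrow> 'k::topological_space chart set \<Rightarrow>
   ('m \<Rightarrow> 'k) \<Rightarrow> bool" where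
  "smooth_map n \<A> m \<B> F \<longleftrightarrow>
     continuous_on UNIV F \<and>
     (\<forall>(U, \<phi>)\<in>\<A>. \<forall>(V, \<psi>)\<in>\<B>. \<forall>i<m.
        smooth_fun_on n (\<phi> ` (U \<inter> F -` V)) (\<lambda>y. \<psi> (F (inv_into U \<phi> y)) i))"

text \<open>The first \<open>n\<close> coordinates are those of the first factor.\<close>

definition prod_atlas :: "nat \<Rightarrow> 'a chart set \<Rightarrow> 'b chart set \<Rightarrow> ('a \<times> 'b) chart set" where
  "prod_atlas n \<A> \<B> =
     {(U \<times> V, \<lambda>(x, y) i. if i < n then \<phi> x i else \<psi> y (i - n)) | U \<phi> V \<psi>.
        (U, \<phi>) \<in> \<A> \<and> (V, \<psi>) \<in> \<B>}"

definition lie_group ::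
  "nat \<Rightarrow> 'g::{t2_space, second_countable_topology} chart set \<Rightarrow>
   ('g \<Rightarrow> 'g \<Rightarrow> 'g) \<Rightarrow> 'g \<Rightarrow> ('g \<Rightarrow> 'g) \<Rightarrow> bool" where
  "lie_group m \<A> gmult gone ginv \<longleftrightarrow>
     smooth_manifold m \<A> \<and> group gmult gone ginv \<and>
     smooth_map (m + m) (prod_atlas m \<A> \<A>) m \<A> (\<lambda>(g, h). gmult g h) \<and>
     smooth_map m \<A> m \<A> ginv"


section \<open>Path space\<close>

text \<open>
  Continuous paths on \<open>[0,\<infinity>)\<close>, represented by functions that are \<^const>\<open>undefined\<close> on
  negative times, so that a path is determined by its values on \<open>[0,\<infinity>)\<close>.
\<close>

definition paths :: "(real \<Rightarrow> 'm::topological_space) set" where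
  "paths = {\<omega> \<in> extensional {0..}. continuous_on {0..} \<omega>}"

definition compact_open_topology :: "(real \<Rightarrow> 'm::topological_space) topology" where
  "compact_open_topology = topology_generated_by
     {{\<omega> \<in> paths. \<omega> ` K \<subseteq> U} | K U. compact K \<and> K \<subseteq> {0..} \<and> open U}"

definition path_space :: "(real \<Rightarrow> 'm::topological_space) measure" where
  "path_space = sigma paths {W. openin compact_open_topology W}"

definition shift :: "real \<Rightarrow> (real \<Rightarrow> 'm) \<Rightarrow> real \<Rightarrow> 'm" where
  "shift s \<omega> = restrict (\<lambda>t. \<omega> (t + s)) {0..}"

text \<open>Natural filtration; the index \<open>\<infinity>\<close> is included to allow infinite stopping times.\<close>

definition path_filtration :: "ennreal \<Rightarrow> (real \<Rightarrow> 'm::topological_space) measure" where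
  "path_filtration t =
     sigma paths {{\<omega> \<in> paths. \<omega> s \<in> B} | s B. 0 \<le> s \<and> ennreal s \<le> t \<and> B \<in> sets borel}"

interpretation path_filtration: filtration paths path_filtration
proof
  show "space (path_filtration t) = (paths :: (real \<Rightarrow> 'a) set)" for t
    unfolding path_filtration_def by (rule space_measure_of) auto
next
  fix s t :: ennreal assume "s \<le> t"
  then show "sets (path_filtration s) \<subseteq> sets (path_filtration t :: (real \<Rightarrow> 'a) measure)"
    unfolding path_filtration_def
    by (subst (1 2) sets_measure_of) (auto intro!: sigma_sets_mono' intro: order_trans)
qed


section \<open>Diffusions\<close>

definition test_function :: "nat \<Rightarrow> 'm::topological_space chart set \<Rightarrow> ('m \<Rightarrow> real) \<Rightarrow> bool" where
  "test_function n \<A> f \<longleftrightarrow> smooth n \<A> f \<and> compact (closure {z. f z \<noteq> 0})"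

definition operator_on_smooth ::
  "nat \<Rightarrow> 'm chart set \<Rightarrow> (('m \<Rightarrow> real) \<Rightarrow> 'm \<Rightarrow> real) \<Rightarrow> bool" where
  "operator_on_smooth n \<A> \<L> \<longleftrightarrow>
     (\<forall>f. smooth n \<A> f \<longrightarrow> smooth n \<A> (\<L> f)) \<and>
     (\<forall>f h a b. smooth n \<A> f \<longrightarrow> smooth n \<A> h \<longrightarrow>
        \<L> (\<lambda>z. a * f z + b * h z) = (\<lambda>z. a * \<L> f z + b * \<L> h z))"

definition path_martingale ::
  "(real \<Rightarrow> 'm::topological_space) measure \<Rightarrow> (real \<Rightarrow> (real \<Rightarrow> 'm) \<Rightarrow> real) \<Rightarrow> bool" where
  "path_martingale Q M \<longleftrightarrow>
     (\<forall>t\<ge>0. M t \<in> borel_measurable (path_filtration (ennreal t)) \<and> integrable Q (M t)) \<and>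
     (\<forall>s\<ge>0. \<forall>t\<ge>s. AE \<omega> in Q. real_cond_exp Q (path_filtration (ennreal s)) (M t) \<omega> = M s \<omega>)"

definition martingale_problem_solution ::
  "nat \<Rightarrow> 'm::{t2_space, second_countable_topology} chart set \<Rightarrow>
   (('m \<Rightarrow> real) \<Rightarrow> 'm \<Rightarrow> real) \<Rightarrow> 'm \<Rightarrow> (real \<Rightarrow> 'm) measure \<Rightarrow> bool" where
  "martingale_problem_solution n \<A> \<L> z Q \<longleftrightarrow>
     prob_space Q \<and> sets Q = sets path_space \<and>
     (AE \<omega> in Q. \<omega> 0 = z) \<and>
     (\<forall>f. test_function n \<A> f \<longrightarrow>
        path_martingale Q (\<lambda>t \<omega>. f (\<omega> t) - f (\<omega> 0) - (LINT s:{0..t}|lborel. \<L> f (\<omega> s))))"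

definition strong_markov ::
  "('m::{t2_space, second_countable_topology} \<Rightarrow> (real \<Rightarrow> 'm) measure) \<Rightarrow> bool" where
  "strong_markov P \<longleftrightarrow>
     P \<in> borel \<rightarrow>\<^sub>M prob_algebra path_space \<and>
     (\<forall>z. AE \<omega> in P z. \<omega> 0 = z) \<and>
     (\<forall>z T. stopping_time path_filtration T \<longrightarrow>
        (\<forall>B\<in>sets (path_filtration.pre_sigma T). \<forall>A\<in>sets path_space.
           emeasure (P z) {\<omega> \<in> B. T \<omega> < \<infinity> \<and> shift (enn2real (T \<omega>)) \<omega> \<in> A} =
           (\<integral>\<^sup>+\<omega>\<in>{\<omega> \<in> B. T \<omega> < \<infinity>}. emeasure (P (\<omega> (enn2real (T \<omega>)))) A \<partial>P z)))"

definition diffusion ::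
  "nat \<Rightarrow> 'm::{t2_space, second_countable_topology} chart set \<Rightarrow>
   (('m \<Rightarrow> real) \<Rightarrow> 'm \<Rightarrow> real) \<Rightarrow> ('m \<Rightarrow> (real \<Rightarrow> 'm) measure) \<Rightarrow> bool" where
  "diffusion n \<A> \<L> P \<longleftrightarrow>
     operator_on_smooth n \<A> \<L> \<and>
     strong_markov P \<and>
     (\<forall>z. martingale_problem_solution n \<A> \<L> z (P z) \<and>
          (\<forall>Q. martingale_problem_solution n \<A> \<L> z Q \<longrightarrow> Q = P z))"


section \<open>Invariant sigma fields and harmonic functions\<close>

text \<open>
  The map \<open>\<pi>\<close> selects the observed process \<open>\<pi> (\<omega> t)\<close>: the identity gives the full process
  and \<^const>\<open>fst\<close> the first component alone. Events are sets of paths of the full process.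
\<close>

definition tail_field :: "('m::topological_space \<Rightarrow> 'b::topological_space) \<Rightarrow> (real \<Rightarrow> 'm) set set" where
  "tail_field \<pi> =
     (\<Inter>t\<in>{0..}. sigma_sets paths {{\<omega> \<in> paths. \<pi> (\<omega> s) \<in> B} | s B. t \<le> s \<and> B \<in> sets borel})"

definition invariant_field :: "('m::topological_space \<Rightarrow> 'b::topological_space) \<Rightarrow> (real \<Rightarrow> 'm) set set" where
  "invariant_field \<pi> = {A \<in> tail_field \<pi>. \<forall>s>0. {\<omega> \<in> paths. shift s \<omega> \<in> A} = A}"

definition trivial_field :: "'w measure \<Rightarrow> 'w set set \<Rightarrow> bool" where
  "trivial_field M \<F> \<longleftrightarrow> (\<forall>A\<in>\<F>. measure M A = 0 \<or> measure M A = 1)"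

definition coincide_up_to_null :: "'w measure \<Rightarrow> 'w set set \<Rightarrow> 'w set set \<Rightarrow> bool" where
  "coincide_up_to_null M \<F> \<G> \<longleftrightarrow>
     (\<forall>A\<in>\<F>. \<exists>B\<in>\<G>. sym_diff A B \<in> null_sets M) \<and>
     (\<forall>B\<in>\<G>. \<exists>A\<in>\<F>. sym_diff A B \<in> null_sets M)"

text \<open>Constant (an unspecified point) on the set of paths whose second component does not converge.\<close>

definition g_lim :: "(real \<Rightarrow> 'x \<times> 'g::t2_space) \<Rightarrow> 'g" where
  "g_lim \<omega> = Lim at_top (\<lambda>t. snd (\<omega> t))"

definition sigma_g_lim :: "(real \<Rightarrow> 'x::topological_space \<times> 'g::t2_space) set set" where
  "sigma_g_lim = {{\<omega> \<in> paths. g_lim \<omega> \<in> B} | B. B \<in> sets borel}"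

definition harmonic :: "('m::topological_space \<Rightarrow> (real \<Rightarrow> 'm) measure) \<Rightarrow> ('m \<Rightarrow> real) \<Rightarrow> bool" where
  "harmonic P H \<longleftrightarrow>
     H \<in> borel_measurable borel \<and> bounded (range H) \<and>
     (\<forall>t\<ge>0. \<forall>z. H z = (\<integral>\<omega>. H (\<omega> t) \<partial>P z))"


section \<open>The standing conditions\<close>

text \<open>The law of the first component under \<open>P (x, g)\<close> is that of a diffusion started at \<open>x\<close>.\<close>

definition sub_diffusion ::
  "nat \<Rightarrow> 'x::{t2_space, second_countable_topology} chart set \<Rightarrow>
   ('x \<times> 'g::{t2_space, second_countable_topology} \<Rightarrow> (real \<Rightarrow> 'x \<times> 'g) measure) \<Rightarrow> bool" where
  "sub_diffusion n \<A> P \<longleftrightarrow>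
     (\<exists>\<L> Q. diffusion n \<A> \<L> Q \<and>
        (\<forall>x g. distr (P (x, g)) path_space (\<lambda>\<omega>. restrict (\<lambda>t. fst (\<omega> t)) {0..}) = Q x))"

definition convergence_condition ::
  "('x::topological_space \<times> 'g::topological_space \<Rightarrow> (real \<Rightarrow> 'x \<times> 'g) measure) \<Rightarrow> bool" where
  "convergence_condition P \<longleftrightarrow>
     (\<forall>x g. AE \<omega> in P (x, g). \<exists>l. ((\<lambda>t. snd (\<omega> t)) \<longlongrightarrow> l) at_top)"

definition translate :: "('g \<Rightarrow> 'g \<Rightarrow> 'g) \<Rightarrow> 'g \<Rightarrow> ('x \<times> 'g \<Rightarrow> real) \<Rightarrow> 'x \<times> 'g \<Rightarrow> real" where
  "translate gmult g f = (\<lambda>(x, h). f (x, gmult g h))"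

definition equivariance_condition ::
  "nat \<Rightarrow> ('x \<times> 'g) chart set \<Rightarrow> ('g \<Rightarrow> 'g \<Rightarrow> 'g) \<Rightarrow>
   (('x \<times> 'g \<Rightarrow> real) \<Rightarrow> 'x \<times> 'g \<Rightarrow> real) \<Rightarrow> bool" where
  "equivariance_condition n \<A> gmult \<L> \<longleftrightarrow>
     (\<forall>g f. smooth n \<A> f \<longrightarrow> \<L> (translate gmult g f) = translate gmult g (\<L> f))"

definition regularity_condition ::
  "('m::topological_space \<Rightarrow> (real \<Rightarrow> 'm) measure) \<Rightarrow> bool" where
  "regularity_condition P \<longleftrightarrow> (\<forall>H. harmonic P H \<longrightarrow> continuous_on UNIV H)"

end

theory Submission
  imports Defs
begin

text \<open>
  Two facts drive the proof. First, for a shift-invariant event \<open>A\<close> the function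
  \<open>z \<mapsto> P z A\<close> is harmonic by the Markov property, hence continuous by the regularity
  condition. Second, write \<open>k \<cdot> \<omega>\<close> for the path \<open>\<omega>\<close> with its second component multiplied on
  the left by \<open>k\<close>. By equivariance the law of \<open>k \<cdot> \<omega>\<close> under \<open>P (x, h)\<close> solves the martingale
  problem started at \<open>(x, k h)\<close>, so by uniqueness it is \<open>P (x, k h)\<close> (\<open>diffusion_translate\<close>).

  \<^emph>\<open>Fixed limit points.\<close> Given an invariant event \<open>A\<close> and \<open>h \<in> G\<close>, translate each path so that
  its limit becomes \<open>h\<close> and ask whether the result lies in \<open>A\<close>. This event, \<open>recentred A h\<close>, is
  invariant and is not affected by a translation of \<open>\<omega>\<close>, so its probability is a function of
  \<open>x\<close> alone. An invariant event whose probability depends on \<open>x\<close> alone has probability \<open>0\<close> or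
  \<open>1\<close> when the invariant field of \<open>(x\<^sub>t)\<close> is trivial (\<open>factor_invariant_event_trivial\<close>). Let
  \<open>B\<close>, called \<open>limit_set A x\<close> below, be the set of \<open>h\<close> for which it is \<open>1\<close>. Then for each fixed
  \<open>h\<close>, almost surely, \<open>\<omega>\<close> lies in \<open>recentred A h\<close> if and only if \<open>h \<in> B\<close>.

  \<^emph>\<open>Random limit points.\<close> The value of interest is \<open>h = g\<^sub>\<infinity>(\<omega>)\<close>, for which \<open>recentred A h\<close>
  becomes \<open>A\<close>. Fubini's theorem allows \<open>h\<close> to be random and independent of \<open>\<omega>\<close>; the change of
  variable \<open>h = k g\<^sub>\<infinity>(\<omega>)\<close> then asks for a class of null sets of \<open>G\<close> stable under right
  translations. Take the sets that are null for the law of \<open>(g\<^sub>\<infinity>)\<inverse>\<close> under every \<open>P (x, h)\<close>: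
  translating the path by \<open>c\<close> multiplies \<open>(g\<^sub>\<infinity>)\<inverse>\<close> by \<open>c\<inverse>\<close> on the right and replaces \<open>h\<close> by
  \<open>c h\<close>. By regularity it is enough to test \<open>h\<close> in a countable dense set, which is what makes
  this class usable with almost sure statements. The outcome is that, for almost every \<open>k\<close>,
  \<open>k \<cdot> \<omega> \<in> A\<close> if and only if \<open>g\<^sub>\<infinity>(k \<cdot> \<omega>) \<in> B\<close> almost surely. So the symmetric difference of \<open>A\<close>
  and \<open>{g\<^sub>\<infinity> \<in> B}\<close> has probability zero from a dense set of starting points in \<open>{x} \<times> G\<close>,
  and by continuity from all of them (\<open>invariant_event_eq_limit_event\<close>).

  \<^emph>\<open>Harmonic functions.\<close> A harmonic \<open>H\<close> with values in \<open>[0, 1]\<close> converges along almost every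
  path (\<open>harmonic_no_oscillation\<close>), and \<open>H z\<close> is the mean of the limit. The events that the
  limit superior exceeds a rational \<open>q\<close> are invariant, hence of the form \<open>{g\<^sub>\<infinity> \<in> B\<^sub>q}\<close>, and the
  sets \<open>B\<^sub>q\<close> assemble to \<open>\<psi>\<close>. They do not depend on \<open>x\<close> when \<open>X\<close> is connected, because the
  probability of \<open>recentred A h\<close> is a continuous function of \<open>x\<close> with values in \<open>{0, 1}\<close>.

  The probabilistic input on both sides is a maximal inequality for harmonic functions
  (\<open>harmonic_maximal_inequality\<close>) and the approximation of path events by events that depend
  on a bounded time interval (\<open>measure_eq_0_of_cylinder_bound\<close>).
\<close>

section \<open>Functions of class C-infinity on open sets of the model space\<close>

definition admits_partials :: "nat \<Rightarrow> (nat \<Rightarrow> real) set \<Rightarrow> ((nat \<Rightarrow> real) \<Rightarrow> real) \<Rightarrow> bool" where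
  "admits_partials n V f \<longleftrightarrow>
     (\<forall>i<n. \<forall>x\<in>V. (\<lambda>t. f (x(i := t))) field_differentiable (at (x i)))"

text \<open>
  Smoothness is phrased with iterated partial derivatives of arbitrary length. The chain rule
  expresses a partial derivative of \<open>f \<circ> F\<close> through products of other functions, so it has to be
  proved by induction on the order of differentiability; hence this recursive predicate for the
  class \<open>C\<^sup>k\<close>.
\<close>

fun cont_diff :: "nat \<Rightarrow> nat \<Rightarrow> (nat \<Rightarrow> real) set \<Rightarrow> ((nat \<Rightarrow> real) \<Rightarrow> real) \<Rightarrow> bool" where
  "cont_diff 0 n V f \<longleftrightarrow> continuous_on V f"
| "cont_diff (Suc k) n V f \<longleftrightarrow>
     continuous_on V f \<and> admits_partials n V f \<and> (\<forall>i<n. cont_diff k n V (partial_deriv i f))"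

lemma cont_diff_imp_continuous: "cont_diff k n V f \<Longrightarrow> continuous_on V f"
  by (cases k) auto

lemma cont_diff_Suc_imp: "cont_diff (Suc k) n V f \<Longrightarrow> cont_diff k n V f"
proof (induction k arbitrary: f)
  case (Suc k)
  then show ?case by (metis cont_diff.simps(2))
qed auto

lemma smooth_fun_on_partial_deriv:
  assumes "smooth_fun_on n V f" "i < n"
  shows "smooth_fun_on n V (partial_deriv i f)"
proof -
  have *: "iterated_partial js (partial_deriv i f) = iterated_partial (js @ [i]) f" for js
    by (simp add: iterated_partial_def)
  show ?thesis
    using assms unfolding smooth_fun_on_def * by simp
qed

lemma smooth_fun_on_iff_cont_diff: "smooth_fun_on n V f \<longleftrightarrow> (\<forall>k. cont_diff k n V f)"
proof
  assume "smooth_fun_on n V f"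
  then show "\<forall>k. cont_diff k n V f"
  proof (intro allI)
    fix k
    assume "smooth_fun_on n V f"
    then show "cont_diff k n V f"
    proof (induction k arbitrary: f)
      case 0
      then show ?case
        by (auto simp: smooth_fun_on_def iterated_partial_def dest: spec[of _ "[]"])
    next
      case (Suc k)
      have "continuous_on V f" "admits_partials n V f"
        using Suc.prems
        by (auto simp: smooth_fun_on_def iterated_partial_def admits_partials_def dest: spec[of _ "[]"])
      then show ?case
        using Suc.IH smooth_fun_on_partial_deriv[OF Suc.prems] by simp
    qed
  qed
next
  assume "\<forall>k. cont_diff k n V f"
  moreover have "continuous_on V (iterated_partial js f) \<and> admits_partials n V (iterated_partial js f)"
    if "\<forall>k. cont_diff k n V f" "set js \<subseteq> {..<n}" for js
    using that
  proof (induction js arbitrary: f rule: rev_induct)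
    case Nil
    then show ?case
      using cont_diff.simps(2)[of 0 n V f] by (simp add: iterated_partial_def del: cont_diff.simps)
  next
    case (snoc i js)
    have "\<forall>k. cont_diff k n V (partial_deriv i f)"
    proof
      fix k
      have "cont_diff (Suc k) n V f" "i < n"
        using snoc.prems by auto
      then show "cont_diff k n V (partial_deriv i f)"
        by simp
    qed
    with snoc.IH[of "partial_deriv i f"] snoc.prems(2) show ?case
      by (simp add: iterated_partial_def)
  qed
  ultimately show "smooth_fun_on n V f"
    by (simp add: smooth_fun_on_def admits_partials_def)
qed

lemma smooth_fun_on_subset: "smooth_fun_on n V f \<Longrightarrow> U \<subseteq> V \<Longrightarrow> smooth_fun_on n U f"
  unfolding smooth_fun_on_def by (blast intro: continuous_on_subset)

lemma continuous_on_fun_upd: "continuous_on UNIV (\<lambda>t. (x :: nat \<Rightarrow> real)(i := t))"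
proof (rule continuous_on_coordinatewise_then_product)
  show "continuous_on UNIV (\<lambda>t. (x(i := t)) j)" for j
    by (cases "j = i") auto
qed

lemma openin_Euclidean_space_iff:
  "openin (Euclidean_space n) V \<longleftrightarrow> (\<exists>U. open U \<and> V = U \<inter> {x. \<forall>i\<ge>n. x i = 0})"
  unfolding Euclidean_space_def openin_subtopology by (simp add: euclidean_product_topology)

lemma openin_Euclidean_space_zero: "openin (Euclidean_space n) V \<Longrightarrow> x \<in> V \<Longrightarrow> i \<ge> n \<Longrightarrow> x i = 0"
  by (auto simp: openin_Euclidean_space_iff)

lemma eventually_fun_upd_mem:
  assumes V: "openin (Euclidean_space n) V" "x \<in> V" "i < n"
  shows "\<forall>\<^sub>F t in nhds (x i). x(i := t) \<in> V"
proof -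
  obtain U where U: "open U" "V = U \<inter> {x. \<forall>i\<ge>n. x i = 0}"
    using V(1) by (auto simp: openin_Euclidean_space_iff)
  have "open ((\<lambda>t. x(i := t)) -` U)"
    using U(1) continuous_on_fun_upd by (simp add: open_vimage)
  moreover have "x i \<in> (\<lambda>t. x(i := t)) -` U"
    using U V by simp
  ultimately show ?thesis
    unfolding eventually_nhds using U V by (intro exI[of _ "(\<lambda>t. x(i := t)) -` U"]) auto
qed

text \<open>
  Boxes around \<open>q\<close> are used because the chain rule passes through points that take some
  coordinates from \<open>q\<close> and the others from a nearby point.
\<close>

lemma box_subset_of_openin_Euclidean_space:
  assumes "openin (Euclidean_space n) V" "q \<in> V"
  obtains \<delta> where "\<delta> > 0"
    "\<And>p. (\<And>i. i \<ge> n \<Longrightarrow> p i = 0) \<Longrightarrow> (\<And>i. i < n \<Longrightarrow> \<bar>p i - q i\<bar> \<le> \<delta>) \<Longrightarrow> p \<in> V"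
proof -
  obtain U where U: "open U" "V = U \<inter> {x. \<forall>i\<ge>n. x i = 0}"
    using assms(1) by (auto simp: openin_Euclidean_space_iff)
  then have "q \<in> U" and q0: "\<And>i. i \<ge> n \<Longrightarrow> q i = 0"
    using assms by auto
  then obtain X where X: "q \<in> PiE UNIV X" "\<And>i. open (X i)" "PiE UNIV X \<subseteq> U"
    using U(1) by (auto simp: open_fun_def dest!: product_topology_open_contains_basis)
  have "\<exists>e>0. \<forall>y. dist y (q i) \<le> e \<longrightarrow> y \<in> X i" for i
  proof -
    have "q i \<in> X i"
      using X(1) by (auto simp: PiE_def)
    then show ?thesis
      using X(2)[of i] unfolding open_contains_cball by (force simp: subset_eq dist_commute)
  qed
  then obtain e where e: "\<And>i. e i > 0" "\<And>i y. dist y (q i) \<le> e i \<Longrightarrow> y \<in> X i"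
    by metis
  define \<delta> where "\<delta> = Min (insert 1 (e ` {..<n}))"
  have \<delta>: "\<delta> \<le> e i" if "i < n" for i
    unfolding \<delta>_def using that by (intro Min_le) auto
  show thesis
  proof (rule that[of \<delta>])
    show "\<delta> > 0"
      unfolding \<delta>_def using e(1) by (subst Min_gr_iff) auto
    fix p assume p: "\<And>i. i \<ge> n \<Longrightarrow> p i = 0" "\<And>i. i < n \<Longrightarrow> \<bar>p i - q i\<bar> \<le> \<delta>"
    have "p i \<in> X i" for i
    proof (cases "i < n")
      case True
      then show ?thesis using p(2)[OF True] \<delta>[OF True] by (intro e(2)) (auto simp: dist_real_def)
    next
      case False
      then show ?thesis using p(1)[of i] q0[of i] e(2)[of "p i" i] e(1)[of i] by (simp add: less_imp_le)
    qed
    then have "p \<in> U"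
      using X(3) by auto
    then show "p \<in> V"
      using U p by auto
  qed
qed

lemma tendsto_coordinatewise:
  fixes f :: "'a \<Rightarrow> nat \<Rightarrow> real"
  assumes "\<And>i. ((\<lambda>t. f t i) \<longlongrightarrow> l i) F"
  shows "(f \<longlongrightarrow> l) F"
  using assms limitin_componentwise[of "\<lambda>_. euclidean" UNIV f l F] by (simp add: euclidean_product_topology)

lemma has_partial_deriv:
  assumes "admits_partials n V f" "x \<in> V" "i < n"
  shows "((\<lambda>t. f (x(i := t))) has_real_derivative partial_deriv i f x) (at (x i))"
  using assms unfolding admits_partials_def partial_deriv_def
  by (auto simp: DERIV_deriv_iff_field_differentiable)

lemma partial_derivI:
  "((\<lambda>t. f (x(i := t))) has_real_derivative D) (at (x i)) \<Longrightarrow> partial_deriv i f x = D"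
  unfolding partial_deriv_def by (rule DERIV_imp_deriv)

text \<open>
  Partial derivatives at a point of a relatively open set only look at the function along
  coordinate lines near that point, so agreement on the set is enough.
\<close>

lemma cont_diff_cong:
  assumes V: "openin (Euclidean_space n) V" and "\<And>x. x \<in> V \<Longrightarrow> f x = g x" "cont_diff k n V f"
  shows "cont_diff k n V g"
  using assms(2,3)
proof (induction k arbitrary: f g)
  case 0
  then show ?case
    by (auto cong: continuous_on_cong)
next
  case (Suc k)
  have D: "((\<lambda>t. g (x(i := t))) has_real_derivative partial_deriv i f x) (at (x i))"
    if "i < n" "x \<in> V" for i x
  proof -
    have "\<forall>\<^sub>F t in nhds (x i). f (x(i := t)) = g (x(i := t))"
      using eventually_fun_upd_mem[OF V that(2,1)] by eventually_elim (rule Suc.prems(1))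
    moreover have "((\<lambda>t. f (x(i := t))) has_real_derivative partial_deriv i f x) (at (x i))"
      using Suc.prems(2) that by (intro has_partial_deriv) auto
    ultimately show ?thesis
      by (simp add: DERIV_cong_ev)
  qed
  have "cont_diff k n V (partial_deriv i g)" if "i < n" for i
  proof (rule Suc.IH[of "partial_deriv i f"])
    show "partial_deriv i f x = partial_deriv i g x" if "x \<in> V" for x
      using partial_derivI[OF D[OF \<open>i < n\<close> that]] by simp
  qed (use Suc.prems(2) that in auto)
  moreover have "admits_partials n V g"
    unfolding admits_partials_def using D by (auto simp: field_differentiable_def)
  moreover have "continuous_on V g"
    using Suc.prems by (auto cong: continuous_on_cong)
  ultimately show ?case
    by simp
qed

lemma cont_diff_const: "cont_diff k n V (\<lambda>_. c)"
proof (induction k arbitrary: c)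
  case (Suc k)
  have "partial_deriv i (\<lambda>_. c) = (\<lambda>_. 0)" for i
    by (auto simp: partial_deriv_def)
  then show ?case
    using Suc by (auto simp: admits_partials_def)
qed simp

lemma cont_diff_coord: "cont_diff k n V (\<lambda>x. x j)"
proof (cases k)
  case (Suc l)
  have D: "((\<lambda>t. (x(i := t)) j) has_real_derivative (if i = j then 1 else 0)) (at (x i))"
    for i and x :: "nat \<Rightarrow> real"
    by (auto intro!: derivative_eq_intros)
  have "partial_deriv i (\<lambda>x. x j) = (\<lambda>_. if i = j then 1 else 0)" for i
    unfolding fun_eq_iff by (intro allI partial_derivI D)
  then show ?thesis
    using Suc D by (auto simp: cont_diff_const admits_partials_def field_differentiable_def
        intro: continuous_on_subset[OF continuous_on_product_coordinates])
qed (auto intro: continuous_on_subset[OF continuous_on_product_coordinates])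

lemma cont_diff_add:
  assumes V: "openin (Euclidean_space n) V" and "cont_diff k n V f" "cont_diff k n V g"
  shows "cont_diff k n V (\<lambda>x. f x + g x)"
  using assms(2,3)
proof (induction k arbitrary: f g)
  case (Suc k)
  have D: "((\<lambda>t. f (x(i := t)) + g (x(i := t))) has_real_derivative
      partial_deriv i f x + partial_deriv i g x) (at (x i))" if "i < n" "x \<in> V" for i x
    using Suc.prems that by (intro DERIV_add has_partial_deriv) auto
  have "cont_diff k n V (partial_deriv i (\<lambda>x. f x + g x))" if "i < n" for i
  proof (rule cont_diff_cong[OF V])
    show "partial_deriv i f x + partial_deriv i g x = partial_deriv i (\<lambda>x. f x + g x) x"
      if "x \<in> V" for x
      using partial_derivI[OF D[OF \<open>i < n\<close> that]] by simp
    show "cont_diff k n V (\<lambda>x. partial_deriv i f x + partial_deriv i g x)"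
      using Suc that by auto
  qed
  then show ?case
    using Suc.prems D continuous_on_add by (auto simp: admits_partials_def field_differentiable_def)
qed (simp add: continuous_on_add)

lemma cont_diff_mult:
  assumes V: "openin (Euclidean_space n) V" and "cont_diff k n V f" "cont_diff k n V g"
  shows "cont_diff k n V (\<lambda>x. f x * g x)"
  using assms(2,3)
proof (induction k arbitrary: f g)
  case (Suc k)
  have D: "((\<lambda>t. f (x(i := t)) * g (x(i := t))) has_real_derivative
      partial_deriv i f x * g x + partial_deriv i g x * f x) (at (x i))" if "i < n" "x \<in> V" for i x
    using DERIV_mult[OF has_partial_deriv[of n V f x i] has_partial_deriv[of n V g x i]] Suc.prems that
    by auto
  have "cont_diff k n V (partial_deriv i (\<lambda>x. f x * g x))" if "i < n" for i
  proof (rule cont_diff_cong[OF V])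
    show "partial_deriv i f x * g x + partial_deriv i g x * f x = partial_deriv i (\<lambda>x. f x * g x) x"
      if "x \<in> V" for x
      using partial_derivI[OF D[OF \<open>i < n\<close> that]] by simp
    show "cont_diff k n V (\<lambda>x. partial_deriv i f x * g x + partial_deriv i g x * f x)"
      using Suc that cont_diff_Suc_imp[of k n V] by (intro cont_diff_add[OF V] Suc.IH) auto
  qed
  then show ?case
    using Suc.prems D continuous_on_mult by (auto simp: admits_partials_def field_differentiable_def)
qed (simp add: continuous_on_mult)

lemma cont_diff_sum:
  assumes V: "openin (Euclidean_space n) V" and "\<And>j. j \<in> J \<Longrightarrow> cont_diff k n V (f j)"
  shows "cont_diff k n V (\<lambda>x. \<Sum>j\<in>J. f j x)"
  using assms(2) by (induction J rule: infinite_finite_induct) (auto simp: cont_diff_const intro: cont_diff_add[OF V])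

lemma mean_value_in_coordinate:
  assumes f: "admits_partials n W f" and j: "j < n"
    and seg: "\<And>s. s \<in> closed_segment a b \<Longrightarrow> p(j := s) \<in> W"
  shows "\<exists>s\<in>closed_segment a b. f (p(j := b)) - f (p(j := a)) = partial_deriv j f (p(j := s)) * (b - a)"
proof -
  have D: "((\<lambda>t. f (p(j := t))) has_real_derivative partial_deriv j f (p(j := s))) (at s)"
    if "s \<in> closed_segment a b" for s
    using has_partial_deriv[OF f seg[OF that] j] by simp
  consider "a < b" | "a = b" | "b < a" by linarith
  then show ?thesis
  proof cases
    case 1
    then obtain z where "a < z" "z < b"
      "f (p(j := b)) - f (p(j := a)) = (b - a) * partial_deriv j f (p(j := z))"
      using MVT2[of a b "\<lambda>t. f (p(j := t))" "\<lambda>s. partial_deriv j f (p(j := s))"] D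
      by (auto simp: closed_segment_eq_real_ivl)
    with 1 show ?thesis
      by (intro bexI[of _ z]) (auto simp: closed_segment_eq_real_ivl)
  next
    case 3
    then obtain z where "b < z" "z < a"
      "f (p(j := a)) - f (p(j := b)) = (a - b) * partial_deriv j f (p(j := z))"
      using MVT2[of b a "\<lambda>t. f (p(j := t))" "\<lambda>s. partial_deriv j f (p(j := s))"] D
      by (auto simp: closed_segment_eq_real_ivl)
    with 3 show ?thesis
      by (intro bexI[of _ z]) (auto simp: closed_segment_eq_real_ivl algebra_simps)
  qed auto
qed

text \<open>
  Only continuity of the partial derivatives is available, not a total derivative of \<open>f\<close>. The
  increment of \<open>f\<close> from \<open>\<gamma> t0\<close> to \<open>\<gamma> t\<close> is split into steps that change one coordinate each; the
  mean value theorem turns each step into a partial derivative at an intermediate point times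
  an increment of \<open>\<gamma>\<close>, and the intermediate points tend to \<open>\<gamma> t0\<close>.
\<close>

lemma chain_rule_curve:
  fixes \<gamma> :: "real \<Rightarrow> nat \<Rightarrow> real"
  assumes W: "openin (Euclidean_space m) W" and f: "cont_diff (Suc 0) m W f"
    and \<gamma>: "\<forall>\<^sub>F t in nhds t0. \<gamma> t \<in> W"
    and d: "\<And>j. j < m \<Longrightarrow> ((\<lambda>t. \<gamma> t j) has_real_derivative d j) (at t0)"
  shows "((\<lambda>t. f (\<gamma> t)) has_real_derivative (\<Sum>j<m. partial_deriv j f (\<gamma> t0) * d j)) (at t0)"
proof -
  define q where "q = \<gamma> t0"
  have qW: "q \<in> W"
    using eventually_nhds_x_imp_x[OF \<gamma>] by (simp add: q_def)
  obtain \<delta> where \<delta>: "\<delta> > 0"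
    "\<And>p. (\<And>i. i \<ge> m \<Longrightarrow> p i = 0) \<Longrightarrow> (\<And>i. i < m \<Longrightarrow> \<bar>p i - q i\<bar> \<le> \<delta>) \<Longrightarrow> p \<in> W"
    using box_subset_of_openin_Euclidean_space[OF W qW] by metis
  \<comment> \<open>the point reached after the first \<open>j\<close> coordinates have been changed\<close>
  define p where "p j t = (\<lambda>l. if l < j then \<gamma> t l else q l)" for j :: nat and t
  define near where "near t \<longleftrightarrow> \<gamma> t \<in> W \<and> (\<forall>l<m. \<bar>\<gamma> t l - q l\<bar> \<le> \<delta>)" for t
  have lim: "((\<lambda>t. \<gamma> t l) \<longlongrightarrow> q l) (at t0)" if "l < m" for l
    using DERIV_isCont[OF d[OF that]] by (simp add: isCont_def q_def)
  have near: "\<forall>\<^sub>F t in at t0. near t"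
  proof -
    have "\<forall>\<^sub>F t in at t0. \<bar>\<gamma> t l - q l\<bar> \<le> \<delta>" if "l < m" for l
      using tendstoD[OF lim[OF that] \<delta>(1)] by eventually_elim (simp add: dist_real_def)
    then have "\<forall>\<^sub>F t in at t0. \<forall>l\<in>{..<m}. \<bar>\<gamma> t l - q l\<bar> \<le> \<delta>"
      by (simp add: eventually_ball_finite)
    moreover have "\<forall>\<^sub>F t in at t0. \<gamma> t \<in> W"
      using \<gamma> by (simp add: eventually_nhds_conv_at)
    ultimately show ?thesis
      unfolding near_def by eventually_elim auto
  qed
  have "\<exists>s\<in>closed_segment (q j) (\<gamma> t j). f ((p j t)(j := \<gamma> t j)) - f ((p j t)(j := q j)) =
      partial_deriv j f ((p j t)(j := s)) * (\<gamma> t j - q j) \<and> (p j t)(j := s) \<in> W"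
    if t: "near t" and j: "j < m" for t j
  proof -
    have seg: "(p j t)(j := s) \<in> W" if s: "s \<in> closed_segment (q j) (\<gamma> t j)" for s
    proof (rule \<delta>(2))
      show "((p j t)(j := s)) i = 0" if "i \<ge> m" for i
        using that j openin_Euclidean_space_zero[OF W qW that] by (simp add: p_def)
      have "\<bar>s - q j\<bar> \<le> \<bar>\<gamma> t j - q j\<bar>"
        using s by (auto simp: closed_segment_eq_real_ivl split: if_splits)
      then show "\<bar>((p j t)(j := s)) i - q i\<bar> \<le> \<delta>" if "i < m" for i
        using t j that \<delta>(1) by (force simp: p_def near_def)
    qed
    have "admits_partials m W f"
      using f by simp
    from mean_value_in_coordinate[OF this j seg] seg show ?thesis
      by blast
  qed
  then have "\<exists>s. \<forall>t j. near t \<longrightarrow> j < m \<longrightarrow> s t j \<in> closed_segment (q j) (\<gamma> t j) \<and>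
      f ((p j t)(j := \<gamma> t j)) - f ((p j t)(j := q j)) =
        partial_deriv j f ((p j t)(j := s t j)) * (\<gamma> t j - q j) \<and> (p j t)(j := s t j) \<in> W"
    by (intro choice allI) blast
  then obtain s where s: "\<And>t j. near t \<Longrightarrow> j < m \<Longrightarrow> s t j \<in> closed_segment (q j) (\<gamma> t j)"
    "\<And>t j. near t \<Longrightarrow> j < m \<Longrightarrow> f ((p j t)(j := \<gamma> t j)) - f ((p j t)(j := q j)) =
      partial_deriv j f ((p j t)(j := s t j)) * (\<gamma> t j - q j)"
    "\<And>t j. near t \<Longrightarrow> j < m \<Longrightarrow> (p j t)(j := s t j) \<in> W"
    by auto
  define \<xi> where "\<xi> j t = (p j t)(j := s t j)" for j t
  have telescope: "f (\<gamma> t) - f q = (\<Sum>j<m. partial_deriv j f (\<xi> j t) * (\<gamma> t j - q j))" if t: "near t" for t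
  proof -
    have "p m t = \<gamma> t"
      using t openin_Euclidean_space_zero[OF W qW] openin_Euclidean_space_zero[OF W, of "\<gamma> t"]
      by (auto simp: p_def near_def fun_eq_iff not_less)
    moreover have "p 0 t = q"
      by (simp add: p_def)
    moreover have "(p j t)(j := \<gamma> t j) = p (Suc j) t" "(p j t)(j := q j) = p j t" for j
      by (auto simp: p_def fun_eq_iff)
    moreover have "f (p (Suc j) t) - f (p j t) = partial_deriv j f (\<xi> j t) * (\<gamma> t j - q j)" if "j < m" for j
      using s(2)[OF t that] unfolding \<xi>_def calculation(3,4) .
    ultimately show ?thesis
      using sum_lessThan_telescope[of "\<lambda>j. f (p j t)" m] by simp
  qed
  have \<xi>_lim: "((\<lambda>t. partial_deriv j f (\<xi> j t)) \<longlongrightarrow> partial_deriv j f q) (at t0)" if j: "j < m" for j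
  proof (rule continuous_on_tendsto_compose[of W "partial_deriv j f"])
    show "continuous_on W (partial_deriv j f)"
      using f j by simp
    show "\<forall>\<^sub>F t in at t0. \<xi> j t \<in> W"
      using near by eventually_elim (use s(3) j in \<open>auto simp: \<xi>_def\<close>)
    show "(\<xi> j \<longlongrightarrow> q) (at t0)"
    proof (rule tendsto_coordinatewise)
      fix l
      show "((\<lambda>t. \<xi> j t l) \<longlongrightarrow> q l) (at t0)"
      proof (cases "l \<le> j")
        case True
        then have "l < m" using j by simp
        show ?thesis
        proof (rule tendsto_dist_iff[THEN iffD2],
            rule tendsto_sandwich[of "\<lambda>_. 0" _ _ "\<lambda>t. dist (\<gamma> t l) (q l)"])
          show "((\<lambda>t. dist (\<gamma> t l) (q l)) \<longlongrightarrow> 0) (at t0)"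
            by (rule tendsto_dist_iff[THEN iffD1, OF lim[OF \<open>l < m\<close>]])
          show "\<forall>\<^sub>F t in at t0. dist (\<xi> j t l) (q l) \<le> dist (\<gamma> t l) (q l)"
            using near
          proof eventually_elim
            case (elim t)
            with s(1)[OF elim j] True show ?case
              by (auto simp: \<xi>_def p_def dist_real_def closed_segment_eq_real_ivl split: if_splits)
          qed
        qed auto
      next
        case False
        then show ?thesis by (simp add: \<xi>_def p_def)
      qed
    qed
  qed (rule qW)
  have "((\<lambda>t. \<Sum>j<m. partial_deriv j f (\<xi> j t) * ((\<gamma> t j - \<gamma> t0 j) / (t - t0)))
      \<longlongrightarrow> (\<Sum>j<m. partial_deriv j f q * d j)) (at t0)"
  proof (rule tendsto_sum, rule tendsto_mult)
    fix j assume "j \<in> {..<m}"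
    then show "((\<lambda>t. partial_deriv j f (\<xi> j t)) \<longlongrightarrow> partial_deriv j f q) (at t0)"
      "((\<lambda>t. (\<gamma> t j - \<gamma> t0 j) / (t - t0)) \<longlongrightarrow> d j) (at t0)"
      using \<xi>_lim d[of j] unfolding has_field_derivative_iff by auto
  qed
  moreover have "\<forall>\<^sub>F t in at t0. (\<Sum>j<m. partial_deriv j f (\<xi> j t) * ((\<gamma> t j - \<gamma> t0 j) / (t - t0)))
      = (f (\<gamma> t) - f (\<gamma> t0)) / (t - t0)"
    using near
  proof eventually_elim
    case (elim t)
    from telescope[OF elim] show ?case
      by (simp add: q_def sum_divide_distrib)
  qed
  ultimately show ?thesis
    unfolding has_field_derivative_iff q_def by (rule Lim_transform_eventually)
qed

lemma cont_diff_compose: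
  assumes V: "openin (Euclidean_space n) V" and W: "openin (Euclidean_space m) W"
    and "cont_diff k m W f" and F: "\<And>x. x \<in> V \<Longrightarrow> F x \<in> W"
    and "\<And>j. j < m \<Longrightarrow> cont_diff k n V (\<lambda>x. F x j)"
  shows "cont_diff k n V (\<lambda>x. f (F x))"
  using assms(3,5)
proof (induction k arbitrary: f)
  case 0
  have "continuous_on V F"
  proof (rule continuous_on_coordinatewise_then_product)
    fix j
    have "continuous_on V (\<lambda>x. F x j)" if "\<not> j < m"
    proof -
      have "F x j = 0" if "x \<in> V" for x
        using openin_Euclidean_space_zero[OF W F[OF that]] \<open>\<not> j < m\<close> by simp
      then show ?thesis by (simp cong: continuous_on_cong)
    qed
    then show "continuous_on V (\<lambda>x. F x j)"
      using 0(2)[of j] by auto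
  qed
  then show ?case
    using 0 F by (auto intro!: continuous_on_compose2[of W f])
next
  case (Suc k)
  have D: "((\<lambda>t. f (F (x(i := t)))) has_real_derivative
      (\<Sum>j<m. partial_deriv j f (F x) * partial_deriv i (\<lambda>x. F x j) x)) (at (x i))"
    if "i < n" "x \<in> V" for i x
  proof -
    have "cont_diff (Suc 0) m W f"
      using Suc.prems(1) cont_diff_imp_continuous by auto
    moreover have "\<forall>\<^sub>F t in nhds (x i). F (x(i := t)) \<in> W"
      using eventually_fun_upd_mem[OF V that(2,1)] by eventually_elim (rule F)
    moreover have "((\<lambda>t. F (x(i := t)) j) has_real_derivative partial_deriv i (\<lambda>x. F x j) x) (at (x i))"
      if "j < m" for j
      using Suc.prems(2)[OF that] \<open>x \<in> V\<close> \<open>i < n\<close> by (intro has_partial_deriv) auto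
    ultimately have "((\<lambda>t. f (F (x(i := t)))) has_real_derivative
      (\<Sum>j<m. partial_deriv j f (F (x(i := x i))) * partial_deriv i (\<lambda>x. F x j) x)) (at (x i))"
      by (rule chain_rule_curve[OF W, of f "\<lambda>t. F (x(i := t))"])
    then show ?thesis by simp
  qed
  have "cont_diff k n V (partial_deriv i (\<lambda>x. f (F x)))" if "i < n" for i
  proof (rule cont_diff_cong[OF V])
    show "(\<Sum>j<m. partial_deriv j f (F x) * partial_deriv i (\<lambda>x. F x j) x) =
        partial_deriv i (\<lambda>x. f (F x)) x" if "x \<in> V" for x
      using partial_derivI[OF D[OF \<open>i < n\<close> that]] by simp
    show "cont_diff k n V (\<lambda>x. \<Sum>j<m. partial_deriv j f (F x) * partial_deriv i (\<lambda>x. F x j) x)"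
    proof (intro cont_diff_sum[OF V] cont_diff_mult[OF V])
      fix j assume "j \<in> {..<m}"
      then show "cont_diff k n V (\<lambda>x. partial_deriv j f (F x))"
        using Suc.prems(1) cont_diff_Suc_imp[OF Suc.prems(2)]
        by - (rule Suc.IH, auto)
      show "cont_diff k n V (partial_deriv i (\<lambda>x. F x j))"
        using Suc.prems(2)[of j] \<open>j \<in> {..<m}\<close> that by simp
    qed
  qed
  moreover have "continuous_on V (\<lambda>x. f (F x))"
    by (rule cont_diff_imp_continuous[OF Suc.IH[OF cont_diff_Suc_imp[OF Suc.prems(1)]
          cont_diff_Suc_imp[OF Suc.prems(2)]]])
  ultimately show ?case
    using D by (auto simp: admits_partials_def field_differentiable_def)
qed

lemma smooth_fun_on_compose:
  assumes "openin (Euclidean_space n) V" "openin (Euclidean_space m) W"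
    and "smooth_fun_on m W f" "\<And>x. x \<in> V \<Longrightarrow> F x \<in> W"
    and "\<And>j. j < m \<Longrightarrow> smooth_fun_on n V (\<lambda>x. F x j)"
  shows "smooth_fun_on n V (\<lambda>x. f (F x))"
  unfolding smooth_fun_on_iff_cont_diff
proof
  fix k
  show "cont_diff k n V (\<lambda>x. f (F x))"
    by (rule cont_diff_compose[OF assms(1,2) _ assms(4)])
      (use assms(3,5) in \<open>auto simp: smooth_fun_on_iff_cont_diff\<close>)
qed

lemma smooth_fun_on_cong:
  assumes "openin (Euclidean_space n) V" "\<And>x. x \<in> V \<Longrightarrow> f x = g x" "smooth_fun_on n V f"
  shows "smooth_fun_on n V g"
  using assms(3) cont_diff_cong[OF assms(1,2)] unfolding smooth_fun_on_iff_cont_diff by simp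

lemma smooth_fun_on_locally:
  assumes "\<And>x. x \<in> V \<Longrightarrow> \<exists>O'. openin (Euclidean_space n) O' \<and> x \<in> O' \<and> smooth_fun_on n O' f"
    and V: "openin (Euclidean_space n) V"
  shows "smooth_fun_on n V f"
  unfolding smooth_fun_on_def
proof (intro allI impI conjI ballI)
  fix js assume js: "set js \<subseteq> {..<n}"
  show "continuous_on V (iterated_partial js f)"
    unfolding continuous_on_eq_continuous_within
  proof
    fix x assume x: "x \<in> V"
    then obtain O' where O': "openin (Euclidean_space n) O'" "x \<in> O'" "smooth_fun_on n O' f"
      using assms(1) by blast
    obtain U where U: "open U" "O' = U \<inter> {x. \<forall>i\<ge>n. x i = 0}"
      using O'(1) by (auto simp: openin_Euclidean_space_iff)
    have "continuous (at x within O') (iterated_partial js f)"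
      using O' js by (auto simp: smooth_fun_on_def continuous_on_eq_continuous_within)
    then have "continuous (at x within V \<inter> O') (iterated_partial js f)"
      by (rule continuous_within_subset) auto
    moreover have "V \<inter> O' = V \<inter> U"
      using U(2) V by (auto simp: openin_Euclidean_space_iff)
    moreover have "at x within V \<inter> U = at x within V"
      using U O'(2) by (intro at_within_nhd[of x U]) auto
    ultimately show "continuous (at x within V) (iterated_partial js f)"
      by simp
  qed
next
  fix js i x assume "set js \<subseteq> {..<n}" "i < n" "x \<in> V"
  then show "(\<lambda>t. iterated_partial js f (x(i := t))) field_differentiable at (x i)"
    using assms(1)[of x] by (auto simp: smooth_fun_on_def)
qed

lemma smooth_fun_on_coord: "smooth_fun_on n V (\<lambda>x. x j)"
  and smooth_fun_on_const: "smooth_fun_on n V (\<lambda>x. c)"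
  by (simp_all add: smooth_fun_on_iff_cont_diff cont_diff_coord cont_diff_const)

section \<open>Left translations of the second factor\<close>

text \<open>
  The charts that generate the product atlas, as a definition of their own so that images of
  rectangles can be computed once and for all.
\<close>

definition chart_prod :: "nat \<Rightarrow> ('a \<Rightarrow> nat \<Rightarrow> real) \<Rightarrow> ('b \<Rightarrow> nat \<Rightarrow> real) \<Rightarrow> 'a \<times> 'b \<Rightarrow> nat \<Rightarrow> real" where
  "chart_prod n \<phi> \<psi> = (\<lambda>(x, y) i. if i < n then \<phi> x i else \<psi> y (i - n))"

lemma prod_atlas_eq:
  "prod_atlas n \<A> \<B> = {(U \<times> V, chart_prod n \<phi> \<psi>) | U \<phi> V \<psi>. (U, \<phi>) \<in> \<A> \<and> (V, \<psi>) \<in> \<B>}"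
  unfolding prod_atlas_def chart_prod_def by auto

lemma is_chart_inj_on: "is_chart n (U, \<phi>) \<Longrightarrow> inj_on \<phi> U"
  unfolding is_chart_def by (auto simp: homeomorphic_map_def)

lemma is_chart_openin_image:
  assumes c: "is_chart n (U, \<phi>)" and V: "open V" "V \<subseteq> U"
  shows "openin (Euclidean_space n) (\<phi> ` V)"
proof -
  have "open_map (top_of_set U) (subtopology (Euclidean_space n) (\<phi> ` U)) \<phi>"
    using c by (auto simp: is_chart_def intro: homeomorphic_imp_open_map)
  moreover have "openin (top_of_set U) V"
    using V by (auto simp: openin_open)
  ultimately have "openin (subtopology (Euclidean_space n) (\<phi> ` U)) (\<phi> ` V)"
    by (simp add: open_map_def)
  moreover have "openin (Euclidean_space n) (\<phi> ` U)"
    using c by (auto simp: is_chart_def)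
  ultimately show ?thesis
    by (rule openin_trans_full)
qed

lemma openin_Euclidean_space_Times:
  assumes "openin (Euclidean_space n) A" "openin (Euclidean_space m) B"
  shows "openin (Euclidean_space (n + m))
    {z. (\<forall>i\<ge>n+m. z i = 0) \<and> (\<lambda>i. if i < n then z i else 0) \<in> A \<and> (\<lambda>i. z (n + i)) \<in> B}"
proof -
  obtain A' B' where A': "open A'" "A = A' \<inter> {x. \<forall>i\<ge>n. x i = 0}"
    and B': "open B'" "B = B' \<inter> {x. \<forall>i\<ge>m. x i = 0}"
    using assms by (auto simp: openin_Euclidean_space_iff)
  define pA pB where "pA z = (\<lambda>i. if i < n then z i else 0)" and "pB z = (\<lambda>i. z (n + i))"
    for z :: "nat \<Rightarrow> real"
  have "continuous_on UNIV (\<lambda>z. pA z i)" for i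
    unfolding pA_def by (cases "i < n") (auto intro: continuous_on_product_coordinates)
  then have "continuous_on UNIV pA"
    by (rule continuous_on_coordinatewise_then_product)
  moreover have "continuous_on UNIV pB"
    unfolding pB_def
    by (rule continuous_on_coordinatewise_then_product) (rule continuous_on_product_coordinates)
  ultimately have "open (pA -` A' \<inter> pB -` B')"
    using A'(1) B'(1) by (intro open_Int open_vimage)
  moreover have "{z. (\<forall>i\<ge>n+m. z i = 0) \<and> pA z \<in> A \<and> pB z \<in> B} =
      (pA -` A' \<inter> pB -` B') \<inter> {z. \<forall>i\<ge>n+m. z i = 0}"
    unfolding A'(2) B'(2) by (auto simp: pA_def pB_def)
  ultimately show ?thesis
    unfolding openin_Euclidean_space_iff pA_def pB_def by blast
qed

lemma chart_prod_image_Times: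
  assumes A: "\<phi> ` U \<subseteq> {x. \<forall>i\<ge>n. x i = 0}" and B: "\<psi> ` V \<subseteq> {x. \<forall>i\<ge>m. x i = 0}"
  shows "chart_prod n \<phi> \<psi> ` (U \<times> V) =
    {z. (\<forall>i\<ge>n+m. z i = 0) \<and> (\<lambda>i. if i < n then z i else 0) \<in> \<phi> ` U \<and> (\<lambda>i. z (n + i)) \<in> \<psi> ` V}"
    (is "_ = ?R")
proof
  have 1: "(\<lambda>i. if i < n then chart_prod n \<phi> \<psi> (x, y) i else 0) = \<phi> x" if "x \<in> U" for x y
    using A that by (auto simp: chart_prod_def fun_eq_iff)
  have 2: "(\<lambda>i. chart_prod n \<phi> \<psi> (x, y) (n + i)) = \<psi> y" for x y
    by (auto simp: chart_prod_def fun_eq_iff)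
  have 3: "chart_prod n \<phi> \<psi> (x, y) i = 0" if "y \<in> V" "i \<ge> n + m" for x y i
    using B that by (auto simp: chart_prod_def)
  show "chart_prod n \<phi> \<psi> ` (U \<times> V) \<subseteq> ?R"
    by (auto simp: 1 2 3)
  show "?R \<subseteq> chart_prod n \<phi> \<psi> ` (U \<times> V)"
  proof
    fix z assume z: "z \<in> ?R"
    then obtain x y where xy: "x \<in> U" "y \<in> V" and
      eq: "(\<lambda>i. if i < n then z i else 0) = \<phi> x" "(\<lambda>i. z (n + i)) = \<psi> y"
      by auto
    have "z i = chart_prod n \<phi> \<psi> (x, y) i" for i
      using fun_cong[OF eq(1), of i] fun_cong[OF eq(2), of "i - n"]
      by (auto simp: chart_prod_def split: if_splits)
    then have "z = chart_prod n \<phi> \<psi> (x, y)"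
      by (rule ext)
    with xy show "z \<in> chart_prod n \<phi> \<psi> ` (U \<times> V)"
      by blast
  qed
qed

lemma is_chart_zero:
  assumes "is_chart n (U, \<phi>)" "x \<in> U" "i \<ge> n" shows "\<phi> x i = 0"
proof -
  have "openin (Euclidean_space n) (\<phi> ` U)"
    using assms(1) by (simp add: is_chart_def)
  from openin_Euclidean_space_zero[OF this _ assms(3)] assms(2) show ?thesis
    by blast
qed

lemma openin_chart_prod_image:
  assumes c: "is_chart n (U, \<phi>)" "is_chart m (V, \<psi>)"
    and "open U'" "U' \<subseteq> U" "open V'" "V' \<subseteq> V"
  shows "openin (Euclidean_space (n + m)) (chart_prod n \<phi> \<psi> ` (U' \<times> V'))"
proof -
  have "\<phi> ` U' \<subseteq> {x. \<forall>i\<ge>n. x i = 0}" "\<psi> ` V' \<subseteq> {x. \<forall>i\<ge>m. x i = 0}"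
    using is_chart_zero[OF c(1)] is_chart_zero[OF c(2)] assms by auto
  from chart_prod_image_Times[OF this] show ?thesis
    using is_chart_openin_image[OF c(1)] is_chart_openin_image[OF c(2)] assms
    by (simp add: openin_Euclidean_space_Times)
qed

lemma inj_on_chart_prod:
  assumes c: "is_chart n (U, \<phi>)" "is_chart m (V, \<psi>)"
  shows "inj_on (chart_prod n \<phi> \<psi>) (U \<times> V)"
proof (rule inj_onI, clarsimp)
  fix x y x' y' assume *: "x \<in> U" "y \<in> V" "x' \<in> U" "y' \<in> V"
    and eq: "chart_prod n \<phi> \<psi> (x, y) = chart_prod n \<phi> \<psi> (x', y')"
  have "\<phi> x i = \<phi> x' i" for i
  proof (cases "i < n")
    case True
    then show ?thesis using fun_cong[OF eq, of i] by (simp add: chart_prod_def)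
  qed (use is_chart_zero[OF c(1)] * in simp)
  then have "\<phi> x = \<phi> x'" ..
  moreover have "\<psi> y i = \<psi> y' i" for i
    using fun_cong[OF eq, of "n + i"] by (simp add: chart_prod_def)
  then have "\<psi> y = \<psi> y'" ..
  ultimately show "x = x' \<and> y = y'"
    using is_chart_inj_on[OF c(1)] is_chart_inj_on[OF c(2)] * by (auto dest: inj_onD)
qed

lemma smooth_manifold_chart_at:
  assumes "smooth_manifold n \<A>"
  obtains U \<phi> where "(U, \<phi>) \<in> \<A>" "p \<in> U"
proof -
  have "(\<Union>(U, \<phi>)\<in>\<A>. U) = UNIV"
    using assms by (simp add: smooth_manifold_def)
  then have "p \<in> (\<Union>(U, \<phi>)\<in>\<A>. U)" by simp
  then show thesis using that by blast
qed

lemma smooth_manifold_is_chart: "smooth_manifold n \<A> \<Longrightarrow> c \<in> \<A> \<Longrightarrow> is_chart n c"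
  by (simp add: smooth_manifold_def)

lemma is_chart_open: "is_chart n (U, \<phi>) \<Longrightarrow> open U"
  by (simp add: is_chart_def)

lemma lie_group_continuous:
  assumes "lie_group m \<A> gmult gone ginv"
  shows "continuous_on UNIV (\<lambda>(g, h). gmult g h)" "continuous_on UNIV ginv"
  using assms by (simp_all add: lie_group_def smooth_map_def)

text \<open>
  Around a given point the translate is \<open>f\<close>, read in a product chart, composed with a map that
  keeps the first \<open>n\<close> coordinates and sends the others through multiplication by \<open>g\<close>. The
  latter is the multiplication of the group, which is jointly smooth, with the first argument
  held at \<open>g\<close>; in coordinates both compositions are instances of the chain rule.
\<close>

lemma smooth_translate:
  assumes X: "smooth_manifold n \<A>" and G: "lie_group m \<B> gmult gone ginv"
    and f: "smooth (n + m) (prod_atlas n \<A> \<B>) f"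
  shows "smooth (n + m) (prod_atlas n \<A> \<B>) (translate gmult g f)"
proof -
  have GM: "smooth_manifold m \<B>"
    using G by (simp add: lie_group_def)
  have "smooth_fun_on (n + m) (chart_prod n \<phi> \<psi> ` (U \<times> V))
      (\<lambda>y. translate gmult g f (inv_into (U \<times> V) (chart_prod n \<phi> \<psi>) y))"
    if U: "(U, \<phi>) \<in> \<A>" and V: "(V, \<psi>) \<in> \<B>" for U \<phi> V \<psi>
  proof (rule smooth_fun_on_locally)
    note cU = smooth_manifold_is_chart[OF X U] and cV = smooth_manifold_is_chart[OF GM V]
    have oU: "open U" and oV: "open V"
      using cU cV by (simp_all add: is_chart_def)
    show "openin (Euclidean_space (n + m)) (chart_prod n \<phi> \<psi> ` (U \<times> V))"
      by (rule openin_chart_prod_image[OF cU cV oU _ oV]) auto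
    fix z assume "z \<in> chart_prod n \<phi> \<psi> ` (U \<times> V)"
    then obtain x0 h0 where z: "z = chart_prod n \<phi> \<psi> (x0, h0)" "x0 \<in> U" "h0 \<in> V"
      by auto
    obtain U1 \<phi>1 where U1: "(U1, \<phi>1) \<in> \<B>" "g \<in> U1"
      using smooth_manifold_chart_at[OF GM] .
    obtain V' \<psi>' where V': "(V', \<psi>') \<in> \<B>" "gmult g h0 \<in> V'"
      using smooth_manifold_chart_at[OF GM] .
    note cU1 = smooth_manifold_is_chart[OF GM U1(1)] and cV' = smooth_manifold_is_chart[OF GM V'(1)]
    have "open ((\<lambda>(g, h). gmult g h) -` V')"
      using lie_group_continuous(1)[OF G] is_chart_open[OF cV'] by (rule open_vimage[rotated])
    then obtain N1 N2 where N: "open N1" "open N2" "(g, h0) \<in> N1 \<times> N2"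
      "N1 \<times> N2 \<subseteq> (\<lambda>(g, h). gmult g h) -` V'"
      by (rule open_prod_elim) (use V'(2) in auto)
    define O' where "O' = chart_prod n \<phi> \<psi> ` (U \<times> (V \<inter> N2))"
    define W2 where "W2 = chart_prod m \<phi>1 \<psi> ` ((U1 \<inter> N1) \<times> (V \<inter> N2))"
    define W3 where "W3 = chart_prod n \<phi> \<psi>' ` (U \<times> V')"
    have oO: "openin (Euclidean_space (n + m)) O'"
      unfolding O'_def using oU oV N by (intro openin_chart_prod_image[OF cU cV]) auto
    have oW2: "openin (Euclidean_space (m + m)) W2"
      unfolding W2_def using oV N is_chart_open[OF cU1]
      by (intro openin_chart_prod_image[OF cU1 cV]) auto
    have oW3: "openin (Euclidean_space (n + m)) W3"
      unfolding W3_def using is_chart_open[OF cV'] oU by (intro openin_chart_prod_image[OF cU cV']) auto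
    define K where "K j y = \<psi>' ((\<lambda>(g, h). gmult g h) (inv_into (U1 \<times> V) (chart_prod m \<phi>1 \<psi>) y)) j" for j y
    have K: "smooth_fun_on (m + m) W2 (K j)" if "j < m" for j
    proof (rule smooth_fun_on_subset)
      have "(U1 \<times> V, chart_prod m \<phi>1 \<psi>) \<in> prod_atlas m \<B> \<B>"
        using U1 V by (auto simp: prod_atlas_eq)
      then show "smooth_fun_on (m + m)
          (chart_prod m \<phi>1 \<psi> ` ((U1 \<times> V) \<inter> (\<lambda>(g, h). gmult g h) -` V')) (K j)"
        using G V'(1) that unfolding lie_group_def smooth_map_def K_def by fast
      show "W2 \<subseteq> chart_prod m \<phi>1 \<psi> ` ((U1 \<times> V) \<inter> (\<lambda>(g, h). gmult g h) -` V')"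
        unfolding W2_def using N(4) by auto
    qed
    have K_eq: "K j (chart_prod m \<phi>1 \<psi> (g, h)) = \<psi>' (gmult g h) j" if "h \<in> V" for h j
      unfolding K_def using that U1(2) by (simp add: inv_into_f_f[OF inj_on_chart_prod[OF cU1 cV]])
    \<comment> \<open>the coordinates of the pair \<open>(g, h)\<close> in terms of those of \<open>(x, h)\<close>\<close>
    define E where "E y = (\<lambda>i. if i < m then \<phi>1 g i else if i < m + m then y (n + (i - m)) else 0)"
      for y :: "nat \<Rightarrow> real"
    have E: "E (chart_prod n \<phi> \<psi> (x, h)) = chart_prod m \<phi>1 \<psi> (g, h)" if "h \<in> V" for x h
      using is_chart_zero[OF cV that] by (auto simp: E_def chart_prod_def fun_eq_iff)
    \<comment> \<open>the coordinates of \<open>(x, g h)\<close> in terms of those of \<open>(x, h)\<close>\<close>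
    define F where "F y = (\<lambda>i. if i < n then y i else if i < n + m then K (i - n) (E y) else 0)"
      for y :: "nat \<Rightarrow> real"
    have F: "F (chart_prod n \<phi> \<psi> (x, h)) = chart_prod n \<phi> \<psi>' (x, gmult g h)"
      if h: "h \<in> V \<inter> N2" for x h
    proof
      fix i
      have "gmult g h \<in> V'"
        using h N(3,4) by auto
      from is_chart_zero[OF cV' this, of "i - n"] h
      show "F (chart_prod n \<phi> \<psi> (x, h)) i = chart_prod n \<phi> \<psi>' (x, gmult g h) i"
        by (auto simp: F_def E K_eq) (auto simp: chart_prod_def)
    qed
    have EW: "E y \<in> W2" if "y \<in> O'" for y
      using that N(3) U1(2) by (auto simp: O'_def W2_def E)
    have FW: "F y \<in> W3" if "y \<in> O'" for y
    proof -
      from that obtain x h where xh: "x \<in> U" "h \<in> V \<inter> N2" "y = chart_prod n \<phi> \<psi> (x, h)"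
        by (auto simp: O'_def)
      then have "gmult g h \<in> V'"
        using N(3,4) by auto
      then show ?thesis
        unfolding W3_def xh(3) F[OF xh(2)] using xh by blast
    qed
    have "smooth_fun_on (n + m) O' (\<lambda>y. F y j)" if "j < n + m" for j
    proof (cases "j < n")
      case True
      then show ?thesis
        by (simp add: F_def smooth_fun_on_coord)
    next
      case False
      have "smooth_fun_on (n + m) O' (\<lambda>y. K (j - n) (E y))"
      proof (rule smooth_fun_on_compose[OF oO oW2 K EW])
        show "j - n < m" using False that by simp
        show "smooth_fun_on (n + m) O' (\<lambda>y. E y i)" for i
          unfolding E_def
          by (cases "i < m"; cases "i < m + m") (simp_all add: smooth_fun_on_coord smooth_fun_on_const)
      qed
      then show ?thesis
        using False that by (simp add: F_def)
    qed
    moreover have "smooth_fun_on (n + m) W3 (\<lambda>y. f (inv_into (U \<times> V') (chart_prod n \<phi> \<psi>') y))"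
    proof -
      have "(U \<times> V', chart_prod n \<phi> \<psi>') \<in> prod_atlas n \<A> \<B>"
        using U V' by (auto simp: prod_atlas_eq)
      then show ?thesis
        using f unfolding smooth_def W3_def by fast
    qed
    ultimately have "smooth_fun_on (n + m) O' (\<lambda>y. f (inv_into (U \<times> V') (chart_prod n \<phi> \<psi>') (F y)))"
      by - (rule smooth_fun_on_compose[OF oO oW3 _ FW])
    moreover have "f (inv_into (U \<times> V') (chart_prod n \<phi> \<psi>') (F y)) =
        translate gmult g f (inv_into (U \<times> V) (chart_prod n \<phi> \<psi>) y)" if "y \<in> O'" for y
    proof -
      from that obtain x h where xh: "x \<in> U" "h \<in> V \<inter> N2" "y = chart_prod n \<phi> \<psi> (x, h)"
        by (auto simp: O'_def)
      then have "gmult g h \<in> V'"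
        using N(3,4) by auto
      with xh show ?thesis
        by (simp add: F inv_into_f_f[OF inj_on_chart_prod[OF cU cV]]
            inv_into_f_f[OF inj_on_chart_prod[OF cU cV']] translate_def)
    qed
    ultimately have "smooth_fun_on (n + m) O'
        (\<lambda>y. translate gmult g f (inv_into (U \<times> V) (chart_prod n \<phi> \<psi>) y))"
      by (rule smooth_fun_on_cong[OF oO, rotated])
    moreover have "z \<in> O'"
      unfolding O'_def z(1) using z(2,3) N(3) by blast
    ultimately show "\<exists>O'. openin (Euclidean_space (n + m)) O' \<and> z \<in> O' \<and> smooth_fun_on (n + m) O'
        (\<lambda>y. translate gmult g f (inv_into (U \<times> V) (chart_prod n \<phi> \<psi>) y))"
      using oO by blast
  qed
  then show ?thesis
    by (auto simp: smooth_def prod_atlas_eq)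
qed

definition left_mult :: "('g \<Rightarrow> 'g \<Rightarrow> 'g) \<Rightarrow> 'g \<Rightarrow> 'x \<times> 'g \<Rightarrow> 'x \<times> 'g" where
  "left_mult gmult g = (\<lambda>(x, h). (x, gmult g h))"

lemma translate_eq_comp: "translate gmult g f = f \<circ> left_mult gmult g"
  by (auto simp: translate_def left_mult_def)

lemma continuous_left_mult:
  assumes "lie_group m \<B> gmult gone ginv"
  shows "continuous_on UNIV (left_mult gmult g)"
  unfolding left_mult_def case_prod_beta
  by (intro continuous_on_Pair continuous_on_fst continuous_on_id
      continuous_on_compose2[OF lie_group_continuous(1)[OF assms], of _ "\<lambda>z. (g, snd z)", simplified]
      continuous_on_const continuous_on_snd)

lemma left_mult_left_mult:
  assumes "group gmult gone ginv"
  shows "left_mult gmult g (left_mult gmult h z) = left_mult gmult (gmult g h) z"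
    and "left_mult gmult gone z = z"
proof -
  interpret group gmult gone ginv by fact
  show "left_mult gmult g (left_mult gmult h z) = left_mult gmult (gmult g h) z"
    "left_mult gmult gone z = z"
    by (simp_all add: left_mult_def assoc split: prod.split)
qed

text \<open>
  The support of the translate is contained in the image of the support of \<open>f\<close> under the
  inverse translation.
\<close>

lemma test_function_translate:
  assumes X: "smooth_manifold n \<A>" and G: "lie_group m \<B> gmult gone ginv"
    and f: "test_function (n + m) (prod_atlas n \<A> \<B>) f"
  shows "test_function (n + m) (prod_atlas n \<A> \<B>) (translate gmult g f)"
  unfolding test_function_def
proof
  have grp: "group gmult gone ginv"
    using G by (simp add: lie_group_def)
  interpret group gmult gone ginv by (rule grp)
  show "smooth (n + m) (prod_atlas n \<A> \<B>) (translate gmult g f)"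
    using f by (intro smooth_translate[OF X G]) (simp add: test_function_def)
  let ?K = "left_mult gmult (ginv g) ` closure {z. f z \<noteq> 0}"
  have K: "compact ?K"
    using f continuous_left_mult[OF G, of "ginv g"]
    by (intro compact_continuous_image) (auto simp: test_function_def intro: continuous_on_subset)
  have "{z. translate gmult g f z \<noteq> 0} \<subseteq> ?K"
  proof
    fix z assume "z \<in> {z. translate gmult g f z \<noteq> 0}"
    then have "left_mult gmult g z \<in> closure {z. f z \<noteq> 0}"
      using closure_subset by (fastforce simp: translate_eq_comp)
    moreover have "z = left_mult gmult (ginv g) (left_mult gmult g z)"
      by (simp add: left_mult_left_mult[OF grp])
    ultimately show "z \<in> ?K" by blast
  qed
  then have "closure {z. translate gmult g f z \<noteq> 0} \<subseteq> ?K"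
    using K by (intro closure_minimal compact_imp_closed)
  then show "compact (closure {z. translate gmult g f z \<noteq> 0})"
    using K by (metis closed_Int_compact closed_closure inf.absorb1)
qed

section \<open>Path space and translated laws\<close>

definition map_path :: "('m \<Rightarrow> 'k) \<Rightarrow> (real \<Rightarrow> 'm) \<Rightarrow> real \<Rightarrow> 'k" where
  "map_path T \<omega> = restrict (\<lambda>t. T (\<omega> t)) {0..}"

lemma map_path_apply [simp]: "t \<ge> 0 \<Longrightarrow> map_path T \<omega> t = T (\<omega> t)"
  by (simp add: map_path_def)

lemma shift_apply [simp]: "t \<ge> 0 \<Longrightarrow> shift s \<omega> t = \<omega> (t + s)"
  by (simp add: shift_def)

lemma map_path_in_paths:
  assumes "continuous_on UNIV T" "\<omega> \<in> paths"
  shows "map_path T \<omega> \<in> paths"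
proof -
  have "continuous_on {0..} (\<lambda>t. T (\<omega> t))"
    by (rule continuous_on_compose2[OF assms(1)]) (use assms(2) in \<open>auto simp: paths_def\<close>)
  then have "continuous_on {0..} (map_path T \<omega>)"
    by (rule continuous_on_eq) simp
  then show ?thesis
    by (simp add: paths_def map_path_def)
qed

lemma shift_in_paths:
  assumes "s \<ge> 0" "\<omega> \<in> paths"
  shows "shift s \<omega> \<in> paths"
proof -
  have "continuous_on {0..} (\<lambda>t. \<omega> (t + s))"
  proof (rule continuous_on_compose2[of "{0..}" \<omega>])
    show "continuous_on {0..} \<omega>"
      using assms(2) by (simp add: paths_def)
    show "continuous_on {0..} (\<lambda>t. t + s)"
      by (intro continuous_on_add continuous_on_id continuous_on_const)
  qed (use assms(1) in auto)
  then have "continuous_on {0..} (shift s \<omega>)"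
    by (rule continuous_on_eq) simp
  then show ?thesis
    by (simp add: paths_def shift_def)
qed

lemma shift_map_path: "s \<ge> 0 \<Longrightarrow> shift s (map_path T \<omega>) = map_path T (shift s \<omega>)"
  by (auto simp: shift_def map_path_def fun_eq_iff)

lemma paths_eqI:
  assumes "\<omega> \<in> paths" "\<omega>' \<in> paths" "\<And>t. t \<ge> 0 \<Longrightarrow> \<omega> t = \<omega>' t"
  shows "\<omega> = \<omega>'"
  using assms by (intro extensionalityI[of _ "{0..}"]) (auto simp: paths_def)

lemma map_path_map_path: "map_path S (map_path T \<omega>) = map_path (\<lambda>z. S (T z)) \<omega>"
  by (auto simp: map_path_def fun_eq_iff)

lemma map_path_id: "\<omega> \<in> paths \<Longrightarrow> map_path (\<lambda>z. z) \<omega> = \<omega>"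
  unfolding paths_def map_path_def by (simp add: extensional_restrict)

lemma topspace_compact_open_topology: "topspace compact_open_topology = paths"
proof -
  have "\<Union>{{\<omega> \<in> paths. \<omega> ` K \<subseteq> U} | K U. compact K \<and> K \<subseteq> {0..} \<and> open (U :: 'a set)} = (paths :: (real \<Rightarrow> 'a) set)"
  proof
    show "paths \<subseteq> \<Union>{{\<omega> \<in> paths. \<omega> ` K \<subseteq> U} | K U. compact K \<and> K \<subseteq> {0..} \<and> open (U :: 'a set)}"
      by (rule subsetI, rule UnionI[where X = "{\<omega> \<in> paths. \<omega> ` {} \<subseteq> UNIV}"]) blast+
  qed auto
  then show ?thesis
    unfolding compact_open_topology_def by simp
qed

lemma space_path_space [simp]: "space path_space = paths"
  unfolding path_space_def
  by (rule space_measure_of) (use openin_subset topspace_compact_open_topology in blast)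

lemma sets_path_space: "sets path_space = sigma_sets paths {W. openin compact_open_topology W}"
  unfolding path_space_def
  by (rule sets_measure_of) (use openin_subset topspace_compact_open_topology in blast)

lemma openin_compact_open_basic:
  "compact K \<Longrightarrow> K \<subseteq> {0..} \<Longrightarrow> open U \<Longrightarrow> openin compact_open_topology {\<omega> \<in> paths. \<omega> ` K \<subseteq> U}"
  unfolding compact_open_topology_def by (rule topology_generated_by_Basis) blast

text \<open>
  A map of path spaces is continuous, hence Borel measurable, as soon as it pulls the
  subbasic sets of the compact-open topology back to open sets.
\<close>

lemma measurable_path_spaceI:
  assumes \<Phi>: "\<And>\<omega>. \<omega> \<in> paths \<Longrightarrow> \<Phi> \<omega> \<in> paths"
    and o: "\<And>K U. compact K \<Longrightarrow> K \<subseteq> {0..} \<Longrightarrow> open U \<Longrightarrow>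
      openin compact_open_topology {\<omega> \<in> paths. \<Phi> \<omega> ` K \<subseteq> U}"
  shows "\<Phi> \<in> path_space \<rightarrow>\<^sub>M path_space"
proof -
  have "continuous_map compact_open_topology compact_open_topology \<Phi>"
    unfolding compact_open_topology_def[where 'm = 'b]
  proof (rule continuous_on_generated_topo)
    fix W assume "W \<in> {{\<omega> \<in> paths. \<omega> ` K \<subseteq> U} | K U. compact K \<and> K \<subseteq> {0..} \<and> open (U :: 'b set)}"
    then obtain K and U :: "'b set" where *: "W = {\<omega> \<in> paths. \<omega> ` K \<subseteq> U}" "compact K" "K \<subseteq> {0..}" "open U"
      by blast
    have "\<Phi> -` W \<inter> topspace compact_open_topology = {\<omega> \<in> paths. \<Phi> \<omega> ` K \<subseteq> U}"
      using \<Phi> unfolding *(1) topspace_compact_open_topology by auto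
    then show "openin compact_open_topology (\<Phi> -` W \<inter> topspace compact_open_topology)"
      using o[OF *(2-4)] by simp
  next
    have "\<Phi> ` topspace compact_open_topology \<subseteq> topspace compact_open_topology"
      using \<Phi> by (auto simp: topspace_compact_open_topology)
    then show "\<Phi> ` topspace compact_open_topology \<subseteq>
      \<Union>{{\<omega> \<in> paths. \<omega> ` K \<subseteq> U} | K U. compact K \<and> K \<subseteq> {0..} \<and> open (U :: 'b set)}"
      by (simp add: compact_open_topology_def[where 'm = 'b])
  qed
  then have *: "openin compact_open_topology {\<omega> \<in> paths. \<Phi> \<omega> \<in> W}" if "openin compact_open_topology W" for W
    using openin_continuous_map_preimage[OF \<open>continuous_map _ _ \<Phi>\<close> that]
    by (simp add: topspace_compact_open_topology)
  show ?thesis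
    unfolding path_space_def[where 'm = 'b]
  proof (rule measurable_measure_of)
    show "{W. openin compact_open_topology W} \<subseteq> Pow (paths :: (real \<Rightarrow> 'b) set)"
      using openin_subset topspace_compact_open_topology by blast
    show "\<Phi> \<in> space path_space \<rightarrow> paths"
      using \<Phi> by auto
    fix W assume "W \<in> {W. openin compact_open_topology (W :: (real \<Rightarrow> 'b) set)}"
    moreover have "\<Phi> -` W \<inter> space path_space = {\<omega> \<in> paths. \<Phi> \<omega> \<in> W}"
      by auto
    ultimately show "\<Phi> -` W \<inter> space path_space \<in> sets path_space"
      using * by (simp add: sets_path_space sigma_sets.Basic)
  qed
qed

lemma measurable_map_path:
  assumes T: "continuous_on UNIV T"
  shows "map_path T \<in> path_space \<rightarrow>\<^sub>M path_space"
proof (rule measurable_path_spaceI)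
  fix K :: "real set" and U :: "'b set" assume *: "compact K" "K \<subseteq> {0..}" "open U"
  have "{\<omega> \<in> paths. map_path T \<omega> ` K \<subseteq> U} = {\<omega> \<in> paths. \<omega> ` K \<subseteq> T -` U}"
    using *(2) by (auto simp: subset_eq image_iff)
  then show "openin compact_open_topology {\<omega> \<in> paths. map_path T \<omega> ` K \<subseteq> U}"
    using * open_vimage[OF *(3) T] by (simp add: openin_compact_open_basic)
qed (rule map_path_in_paths[OF T])

lemma measurable_shift:
  assumes s: "s \<ge> 0"
  shows "shift s \<in> path_space \<rightarrow>\<^sub>M (path_space :: (real \<Rightarrow> 'm::topological_space) measure)"
proof (rule measurable_path_spaceI)
  fix K :: "real set" and U :: "'m set" assume *: "compact K" "K \<subseteq> {0..}" "open U"
  have eq: "{\<omega> \<in> paths. shift s \<omega> ` K \<subseteq> U} = {\<omega> \<in> paths. \<omega> ` ((\<lambda>t. t + s) ` K) \<subseteq> U}"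
    using *(2) by (auto simp: subset_eq image_iff)
  show "openin compact_open_topology {\<omega> \<in> paths. shift s \<omega> ` K \<subseteq> U}"
    unfolding eq
  proof (rule openin_compact_open_basic)
    show "compact ((\<lambda>t. t + s) ` K)"
      using *(1) by (intro compact_continuous_image continuous_on_add continuous_on_id continuous_on_const)
  qed (use * s in auto)
qed (rule shift_in_paths[OF s])

lemma measurable_eval [measurable]:
  assumes "s \<ge> 0"
  shows "(\<lambda>\<omega>. \<omega> s) \<in> path_space \<rightarrow>\<^sub>M borel"
proof (rule borel_measurableI)
  fix U :: "'a set" assume U: "open U"
  have "(\<lambda>\<omega>. \<omega> s) -` U \<inter> space path_space = {\<omega> \<in> paths. \<omega> ` {s} \<subseteq> U}"
    by auto
  then show "(\<lambda>\<omega>. \<omega> s) -` U \<inter> space path_space \<in> sets path_space"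
    using openin_compact_open_basic[of "{s}" U] assms U by (simp add: sets_path_space sigma_sets.Basic)
qed

lemma sets_path_filtration:
  "sets (path_filtration t) =
     sigma_sets paths {{\<omega> \<in> paths. \<omega> s \<in> B} | s B. 0 \<le> s \<and> ennreal s \<le> t \<and> B \<in> sets borel}"
  unfolding path_filtration_def by (rule sets_measure_of) auto

lemma space_path_filtration [simp]: "space (path_filtration t) = paths"
  by (rule path_filtration.space_F)

lemma measurable_eval_filtration:
  assumes "0 \<le> s" "ennreal s \<le> t"
  shows "(\<lambda>\<omega>. \<omega> s) \<in> path_filtration t \<rightarrow>\<^sub>M borel"
proof (rule measurableI)
  fix B :: "'a set" assume "B \<in> sets borel"
  moreover have "(\<lambda>\<omega>. \<omega> s) -` B \<inter> space (path_filtration t) = {\<omega> \<in> paths. \<omega> s \<in> B}"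
    by auto
  ultimately show "(\<lambda>\<omega>. \<omega> s) -` B \<inter> space (path_filtration t) \<in> sets (path_filtration t)"
    using assms unfolding sets_path_filtration by (intro sigma_sets.Basic) auto
qed auto

lemma measurable_path_filtrationI:
  assumes "\<And>x. x \<in> space N \<Longrightarrow> \<Phi> x \<in> paths"
    and "\<And>s. 0 \<le> s \<Longrightarrow> ennreal s \<le> t \<Longrightarrow> (\<lambda>x. \<Phi> x s) \<in> N \<rightarrow>\<^sub>M borel"
  shows "\<Phi> \<in> N \<rightarrow>\<^sub>M path_filtration t"
  unfolding path_filtration_def
proof (rule measurable_measure_of)
  fix A assume "A \<in> {{\<omega> \<in> paths. \<omega> s \<in> B} | s B. 0 \<le> s \<and> ennreal s \<le> t \<and> B \<in> sets (borel :: 'b measure)}"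
  then obtain s B where *: "A = {\<omega> \<in> paths. \<omega> s \<in> B}" "0 \<le> s" "ennreal s \<le> t" "B \<in> sets borel"
    by blast
  have "\<Phi> -` A \<inter> space N = (\<lambda>x. \<Phi> x s) -` B \<inter> space N"
    using assms(1) by (auto simp: *(1))
  then show "\<Phi> -` A \<inter> space N \<in> sets N"
    using measurable_sets[OF assms(2)[OF *(2,3)] *(4)] by simp
qed (use assms(1) in auto)

lemma path_filtration_subset: "sets (path_filtration t) \<subseteq> sets path_space"
proof -
  have "(\<lambda>\<omega>. \<omega>) \<in> path_space \<rightarrow>\<^sub>M path_filtration t"
    by (rule measurable_path_filtrationI) (auto intro: measurable_eval)
  then show ?thesis
    using measurable_sets[of "\<lambda>\<omega>. \<omega>" path_space "path_filtration t"] sets.sets_into_space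
    by (fastforce simp: Int_absorb2)
qed

lemma measurable_map_path_filtration:
  assumes T: "continuous_on UNIV T"
  shows "map_path T \<in> path_filtration t \<rightarrow>\<^sub>M path_filtration t"
proof (rule measurable_path_filtrationI)
  fix s assume s: "0 \<le> s" "ennreal s \<le> t"
  show "(\<lambda>\<omega>. map_path T \<omega> s) \<in> path_filtration t \<rightarrow>\<^sub>M borel"
    using measurable_compose[OF measurable_eval_filtration[OF s] borel_measurable_continuous_onI[OF T]] s
    by simp
qed (simp add: map_path_in_paths[OF T])

text \<open>
  The conditional expectation under the image law is identified by its integrals over the
  events of the filtration, which are transported back along \<open>\<Phi>\<close>.
\<close>

lemma path_martingale_distr:
  assumes M: "path_martingale Q M" and Q: "prob_space Q" "sets Q = sets path_space"
    and \<Phi>: "\<Phi> \<in> path_space \<rightarrow>\<^sub>M path_space"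
      "\<And>t. \<Phi> \<in> path_filtration t \<rightarrow>\<^sub>M path_filtration t"
    and M': "\<And>t. t \<ge> 0 \<Longrightarrow> M' t \<in> borel_measurable (path_filtration (ennreal t))"
    and eq: "\<And>t \<omega>. t \<ge> 0 \<Longrightarrow> \<omega> \<in> paths \<Longrightarrow> M' t (\<Phi> \<omega>) = M t \<omega>"
  shows "path_martingale (distr Q path_space \<Phi>) M'"
proof -
  let ?D = "distr Q path_space \<Phi>"
  interpret Q: prob_space Q by fact
  have spQ: "space Q = paths"
    using sets_eq_imp_space_eq[OF Q(2)] by simp
  have \<Phi>Q [measurable]: "\<Phi> \<in> Q \<rightarrow>\<^sub>M path_space"
    using \<Phi>(1) by (simp cong: measurable_cong_sets add: Q(2))
  interpret D: prob_space ?D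
    by (rule Q.prob_space_distr) measurable
  have sub: "M' t \<in> borel_measurable path_space" if "t \<ge> 0" for t
    by (rule measurable_from_subalg[OF _ M'[OF that]])
      (simp add: subalgebra_def path_filtration_subset)
  have intM: "integrable Q (M t)" if "t \<ge> 0" for t
    using M that by (simp add: path_martingale_def)
  have int: "integrable ?D (M' t)" if "t \<ge> 0" for t
  proof -
    have "integrable Q (\<lambda>\<omega>. M' t (\<Phi> \<omega>))"
      using Bochner_Integration.integrable_cong[of Q Q "\<lambda>\<omega>. M' t (\<Phi> \<omega>)" "M t"]
        intM[OF that] eq[OF that] spQ by simp
    then show ?thesis
      using sub[OF that] by (simp add: integrable_distr_eq)
  qed
  have "AE \<omega> in ?D. real_cond_exp ?D (path_filtration (ennreal s)) (M' t) \<omega> = M' s \<omega>"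
    if st: "s \<ge> 0" "t \<ge> s" for s t
  proof -
    have t: "t \<ge> 0" using st by simp
    interpret D: finite_measure_subalgebra ?D "path_filtration (ennreal s)"
      by unfold_locales (simp add: subalgebra_def path_filtration_subset)
    interpret Q: finite_measure_subalgebra Q "path_filtration (ennreal s)"
      by unfold_locales (simp add: subalgebra_def path_filtration_subset Q(2) spQ)
    show ?thesis
    proof (rule D.real_cond_exp_charact)
      fix A assume A: "A \<in> sets (path_filtration (ennreal s) :: (real \<Rightarrow> 'b) measure)"
      then have A': "A \<in> sets path_space"
        using path_filtration_subset by blast
      define A1 where "A1 = \<Phi> -` A \<inter> paths"
      have A1: "A1 \<in> sets (path_filtration (ennreal s))"
        using measurable_sets[OF \<Phi>(2) A] by (simp add: A1_def)
      have move: "(LINT \<omega>:A|?D. M' u \<omega>) = (LINT \<omega>:A1|Q. M u \<omega>)" if "u \<ge> 0" for u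
      proof -
        have "(LINT \<omega>:A|?D. M' u \<omega>) = (\<integral>\<omega>. indicator A (\<Phi> \<omega>) *\<^sub>R M' u (\<Phi> \<omega>) \<partial>Q)"
          unfolding set_lebesgue_integral_def using sub[OF that] A' by (subst integral_distr) auto
        also have "\<dots> = (LINT \<omega>:A1|Q. M u \<omega>)"
          unfolding set_lebesgue_integral_def
          using eq[OF that] by (intro Bochner_Integration.integral_cong refl) (auto simp: spQ A1_def indicator_def)
        finally show ?thesis .
      qed
      have "(LINT \<omega>:A1|Q. M t \<omega>) = (LINT \<omega>:A1|Q. real_cond_exp Q (path_filtration (ennreal s)) (M t) \<omega>)"
        by (rule Q.real_cond_exp_intA[OF intM[OF t] A1])
      also have "\<dots> = (LINT \<omega>:A1|Q. M s \<omega>)"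
      proof (rule set_lebesgue_integral_cong_AE)
        have [measurable]: "A1 \<in> sets Q"
          using A1 path_filtration_subset by (auto simp: Q(2))
        show "A1 \<in> sets Q" by fact
        show "AE \<omega>\<in>A1 in Q. real_cond_exp Q (path_filtration (ennreal s)) (M t) \<omega> = M s \<omega>"
        proof -
          have "AE \<omega> in Q. real_cond_exp Q (path_filtration (ennreal s)) (M t) \<omega> = M s \<omega>"
            using M st unfolding path_martingale_def by blast
          then show ?thesis
            by eventually_elim simp
        qed
        show "real_cond_exp Q (path_filtration (ennreal s)) (M t) \<in> borel_measurable Q"
          by (rule borel_measurable_cond_exp2)
        show "M s \<in> borel_measurable Q"
          using intM[OF st(1)] by simp
      qed
      finally show "(LINT \<omega>:A|?D. M' t \<omega>) = (LINT \<omega>:A|?D. M' s \<omega>)"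
        by (simp add: move st(1) t)
    qed (use int M' st(1) t in auto)
  qed
  with int M' show ?thesis
    by (simp add: path_martingale_def)
qed

text \<open>
  The image law solves the martingale problem: composing the test martingale of \<open>f\<close> with the
  translation gives the test martingale of the translate of \<open>f\<close>, because \<open>\<L>\<close> commutes with
  translations. Uniqueness of the solution concludes.
\<close>

lemma diffusion_translate:
  assumes X: "smooth_manifold n \<A>" and G: "lie_group m \<B> gmult gone ginv"
    and D: "diffusion (n + m) (prod_atlas n \<A> \<B>) \<L> P"
    and eqv: "equivariance_condition (n + m) (prod_atlas n \<A> \<B>) gmult \<L>"
  shows "P (x, gmult g h) = distr (P (x, h)) path_space (map_path (left_mult gmult g))"
proof -
  let ?T = "left_mult gmult g :: 'a \<times> 'b \<Rightarrow> 'a \<times> 'b"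
  let ?n = "n + m" and ?A = "prod_atlas n \<A> \<B>"
  let ?M = "\<lambda>f t \<omega>. f (\<omega> t) - f (\<omega> 0) - (LINT s:{0..t}|lborel. \<L> f (\<omega> s))"
  let ?Q = "distr (P (x, h)) path_space (map_path ?T)"
  have T: "continuous_on UNIV ?T"
    by (rule continuous_left_mult[OF G])
  have sol: "martingale_problem_solution ?n ?A \<L> z (P z)" for z
    using D unfolding diffusion_def by blast
  then have P: "prob_space (P (x, h))" "sets (P (x, h)) = sets path_space" "AE \<omega> in P (x, h). \<omega> 0 = (x, h)"
    by (auto simp: martingale_problem_solution_def)
  interpret P: prob_space "P (x, h)" by (rule P)
  have mT: "map_path ?T \<in> P (x, h) \<rightarrow>\<^sub>M path_space"
    using measurable_map_path[OF T] by (simp cong: measurable_cong_sets add: P(2))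
  have "martingale_problem_solution ?n ?A \<L> (x, gmult g h) ?Q"
    unfolding martingale_problem_solution_def
  proof (intro conjI allI impI)
    show "prob_space ?Q"
      by (rule P.prob_space_distr[OF mT])
    have "{\<omega> \<in> space path_space. \<omega> 0 = (x, gmult g h)} \<in> sets path_space"
      by measurable
    moreover have "AE \<omega> in P (x, h). map_path ?T \<omega> 0 = (x, gmult g h)"
      using P(3) by eventually_elim (simp add: left_mult_def)
    ultimately show "AE \<omega> in ?Q. \<omega> 0 = (x, gmult g h)"
      by (subst AE_distr_iff[OF mT])
    fix f assume f: "test_function ?n ?A f"
    show "path_martingale ?Q (?M f)"
    proof (rule path_martingale_distr[OF _ P(1,2) measurable_map_path[OF T] measurable_map_path_filtration[OF T]])
      have "test_function ?n ?A (translate gmult g f)"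
        by (rule test_function_translate[OF X G f])
      then show "path_martingale (P (x, h)) (?M (translate gmult g f))"
        using sol by (simp add: martingale_problem_solution_def)
      show "?M f t \<in> borel_measurable (path_filtration (ennreal t))" if "t \<ge> 0" for t
        using sol f that by (auto simp: martingale_problem_solution_def path_martingale_def)
      have \<L>: "\<L> (translate gmult g f) = translate gmult g (\<L> f)"
        using eqv f by (simp add: equivariance_condition_def test_function_def)
      show "?M f t (map_path ?T \<omega>) = ?M (translate gmult g f) t \<omega>" if "t \<ge> 0" "\<omega> \<in> paths" for t \<omega>
      proof -
        have "(LINT s:{0..t}|lborel. \<L> f (map_path ?T \<omega> s)) =
            (LINT s:{0..t}|lborel. translate gmult g (\<L> f) (\<omega> s))"
          by (intro set_lebesgue_integral_cong) (auto simp: translate_eq_comp)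
        then show ?thesis
          using that by (simp add: \<L>) (simp add: translate_eq_comp)
      qed
    qed
  qed simp
  then show ?thesis
    using D unfolding diffusion_def by metis
qed

section \<open>The invariant sigma field\<close>

definition observed :: "('m::topological_space \<Rightarrow> 'b::topological_space) \<Rightarrow> real \<Rightarrow> (real \<Rightarrow> 'm) measure" where
  "observed \<pi> t = sigma paths {{\<omega> \<in> paths. \<pi> (\<omega> s) \<in> B} | s B. t \<le> s \<and> B \<in> sets borel}"

lemma space_observed [simp]: "space (observed \<pi> t) = paths"
  unfolding observed_def by (rule space_measure_of) auto

lemma sets_observed:
  "sets (observed \<pi> t) = sigma_sets paths {{\<omega> \<in> paths. \<pi> (\<omega> s) \<in> B} | s B. t \<le> s \<and> B \<in> sets borel}"
  unfolding observed_def by (rule sets_measure_of) auto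

lemma tail_field_eq: "tail_field \<pi> = (\<Inter>t\<in>{0..}. sets (observed \<pi> t))"
  unfolding tail_field_def sets_observed ..

lemma measurable_eval_observed:
  assumes "t \<le> s"
  shows "(\<lambda>\<omega>. \<pi> (\<omega> s)) \<in> observed \<pi> t \<rightarrow>\<^sub>M borel"
proof (rule measurableI)
  fix B :: "'b set" assume "B \<in> sets borel"
  moreover have "(\<lambda>\<omega>. \<pi> (\<omega> s)) -` B \<inter> space (observed \<pi> t) = {\<omega> \<in> paths. \<pi> (\<omega> s) \<in> B}"
    by auto
  ultimately show "(\<lambda>\<omega>. \<pi> (\<omega> s)) -` B \<inter> space (observed \<pi> t) \<in> sets (observed \<pi> t)"
    using assms unfolding sets_observed by (intro sigma_sets.Basic) auto
qed auto

lemma measurable_observedI: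
  assumes "\<And>x. x \<in> space N \<Longrightarrow> \<Phi> x \<in> paths"
    and "\<And>s. t \<le> s \<Longrightarrow> (\<lambda>x. \<pi> (\<Phi> x s)) \<in> N \<rightarrow>\<^sub>M borel"
  shows "\<Phi> \<in> N \<rightarrow>\<^sub>M observed \<pi> t"
  unfolding observed_def
proof (rule measurable_measure_of)
  fix A assume "A \<in> {{\<omega> \<in> paths. \<pi> (\<omega> s) \<in> B} | s B. t \<le> s \<and> B \<in> sets (borel :: 'c measure)}"
  then obtain s B where *: "A = {\<omega> \<in> paths. \<pi> (\<omega> s) \<in> B}" "t \<le> s" "B \<in> sets borel"
    by blast
  have "\<Phi> -` A \<inter> space N = (\<lambda>x. \<pi> (\<Phi> x s)) -` B \<inter> space N"
    using assms(1) by (auto simp: *(1))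
  then show "\<Phi> -` A \<inter> space N \<in> sets N"
    using measurable_sets[OF assms(2)[OF *(2)] *(3)] by simp
qed (use assms(1) in auto)

lemma sets_observed_id: "sets (observed id 0) = sets (path_filtration \<infinity>)"
  unfolding sets_observed sets_path_filtration by simp

lemma measurable_shift_observed:
  assumes "t \<ge> 0"
  shows "shift t \<in> observed \<pi> t \<rightarrow>\<^sub>M observed \<pi> 0"
proof (rule measurable_observedI)
  fix s :: real assume "0 \<le> s"
  then show "(\<lambda>\<omega>. \<pi> (shift t \<omega> s)) \<in> observed \<pi> t \<rightarrow>\<^sub>M borel"
    using measurable_eval_observed[of t "s + t" \<pi>] by simp
qed (use assms in \<open>simp add: shift_in_paths\<close>)

text \<open>
  Measurability with respect to the whole path suffices: a shift-invariant event is its own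
  preimage under the shift by \<open>t\<close>, and therefore depends on the path after time \<open>t\<close> only.
\<close>

lemma invariant_field_iff:
  "A \<in> invariant_field \<pi> \<longleftrightarrow>
    A \<in> sets (observed \<pi> 0) \<and> (\<forall>s>0. {\<omega> \<in> paths. shift s \<omega> \<in> A} = A)"
proof
  assume "A \<in> invariant_field \<pi>"
  then show "A \<in> sets (observed \<pi> 0) \<and> (\<forall>s>0. {\<omega> \<in> paths. shift s \<omega> \<in> A} = A)"
    unfolding invariant_field_def tail_field_eq by force
next
  assume *: "A \<in> sets (observed \<pi> 0) \<and> (\<forall>s>0. {\<omega> \<in> paths. shift s \<omega> \<in> A} = A)"
  have "A \<in> sets (observed \<pi> t)" if "t \<ge> 0" for t
  proof (cases "t = 0")
    case False
    then have "{\<omega> \<in> paths. shift t \<omega> \<in> A} = A"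
      using * that by simp
    moreover have "shift t -` A \<inter> space (observed \<pi> t) = {\<omega> \<in> paths. shift t \<omega> \<in> A}"
      by auto
    moreover have "shift t -` A \<inter> space (observed \<pi> t) \<in> sets (observed \<pi> t)"
      using * by (intro measurable_sets[OF measurable_shift_observed[OF that]]) simp
    ultimately show ?thesis by simp
  qed (use * in simp)
  with * show "A \<in> invariant_field \<pi>"
    by (auto simp: invariant_field_def tail_field_eq)
qed

lemma sigma_algebra_invariant_field: "sigma_algebra paths (invariant_field \<pi>)"
  unfolding sigma_algebra_iff2
proof (intro conjI ballI allI impI)
  show "invariant_field \<pi> \<subseteq> Pow paths"
    by (auto simp: invariant_field_iff dest!: sets.sets_into_space[of _ "observed \<pi> 0", simplified])
  show "{} \<in> invariant_field \<pi>"
    by (simp add: invariant_field_iff)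
  show "paths - A \<in> invariant_field \<pi>" if "A \<in> invariant_field \<pi>" for A
  proof -
    have "{\<omega> \<in> paths. shift s \<omega> \<in> paths - A} = paths - {\<omega> \<in> paths. shift s \<omega> \<in> A}" if "s > 0" for s
      using that by (auto simp: shift_in_paths)
    then show ?thesis
      using that sets.compl_sets[of A "observed \<pi> 0"] by (simp add: invariant_field_iff)
  qed
  show "(\<Union>i. A i) \<in> invariant_field \<pi>" if "range A \<subseteq> invariant_field \<pi>" for A :: "nat \<Rightarrow> _"
  proof -
    have A: "A i \<in> sets (observed \<pi> 0)" "s > 0 \<Longrightarrow> {\<omega> \<in> paths. shift s \<omega> \<in> A i} = A i" for i s
      using that invariant_field_iff[of "A i" \<pi>] by auto
    have "{\<omega> \<in> paths. shift s \<omega> \<in> (\<Union>i. A i)} = (\<Union>i. {\<omega> \<in> paths. shift s \<omega> \<in> A i})" for s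
      by auto
    with A show ?thesis
      by (simp add: invariant_field_iff)
  qed
qed

definition invariant_algebra :: "('m::topological_space \<Rightarrow> 'b::topological_space) \<Rightarrow> (real \<Rightarrow> 'm) measure" where
  "invariant_algebra \<pi> = sigma paths (invariant_field \<pi>)"

lemma sets_invariant_algebra [simp]: "sets (invariant_algebra \<pi>) = invariant_field \<pi>"
  unfolding invariant_algebra_def
  by (rule sigma_algebra.sets_measure_of_eq[OF sigma_algebra_invariant_field])

lemma space_invariant_algebra [simp]: "space (invariant_algebra \<pi>) = paths"
  unfolding invariant_algebra_def
  by (rule sigma_algebra.space_measure_of_eq[OF sigma_algebra_invariant_field])

lemma invariant_field_cylinder: "A \<in> invariant_field id \<Longrightarrow> A \<in> sets (path_filtration \<infinity>)"
  by (simp add: invariant_field_iff sets_observed_id)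

lemma invariant_field_path_space: "A \<in> invariant_field id \<Longrightarrow> A \<in> sets path_space"
  using invariant_field_cylinder path_filtration_subset by blast

lemma invariant_field_subset_paths: "A \<in> invariant_field \<pi> \<Longrightarrow> A \<subseteq> paths"
  using sets.sets_into_space[of A "invariant_algebra \<pi>"] by simp

lemma shift_mem_invariant_iff:
  assumes "A \<in> invariant_field \<pi>" "\<omega> \<in> paths" "s \<ge> 0"
  shows "shift s \<omega> \<in> A \<longleftrightarrow> \<omega> \<in> A"
proof (cases "s = 0")
  case True
  have "shift 0 \<omega> = \<omega>"
    by (rule paths_eqI) (use assms(2) in \<open>auto simp: shift_in_paths\<close>)
  then show ?thesis by (simp add: True)
next
  case False
  then have "{\<omega> \<in> paths. shift s \<omega> \<in> A} = A"
    using assms by (auto simp: invariant_field_iff)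
  then show ?thesis
    using assms(2) by blast
qed

lemma invariant_field_mono:
  assumes \<pi>: "\<pi> \<in> borel \<rightarrow>\<^sub>M borel" and A: "A \<in> invariant_field \<pi>"
  shows "A \<in> invariant_field id"
proof -
  have "(\<lambda>\<omega>. \<omega>) \<in> observed id 0 \<rightarrow>\<^sub>M observed \<pi> 0"
  proof (rule measurable_observedI)
    show "(\<lambda>\<omega>. \<pi> (\<omega> s)) \<in> observed id 0 \<rightarrow>\<^sub>M borel" if "0 \<le> s" for s
      using measurable_compose[OF measurable_eval_observed[OF that, of id] \<pi>] by simp
  qed simp
  from measurable_sets[OF this] A have "A \<inter> paths \<in> sets (observed id 0)"
    by (auto simp: invariant_field_iff)
  then show ?thesis
    using A invariant_field_subset_paths[OF A] by (simp add: invariant_field_iff Int_absorb2)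
qed

lemma eventually_at_top_shift:
  "(\<forall>\<^sub>F t in at_top. P (t + s)) \<longleftrightarrow> (\<forall>\<^sub>F t in at_top. P t)" for s :: real
proof
  assume "\<forall>\<^sub>F t in at_top. P (t + s)"
  then obtain N where "\<And>t. t \<ge> N \<Longrightarrow> P (t + s)"
    by (auto simp: eventually_at_top_linorder)
  from this[of "t - s" for t] have "t \<ge> N + s \<Longrightarrow> P t" for t by simp
  then show "\<forall>\<^sub>F t in at_top. P t"
    by (auto simp: eventually_at_top_linorder)
next
  assume "\<forall>\<^sub>F t in at_top. P t"
  then obtain N where "\<And>t. t \<ge> N \<Longrightarrow> P t"
    by (auto simp: eventually_at_top_linorder)
  then have "t \<ge> N - s \<Longrightarrow> P (t + s)" for t by simp
  then show "\<forall>\<^sub>F t in at_top. P (t + s)"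
    by (auto simp: eventually_at_top_linorder)
qed

lemma eventually_shift_iff:
  "(\<forall>\<^sub>F t in at_top. P (shift s \<omega> t)) \<longleftrightarrow> (\<forall>\<^sub>F t in at_top. P (\<omega> t))"
proof -
  have "(\<forall>\<^sub>F t in at_top. P (shift s \<omega> t)) \<longleftrightarrow> (\<forall>\<^sub>F t in at_top. P (\<omega> (t + s)))"
    by (rule eventually_cong[OF eventually_ge_at_top[of 0]]) simp
  then show ?thesis
    using eventually_at_top_shift[of "\<lambda>t. P (\<omega> t)" s] by simp
qed

definition eventually_in :: "('m::topological_space \<Rightarrow> 'b) \<Rightarrow> 'b set \<Rightarrow> (real \<Rightarrow> 'm) set" where
  "eventually_in \<pi> F = {\<omega> \<in> paths. \<forall>\<^sub>F t in at_top. \<pi> (\<omega> t) \<in> F}"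

text \<open>
  Used to rewrite conditions on all times as countably many conditions.
\<close>

lemma path_closed_rational_times:
  assumes \<omega>: "\<omega> \<in> paths" and \<pi>: "continuous_on UNIV \<pi>" and F: "closed F"
    and q: "\<And>q. q \<in> \<rat> \<Longrightarrow> q \<ge> N \<Longrightarrow> \<pi> (\<omega> q) \<in> F" and t: "t \<ge> N" "N \<ge> 0"
  shows "\<pi> (\<omega> t) \<in> F"
proof (rule ccontr)
  assume nF: "\<pi> (\<omega> t) \<notin> F"
  have "continuous_on {0..} (\<lambda>t. \<pi> (\<omega> t))"
    by (rule continuous_on_compose2[OF \<pi>]) (use \<omega> in \<open>auto simp: paths_def\<close>)
  moreover have "t \<in> {0..}" "open (- F)" "\<pi> (\<omega> t) \<in> - F"
    using F nF t by auto
  ultimately have "\<exists>U. open U \<and> t \<in> U \<and> (\<forall>u\<in>{0..}. u \<in> U \<longrightarrow> \<pi> (\<omega> u) \<in> - F)"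
    by (rule continuous_on_topological[THEN iffD1, rule_format])
  then obtain U where U: "open U" "t \<in> U" "\<And>u. u \<in> {0..} \<Longrightarrow> u \<in> U \<Longrightarrow> \<pi> (\<omega> u) \<in> - F"
    by auto
  then obtain d where d: "d > 0" "\<And>u. dist u t < d \<Longrightarrow> u \<in> U"
    by (auto simp: open_dist)
  obtain q' where q': "q' \<in> \<rat>" "t < q'" "q' < t + d"
    using Rats_dense_in_real[of t "t + d"] d(1) by auto
  then have "\<pi> (\<omega> q') \<in> - F"
    using d(2)[of q'] U(3)[of q'] t by (auto simp: dist_real_def)
  with q[of q'] q' t show False by auto
qed

text \<open>
  The events about limits and exceeded levels that occur below are built from events of this
  form by countable operations.
\<close>

lemma eventually_in_invariant:
  assumes \<pi>: "continuous_on UNIV \<pi>" and F: "closed F"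
  shows "eventually_in \<pi> F \<in> invariant_field \<pi>"
  unfolding invariant_field_iff
proof (intro conjI allI impI)
  have "eventually_in \<pi> F = (\<Union>N::nat. \<Inter>q\<in>{q\<in>\<rat>. q \<ge> real N}. {\<omega> \<in> paths. \<pi> (\<omega> q) \<in> F})"
  proof (intro set_eqI iffI)
    fix \<omega> assume "\<omega> \<in> eventually_in \<pi> F"
    then obtain N where "\<omega> \<in> paths" "\<And>t. t \<ge> N \<Longrightarrow> \<pi> (\<omega> t) \<in> F"
      by (auto simp: eventually_in_def eventually_at_top_linorder)
    moreover obtain M :: nat where "real M \<ge> N"
      using real_arch_simple by blast
    ultimately show "\<omega> \<in> (\<Union>N::nat. \<Inter>q\<in>{q\<in>\<rat>. q \<ge> real N}. {\<omega> \<in> paths. \<pi> (\<omega> q) \<in> F})"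
      by (intro UN_I[of M]) auto
  next
    fix \<omega> assume "\<omega> \<in> (\<Union>N::nat. \<Inter>q\<in>{q\<in>\<rat>. q \<ge> real N}. {\<omega> \<in> paths. \<pi> (\<omega> q) \<in> F})"
    then obtain N :: nat where N: "\<And>q. q \<in> \<rat> \<Longrightarrow> q \<ge> real N \<Longrightarrow> \<omega> \<in> paths \<and> \<pi> (\<omega> q) \<in> F"
      by auto
    then have "\<omega> \<in> paths"
      using N[of "real N"] by auto
    then have "\<pi> (\<omega> t) \<in> F" if "t \<ge> real N" for t
      using path_closed_rational_times[OF _ \<pi> F _ that] N by auto
    with \<open>\<omega> \<in> paths\<close> show "\<omega> \<in> eventually_in \<pi> F"
      by (auto simp: eventually_in_def eventually_at_top_linorder)
  qed
  moreover have "(\<Inter>q\<in>{q\<in>\<rat>. q \<ge> real N}. {\<omega> \<in> paths. \<pi> (\<omega> q) \<in> F}) \<in> sets (observed \<pi> 0)" for N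
  proof (rule sets.countable_INT')
    show "countable {q \<in> \<rat>. real N \<le> q}"
      by (rule countable_subset[OF _ countable_rat]) auto
    have "real N \<in> {q \<in> \<rat>. real N \<le> q}" by simp
    then show "{q \<in> \<rat>. real N \<le> q} \<noteq> {}" by blast
    show "(\<lambda>q. {\<omega> \<in> paths. \<pi> (\<omega> q) \<in> F}) ` {q \<in> \<rat>. real N \<le> q} \<subseteq> sets (observed \<pi> 0)"
    proof clarify
      fix q :: real assume "real N \<le> q"
      then have "0 \<le> q" by simp
      then show "{\<omega> \<in> paths. \<pi> (\<omega> q) \<in> F} \<in> sets (observed \<pi> 0)"
        unfolding sets_observed using borel_closed[OF F] by (intro sigma_sets.Basic) blast
    qed
  qed
  ultimately show "eventually_in \<pi> F \<in> sets (observed \<pi> 0)"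
    by simp
  fix s :: real assume "s > 0"
  then show "{\<omega> \<in> paths. shift s \<omega> \<in> eventually_in \<pi> F} = eventually_in \<pi> F"
    by (auto simp: eventually_in_def shift_in_paths eventually_shift_iff[of "\<lambda>z. \<pi> z \<in> F"])
qed

section \<open>The limit of the group component\<close>

text \<open>
  A countable base in which every point has arbitrarily small neighbourhoods with compact
  closure; it exists because a manifold is locally compact.
\<close>

definition compact_closure_basis :: "'g::{t2_space, second_countable_topology} set set \<Rightarrow> bool" where
  "compact_closure_basis \<BB> \<longleftrightarrow> countable \<BB> \<and> (\<forall>b\<in>\<BB>. open b) \<and>
     (\<forall>U x. open U \<longrightarrow> x \<in> U \<longrightarrow> (\<exists>b\<in>\<BB>. x \<in> b \<and> compact (closure b) \<and> closure b \<subseteq> U))"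

lemma smooth_manifold_locally_compact:
  fixes \<A> :: "'g::{t2_space, second_countable_topology} chart set"
  assumes M: "smooth_manifold m \<A>"
  shows "locally_compact_space (euclidean :: 'g topology)"
  unfolding locally_compact_space_def
proof
  fix x :: 'g
  obtain U \<phi> where U: "(U, \<phi>) \<in> \<A>" "x \<in> U"
    using smooth_manifold_chart_at[OF M] .
  then have c: "openin (Euclidean_space m) (\<phi> ` U)" "open U"
    "homeomorphic_map (top_of_set U) (subtopology (Euclidean_space m) (\<phi> ` U)) \<phi>"
    using smooth_manifold_is_chart[OF M U(1)] by (auto simp: is_chart_def)
  have "locally_compact_space (subtopology (Euclidean_space m) (\<phi> ` U))"
    using locally_compact_space_open_subset[OF _ locally_compact_Euclidean_space c(1)]
      Hausdorff_Euclidean_space by blast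
  then have "locally_compact_space (top_of_set U)"
    using c(3) homeomorphic_locally_compact_space homeomorphic_space by blast
  then obtain V K where "openin (top_of_set U) V" "compactin (top_of_set U) K" "x \<in> V" "V \<subseteq> K"
    using U(2) unfolding locally_compact_space_def by force
  then show "\<exists>V K. openin euclidean V \<and> compactin euclidean K \<and> x \<in> V \<and> V \<subseteq> K"
    using c(2) by (intro exI[of _ V] exI[of _ K])
      (auto simp: compactin_subtopology openin_open_eq)
qed

lemma ex_compact_closure_basis:
  fixes \<A> :: "'g::{t2_space, second_countable_topology} chart set"
  assumes M: "smooth_manifold m \<A>"
  shows "\<exists>\<BB> :: 'g set set. compact_closure_basis \<BB>"
proof -
  obtain \<BB> :: "'g set set" where B: "countable \<BB>" "topological_basis \<BB>"
    using ex_countable_basis by blast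
  have nb: "neighbourhood_base_of (compactin euclidean) (euclidean :: 'g topology)"
  proof -
    have "Hausdorff_space (euclidean :: 'g topology)"
      unfolding Hausdorff_space_def disjnt_def
      using hausdorff by (metis open_openin)
    then show ?thesis
      using smooth_manifold_locally_compact[OF M]
      by (intro locally_compact_imp_neighbourhood_base locally_compact_Hausdorff_imp_regular_space)
  qed
  have "\<exists>b\<in>\<BB>. x \<in> b \<and> compact (closure b) \<and> closure b \<subseteq> U" if "open U" "x \<in> U" for U and x :: 'g
  proof -
    have "openin euclidean U \<and> x \<in> U"
      using that by simp
    then have "\<exists>V K. openin euclidean V \<and> compactin euclidean K \<and> x \<in> V \<and> V \<subseteq> K \<and> K \<subseteq> U"
      by (rule nb[unfolded neighbourhood_base_of, rule_format])
    then obtain V K where V: "open V" "compact K" "x \<in> V" "V \<subseteq> K" "K \<subseteq> U"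
      by auto
    obtain b where b: "b \<in> \<BB>" "x \<in> b" "b \<subseteq> V"
      using B(2) V(1,3) by (rule topological_basisE)
    have "closure b \<subseteq> K"
      using b V by (intro closure_minimal compact_imp_closed) auto
    then show ?thesis
      using b V by (metis closed_Int_compact closed_closure inf.absorb1 order.trans)
  qed
  then show ?thesis
    using B(1) topological_basis_open[OF B(2)]
    by (intro exI[of _ \<BB>]) (simp add: compact_closure_basis_def)
qed

text \<open>
  Convergence without reference to the limit, as a countable condition. The first clause keeps
  the function in a compact set, so that it has a cluster point. The second clause excludes two
  distinct cluster points: they would have basic neighbourhoods with disjoint closures, both
  visited at arbitrarily large times. Disjointness of the closures matters, since a convergent
  function may visit two disjoint open sets for ever if its limit lies on the boundary of both.
\<close>

lemma convergent_iff_basis: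
  fixes f :: "real \<Rightarrow> 'g::{t2_space, second_countable_topology}"
  assumes B: "compact_closure_basis \<BB>"
  shows "(\<exists>l. (f \<longlongrightarrow> l) at_top) \<longleftrightarrow>
    (\<exists>b\<in>\<BB>. compact (closure b) \<and> (\<forall>\<^sub>F t in at_top. f t \<in> closure b)) \<and>
    (\<forall>b1\<in>\<BB>. \<forall>b2\<in>\<BB>. closure b1 \<inter> closure b2 = {} \<longrightarrow>
      (\<forall>\<^sub>F t in at_top. f t \<in> - b1) \<or> (\<forall>\<^sub>F t in at_top. f t \<in> - b2))"
    (is "?L \<longleftrightarrow> ?C \<and> ?S")
proof
  assume ?L
  then obtain l where l: "(f \<longlongrightarrow> l) at_top" ..
  obtain b where b: "b \<in> \<BB>" "l \<in> b" "compact (closure b)"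
    using B open_UNIV unfolding compact_closure_basis_def by blast
  have "open b"
    using B b by (simp add: compact_closure_basis_def)
  then have "\<forall>\<^sub>F t in at_top. f t \<in> b"
    using l b(2) by (simp add: topological_tendstoD)
  then have "\<forall>\<^sub>F t in at_top. f t \<in> closure b"
    by eventually_elim (use closure_subset in blast)
  moreover have "\<forall>\<^sub>F t in at_top. f t \<in> - b1" if "l \<notin> closure b1" for b1
  proof -
    have "\<forall>\<^sub>F t in at_top. f t \<in> - closure b1"
      using l that by (intro topological_tendstoD[of f l]) auto
    then show ?thesis
      by eventually_elim (use closure_subset in blast)
  qed
  ultimately show "?C \<and> ?S"
    using b by blast
next
  assume "?C \<and> ?S"
  then obtain b where b: "compact (closure b)" "\<forall>\<^sub>F t in at_top. f t \<in> closure b" and S: ?S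
    by blast
  define F where "F = filtermap f at_top"
  have "F \<noteq> bot"
    by (simp add: F_def filtermap_bot_iff)
  moreover have evK: "\<forall>\<^sub>F y in F. y \<in> closure b"
    using b(2) by (simp add: F_def eventually_filtermap)
  ultimately obtain l where l: "inf (nhds l) F \<noteq> bot"
    using b(1) unfolding compact_filter by blast
  have "\<forall>\<^sub>F y in F. y \<in> U" if U: "open U" "l \<in> U" for U
  proof (rule ccontr)
    assume nev: "\<not> (\<forall>\<^sub>F y in F. y \<in> U)"
    \<comment> \<open>a cluster point of the visits outside \<open>U\<close> would be a second cluster point\<close>
    define F' where "F' = inf F (principal (- U))"
    have "F' \<noteq> bot"
      using nev by (simp add: F'_def trivial_limit_def eventually_inf_principal)
    moreover have "\<forall>\<^sub>F y in F'. y \<in> closure b \<inter> - U"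
      unfolding F'_def eventually_inf_principal using evK by eventually_elim simp
    moreover have "compact (closure b \<inter> - U)"
      using b(1) U(1) by (intro compact_Int_closed closed_Compl)
    ultimately obtain l' where l': "l' \<in> closure b \<inter> - U" "inf (nhds l') F' \<noteq> bot"
      unfolding compact_filter by meson
    have l'F: "inf (nhds l') F \<noteq> bot"
      using l'(2) unfolding F'_def by (metis inf.assoc inf_bot_left)
    have "l \<noteq> l'"
      using l'(1) U(2) by auto
    then obtain U1 U2 where U12: "open U1" "open U2" "l \<in> U1" "l' \<in> U2" "U1 \<inter> U2 = {}"
      using hausdorff by metis
    obtain b1 where b1: "b1 \<in> \<BB>" "l \<in> b1" "closure b1 \<subseteq> U1"
      using B U12(1,3) unfolding compact_closure_basis_def by blast
    obtain b2 where b2: "b2 \<in> \<BB>" "l' \<in> b2" "closure b2 \<subseteq> U2"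
      using B U12(2,4) unfolding compact_closure_basis_def by blast
    have no: "inf (nhds p) F = bot" if "open c" "p \<in> c" "\<forall>\<^sub>F t in at_top. f t \<in> - c" for p c
    proof -
      have "\<forall>\<^sub>F y in nhds p. y \<in> c"
        using that by (simp add: eventually_nhds_in_open)
      moreover have "\<forall>\<^sub>F y in F. y \<in> - c"
        using that by (simp add: F_def eventually_filtermap)
      ultimately show ?thesis
        unfolding trivial_limit_def eventually_inf by blast
    qed
    have "closure b1 \<inter> closure b2 = {}"
      using b1 b2 U12 by blast
    then have "(\<forall>\<^sub>F t in at_top. f t \<in> - b1) \<or> (\<forall>\<^sub>F t in at_top. f t \<in> - b2)"
      using S b1(1) b2(1) by blast
    moreover have "open b1" "open b2"
      using B b1 b2 by (auto simp: compact_closure_basis_def)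
    ultimately show False
      using no[of b1 l] no[of b2 l'] b1 b2 l l'F by blast
  qed
  then have "(f \<longlongrightarrow> l) at_top"
    by (intro topological_tendstoI) (simp add: F_def eventually_filtermap)
  then show ?L ..
qed

definition convergent_paths :: "(real \<Rightarrow> 'x::topological_space \<times> 'g::topological_space) set" where
  "convergent_paths = {\<omega> \<in> paths. \<exists>l. ((\<lambda>t. snd (\<omega> t)) \<longlongrightarrow> l) at_top}"

lemma g_lim_eq: "((\<lambda>t. snd (\<omega> t)) \<longlongrightarrow> l) at_top \<Longrightarrow> g_lim \<omega> = l"
  unfolding g_lim_def by (rule tendsto_Lim) simp_all

lemma tendsto_g_lim: "\<omega> \<in> convergent_paths \<Longrightarrow> ((\<lambda>t. snd (\<omega> t)) \<longlongrightarrow> g_lim \<omega>) at_top"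
  unfolding convergent_paths_def using g_lim_eq by blast

text \<open>
  On paths without limit the definite description takes one and the same default value, so
  \<^const>\<open>g_lim\<close> is invariant and measurable everywhere.
\<close>

lemma g_lim_not_convergent:
  "\<omega> \<in> paths \<Longrightarrow> \<omega> \<notin> convergent_paths \<Longrightarrow> g_lim \<omega> = (THE l. False)"
  by (simp add: g_lim_def t2_space_class.Lim_def convergent_paths_def)

lemma eventually_in_snd_invariant:
  assumes "closed F"
  shows "{\<omega> \<in> paths. \<forall>\<^sub>F t in at_top. snd (\<omega> t) \<in> F} \<in> invariant_field id"
proof -
  have "closed (snd -` F)"
    by (rule closed_vimage[OF assms continuous_on_snd[OF continuous_on_id]])
  from eventually_in_invariant[OF continuous_on_id this] show ?thesis
    by (simp add: eventually_in_def id_def)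
qed

lemma convergent_paths_invariant:
  fixes \<BB> :: "'g::{t2_space, second_countable_topology} set set"
  assumes B: "compact_closure_basis \<BB>"
  shows "(convergent_paths :: (real \<Rightarrow> 'x::topological_space \<times> 'g) set) \<in> invariant_field id"
proof -
  let ?I = "invariant_algebra id :: (real \<Rightarrow> 'x \<times> 'g) measure"
  let ?E = "\<lambda>F. {\<omega> \<in> space ?I. \<forall>\<^sub>F t in at_top. snd (\<omega> t) \<in> F}"
  have c: "countable \<BB>" and o: "\<And>b. b \<in> \<BB> \<Longrightarrow> open b"
    using B by (auto simp: compact_closure_basis_def)
  have E: "?E F \<in> sets ?I" if "closed F" for F
    using eventually_in_snd_invariant[OF that] by simp
  have "convergent_paths = {\<omega> \<in> space ?I.
    (\<exists>b\<in>{b\<in>\<BB>. compact (closure b)}. \<forall>\<^sub>F t in at_top. snd (\<omega> t) \<in> closure b) \<and>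
    (\<forall>b\<in>{b\<in>\<BB> \<times> \<BB>. closure (fst b) \<inter> closure (snd b) = {}}.
      (\<forall>\<^sub>F t in at_top. snd (\<omega> t) \<in> - fst b) \<or> (\<forall>\<^sub>F t in at_top. snd (\<omega> t) \<in> - snd b))}"
    unfolding convergent_paths_def convergent_iff_basis[OF B] by (auto simp: Ball_def)
  also have "\<dots> \<in> sets ?I"
    unfolding pred_def[symmetric]
  proof (intro pred_intros_logic measurable_pred_countable)
    show "countable {b \<in> \<BB>. compact (closure b)}"
      using c by (auto intro: countable_subset[of _ \<BB>])
    show "countable {b \<in> \<BB> \<times> \<BB>. closure (fst b) \<inter> closure (snd b) = {}}"
      using c by (auto intro: countable_subset[of _ "\<BB> \<times> \<BB>"])
  qed (use E E[of "- b" for b] o in \<open>auto simp: pred_def closed_Compl\<close>)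
  finally show ?thesis by simp
qed

lemma g_lim_mem_open_iff:
  fixes \<BB> :: "'g::{t2_space, second_countable_topology} set set"
  assumes B: "compact_closure_basis \<BB>" and U: "open U" and \<omega>: "\<omega> \<in> convergent_paths"
  shows "g_lim \<omega> \<in> U \<longleftrightarrow> (\<exists>b\<in>{b\<in>\<BB>. closure b \<subseteq> U}. \<forall>\<^sub>F t in at_top. snd (\<omega> t) \<in> closure b)"
proof
  assume "g_lim \<omega> \<in> U"
  then obtain b where b: "b \<in> \<BB>" "g_lim \<omega> \<in> b" "closure b \<subseteq> U"
    using B U unfolding compact_closure_basis_def by blast
  then have "\<forall>\<^sub>F t in at_top. snd (\<omega> t) \<in> b"
    using tendsto_g_lim[OF \<omega>] B by (intro topological_tendstoD) (auto simp: compact_closure_basis_def)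
  then have "\<forall>\<^sub>F t in at_top. snd (\<omega> t) \<in> closure b"
    by eventually_elim (use closure_subset in blast)
  with b show "\<exists>b\<in>{b\<in>\<BB>. closure b \<subseteq> U}. \<forall>\<^sub>F t in at_top. snd (\<omega> t) \<in> closure b"
    by blast
next
  assume "\<exists>b\<in>{b\<in>\<BB>. closure b \<subseteq> U}. \<forall>\<^sub>F t in at_top. snd (\<omega> t) \<in> closure b"
  then obtain b where b: "closure b \<subseteq> U" "\<forall>\<^sub>F t in at_top. snd (\<omega> t) \<in> closure b"
    by blast
  have "g_lim \<omega> \<in> closure b"
    by (rule Lim_in_closed_set[OF closed_closure b(2) _ tendsto_g_lim[OF \<omega>]]) simp
  with b(1) show "g_lim \<omega> \<in> U" by blast
qed

lemma measurable_g_lim_invariant: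
  fixes \<BB> :: "'g::{t2_space, second_countable_topology} set set"
  assumes B: "compact_closure_basis \<BB>"
  shows "(g_lim :: (real \<Rightarrow> 'x::topological_space \<times> 'g) \<Rightarrow> 'g) \<in> invariant_algebra id \<rightarrow>\<^sub>M borel"
proof (rule borel_measurableI)
  fix U :: "'g set" assume U: "open U"
  let ?I = "invariant_algebra id :: (real \<Rightarrow> 'x \<times> 'g) measure"
  let ?E = "{\<omega> \<in> space ?I. \<exists>b\<in>{b\<in>\<BB>. closure b \<subseteq> U}. \<forall>\<^sub>F t in at_top. snd (\<omega> t) \<in> closure b}"
  have C: "convergent_paths \<in> sets ?I"
    using convergent_paths_invariant[OF B] by simp
  have "countable {b\<in>\<BB>. closure b \<subseteq> U}"
    using B by (auto simp: compact_closure_basis_def intro: countable_subset[of _ \<BB>])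
  then have E: "?E \<in> sets ?I"
    unfolding pred_def[symmetric]
    by (rule measurable_pred_countable) (simp_all add: pred_def eventually_in_snd_invariant)
  have "g_lim -` U \<inter> space ?I =
      (convergent_paths \<inter> ?E) \<union> (if (THE l. False) \<in> U then space ?I - convergent_paths else {})"
  proof (rule set_eqI)
    fix \<omega> :: "real \<Rightarrow> 'x \<times> 'g"
    show "\<omega> \<in> g_lim -` U \<inter> space ?I \<longleftrightarrow>
      \<omega> \<in> (convergent_paths \<inter> ?E) \<union> (if (THE l. False) \<in> U then space ?I - convergent_paths else {})"
    proof (cases "\<omega> \<in> convergent_paths")
      case True
      then have "\<omega> \<in> paths" by (simp add: convergent_paths_def)
      with True show ?thesis
        using g_lim_mem_open_iff[OF B U True] by auto
    next
      case False
      then show ?thesis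
        using g_lim_not_convergent[of \<omega>] by auto
    qed
  qed
  also have "\<dots> \<in> sets ?I"
  proof (intro sets.Un sets.Int C E)
    show "(if (THE l. False) \<in> U then space ?I - convergent_paths else {}) \<in> sets ?I"
      by (simp only: sets.compl_sets[OF C] sets.empty_sets split: if_split) simp
  qed
  finally show "g_lim -` U \<inter> space ?I \<in> sets ?I" .
qed

section \<open>Laws of strong Markov families\<close>

lemma path_filtration_mono:
  "s \<le> t \<Longrightarrow> D \<in> sets (path_filtration (ennreal s)) \<Longrightarrow> D \<in> sets (path_filtration (ennreal t))"
  using path_filtration.sets_F_mono[of "ennreal s" "ennreal t"] ennreal_leI by blast

text \<open>
  The events that can be approximated in this way form a sigma field containing the
  generators. For a countable union, finitely many members carry all but \<open>e / 2\<close> of the mass,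
  and each of them is approximated up to a share of the remaining \<open>e / 2\<close>.
\<close>

lemma cylinder_approximation:
  fixes M :: "(real \<Rightarrow> 'm::topological_space) measure"
  assumes M: "prob_space M" "sets M = sets path_space"
    and A: "A \<in> sets (path_filtration \<infinity>)" and e: "e > 0"
  shows "\<exists>t\<ge>0. \<exists>D\<in>sets (path_filtration (ennreal t)). measure M (sym_diff A D) < e"
proof -
  interpret M: prob_space M by fact
  have FM: "D \<in> sets M" if "D \<in> sets (path_filtration t)" for D t
    using that path_filtration_subset M(2) by blast
  let ?G = "{{\<omega> \<in> paths. \<omega> s \<in> B} | s B. 0 \<le> s \<and> ennreal s \<le> \<infinity> \<and> B \<in> sets (borel :: 'm measure)}"
  have "A \<in> sigma_sets paths ?G"
    using A unfolding sets_path_filtration .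
  then show ?thesis
    using e
  proof (induction arbitrary: e rule: sigma_sets.induct)
    case (Basic a)
    then obtain s B where "a = {\<omega> \<in> paths. \<omega> s \<in> B}" "0 \<le> s" "B \<in> sets borel"
      by blast
    then have "a \<in> sets (path_filtration (ennreal s))"
      unfolding sets_path_filtration by (intro sigma_sets.Basic) blast
    then show ?case
      using \<open>0 \<le> s\<close> Basic(2) by (intro exI[of _ s] conjI bexI[of _ a]) auto
  next
    case Empty
    then show ?case
      by (intro exI[of _ 0] conjI bexI[of _ "{}"]) auto
  next
    case (Compl a)
    obtain t D where t: "t \<ge> 0" "D \<in> sets (path_filtration (ennreal t))" "measure M (sym_diff a D) < e"
      using Compl.IH[OF Compl.prems] by blast
    have "a \<subseteq> paths"
      using Compl.hyps sets.sets_into_space[of a "path_filtration \<infinity>"] by (simp add: sets_path_filtration)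
    moreover have "D \<subseteq> paths"
      using sets.sets_into_space[OF t(2)] by simp
    ultimately have "sym_diff (paths - a) (paths - D) = sym_diff a D"
      by blast
    moreover have "paths - D \<in> sets (path_filtration (ennreal t))"
      using sets.compl_sets[OF t(2)] by simp
    ultimately show ?case
      using t by (intro exI[of _ t] conjI bexI[of _ "paths - D"]) auto
  next
    case (Union a)
    have aM: "a i \<in> sets M" for i
      using Union.hyps FM[of "a i" \<infinity>] by (simp add: sets_path_filtration)
    have "(\<lambda>N. measure M (\<Union>i<N. a i)) \<longlonglongrightarrow> measure M (\<Union>N. \<Union>i<N. a i)"
      using aM by (intro M.finite_Lim_measure_incseq) (auto simp: incseq_def, force)
    moreover have UN: "(\<Union>N. \<Union>i<N. a i) = (\<Union>i. a i)"
      by auto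
    ultimately have "\<forall>\<^sub>F N in sequentially. dist (measure M (\<Union>i<N. a i)) (measure M (\<Union>i. a i)) < e / 2"
      using Union.prems by (intro tendstoD) auto
    then obtain N where N: "dist (measure M (\<Union>i<N. a i)) (measure M (\<Union>i. a i)) < e / 2"
      by (auto simp: eventually_sequentially)
    have "\<exists>t D. t \<ge> 0 \<and> D \<in> sets (path_filtration (ennreal t)) \<and> measure M (sym_diff (a i) D) < e / (2 * (N + 1))"
      for i
      using Union.IH[of "e / (2 * (N + 1))" i] Union.prems by auto
    then obtain t D where tD: "\<And>i. t i \<ge> 0" "\<And>i. D i \<in> sets (path_filtration (ennreal (t i)))"
      "\<And>i. measure M (sym_diff (a i) (D i)) < e / (2 * (N + 1))"
      by metis
    define T where "T = (\<Sum>i<N. t i)"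
    have T: "t i \<le> T" if "i < N" for i
      unfolding T_def using tD(1) that by (intro member_le_sum) auto
    have D: "D i \<in> sets (path_filtration (ennreal T))" if "i < N" for i
      by (rule path_filtration_mono[OF T[OF that] tD(2)])
    then have DU: "(\<Union>i<N. D i) \<in> sets (path_filtration (ennreal T))"
      by auto
    have DM: "D i \<in> sets M" for i
      using tD(2) FM by blast
    have "sym_diff (\<Union>i. a i) (\<Union>i<N. D i) \<subseteq>
        ((\<Union>i. a i) - (\<Union>i<N. a i)) \<union> (\<Union>i<N. sym_diff (a i) (D i))"
      by blast
    then have "measure M (sym_diff (\<Union>i. a i) (\<Union>i<N. D i)) \<le>
        measure M (((\<Union>i. a i) - (\<Union>i<N. a i)) \<union> (\<Union>i<N. sym_diff (a i) (D i)))"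
      using aM DM by (intro M.finite_measure_mono) auto
    also have "\<dots> \<le> measure M ((\<Union>i. a i) - (\<Union>i<N. a i)) + measure M (\<Union>i<N. sym_diff (a i) (D i))"
      using aM DM by (intro measure_Un_le) auto
    also have "measure M ((\<Union>i. a i) - (\<Union>i<N. a i)) < e / 2"
    proof -
      have "measure M ((\<Union>i. a i) - (\<Union>i<N. a i)) = measure M (\<Union>i. a i) - measure M (\<Union>i<N. a i)"
        using aM by (intro M.finite_measure_Diff) auto
      with N show ?thesis unfolding dist_real_def by linarith
    qed
    also have "measure M (\<Union>i<N. sym_diff (a i) (D i)) \<le> (\<Sum>i<N. measure M (sym_diff (a i) (D i)))"
      using aM DM by (intro M.finite_measure_subadditive_finite) auto
    also have "\<dots> \<le> (\<Sum>i<N. e / (2 * (N + 1)))"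
      using tD(3) by (intro sum_mono) (simp add: less_imp_le)
    also have "\<dots> \<le> e / 2"
      using Union.prems by (simp add: field_simps)
    finally show ?case
      using DU tD(1) by (intro exI[of _ T] conjI bexI[of _ "\<Union>i<N. D i"]) (auto simp: T_def sum_nonneg)
  qed
qed

text \<open>
  A weak form of the zero-one law of Levy: an event of positive probability fills almost all of
  some event \<open>D\<close> observed up to a finite time, namely of a close approximation of itself.
\<close>

lemma measure_eq_0_of_cylinder_bound:
  fixes M :: "(real \<Rightarrow> 'm::topological_space) measure"
  assumes M: "prob_space M" "sets M = sets path_space"
    and A: "A \<in> sets (path_filtration \<infinity>)" and a: "0 \<le> a" "a < 1"
    and bound: "\<And>t D. t \<ge> 0 \<Longrightarrow> D \<in> sets (path_filtration (ennreal t)) \<Longrightarrow>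
      measure M (D \<inter> A) \<le> a * measure M D"
  shows "measure M A = 0"
proof (rule ccontr)
  interpret M: prob_space M by fact
  have FM: "D \<in> sets M" if "D \<in> sets (path_filtration t)" for D t
    using that path_filtration_subset M(2) by blast
  assume "measure M A \<noteq> 0"
  then have p: "measure M A > 0"
    by (simp add: zero_less_measure_iff)
  \<comment> \<open>the estimate below gives \<open>(1 - a) M(A) \<le> (1 + a) e \<le> 2 e\<close>, so a factor of \<open>3\<close> is a contradiction\<close>
  define e where "e = (1 - a) * measure M A / 3"
  have "e > 0"
    using p a by (simp add: e_def)
  from cylinder_approximation[OF M A this] obtain t D where t: "t \<ge> 0"
    and D: "D \<in> sets (path_filtration (ennreal t))" and lt: "measure M (sym_diff A D) < e"
    by blast
  note AM = FM[OF A] and DM = FM[OF D]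
  have "measure M A \<le> measure M ((D \<inter> A) \<union> sym_diff A D)"
    using AM DM by (intro M.finite_measure_mono) auto
  also have "\<dots> \<le> measure M (D \<inter> A) + measure M (sym_diff A D)"
    using AM DM by (intro measure_Un_le) auto
  also have "\<dots> \<le> a * measure M D + e"
    using bound[OF t D] lt by simp
  also have "measure M D \<le> measure M (A \<union> sym_diff A D)"
    using AM DM by (intro M.finite_measure_mono) auto
  also have "\<dots> \<le> measure M A + measure M (sym_diff A D)"
    using AM DM by (intro measure_Un_le) auto
  finally have "measure M A \<le> a * (measure M A + e) + e"
    using a lt by (smt (verit) mult_left_mono)
  moreover have "a * e \<le> e"
    using a \<open>e > 0\<close> by simp
  ultimately have "(1 - a) * measure M A \<le> 2 * e"
    by (simp add: algebra_simps)
  then show False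
    using \<open>e > 0\<close> by (simp add: e_def)
qed

locale strong_markov_family =
  fixes P :: "'m::{t2_space, second_countable_topology} \<Rightarrow> (real \<Rightarrow> 'm) measure"
  assumes strong_markov: "strong_markov P"
begin

lemma kernel: "P \<in> borel \<rightarrow>\<^sub>M prob_algebra path_space"
  using strong_markov by (simp add: strong_markov_def)

lemma prob_space_P: "prob_space (P z)" and sets_P [simp]: "sets (P z) = sets path_space"
  using measurable_space[OF kernel, of z] by (auto simp: space_prob_algebra)

lemma space_P [simp]: "space (P z) = paths"
  using sets_eq_imp_space_eq[OF sets_P] by simp

lemma measurable_P_iff [simp]: "f \<in> P z \<rightarrow>\<^sub>M N \<longleftrightarrow> f \<in> path_space \<rightarrow>\<^sub>M N"
  by (simp cong: measurable_cong_sets)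

lemma measurable_measure_P: "A \<in> sets path_space \<Longrightarrow> (\<lambda>z. measure (P z) A) \<in> borel_measurable borel"
  using measurable_compose[OF kernel measurable_measure_prob_algebra] by blast

lemma sets_filtration_P: "D \<in> sets (path_filtration t) \<Longrightarrow> D \<in> sets path_space"
  using path_filtration_subset by blast

lemma measure_eq_0_iff_AE:
  assumes "S \<in> sets path_space"
  shows "measure (P z) S = 0 \<longleftrightarrow> (AE \<omega> in P z. \<omega> \<notin> S)"
proof -
  interpret prob_space "P z" by (rule prob_space_P)
  show ?thesis
    using AE_iff_null_sets[of S "P z"] assms by (simp add: null_sets_def emeasure_eq_measure)
qed

lemma markov:
  assumes t: "t \<ge> 0" and D: "D \<in> sets (path_filtration (ennreal t))" and A: "A \<in> sets path_space"
  shows "emeasure (P z) {\<omega> \<in> D. shift t \<omega> \<in> A} = (\<integral>\<^sup>+\<omega>\<in>D. emeasure (P (\<omega> t)) A \<partial>P z)"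
proof -
  let ?T = "\<lambda>\<omega> :: real \<Rightarrow> 'm. ennreal t"
  have st: "stopping_time path_filtration ?T"
    by (rule stopping_time_const)
  have "{\<omega> \<in> D. ?T \<omega> \<le> u} \<in> sets (path_filtration u)" for u
    using D path_filtration.sets_F_mono[of "ennreal t" u] by (cases "ennreal t \<le> u") auto
  then have "D \<in> sets (path_filtration.pre_sigma ?T)"
    by (intro path_filtration.sets_pre_sigmaI[OF st])
  with strong_markov st A have "emeasure (P z) {\<omega> \<in> D. ?T \<omega> < \<infinity> \<and> shift (enn2real (?T \<omega>)) \<omega> \<in> A} =
      (\<integral>\<^sup>+\<omega>\<in>{\<omega> \<in> D. ?T \<omega> < \<infinity>}. emeasure (P (\<omega> (enn2real (?T \<omega>)))) A \<partial>P z)"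
    unfolding strong_markov_def by blast
  then show ?thesis
    using t by simp
qed

text \<open>
  The Markov property for functions, obtained by reading the one for events as an equality of
  measures: both sides integrate \<open>f\<close> against the law of the shifted path restricted to \<open>D\<close>.
\<close>

lemma markov_nn_integral:
  assumes t: "t \<ge> 0" and D: "D \<in> sets (path_filtration (ennreal t))"
    and f: "f \<in> borel_measurable path_space"
  shows "(\<integral>\<^sup>+\<omega>\<in>D. f (shift t \<omega>) \<partial>P z) = (\<integral>\<^sup>+\<omega>\<in>D. (\<integral>\<^sup>+\<omega>'. f \<omega>' \<partial>P (\<omega> t)) \<partial>P z)"
proof -
  interpret prob_space "P z" by (rule prob_space_P)
  have D': "D \<in> sets path_space"
    by (rule sets_filtration_P[OF D])
  let ?M = "density (P z) (indicator D)"
  have K: "(\<lambda>\<omega>. P (\<omega> t)) \<in> ?M \<rightarrow>\<^sub>M subprob_algebra path_space"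
    using measurable_compose[OF measurable_eval[OF t] measurable_prob_algebraD[OF kernel]] by simp
  have sh: "shift t \<in> path_space \<rightarrow>\<^sub>M path_space"
    by (rule measurable_shift[OF t])
  have eq: "distr ?M path_space (shift t) = ?M \<bind> (\<lambda>\<omega>. P (\<omega> t))"
  proof (rule measure_eqI)
    show "sets (distr ?M path_space (shift t)) = sets (?M \<bind> (\<lambda>\<omega>. P (\<omega> t)))"
      using sets_bind[of ?M "\<lambda>\<omega>. P (\<omega> t)" path_space] not_empty by simp
    fix A assume "A \<in> sets (distr ?M path_space (shift t))"
    then have A: "A \<in> sets path_space" by simp
    have vim: "shift t -` A \<inter> paths \<in> sets path_space"
      using measurable_sets[OF sh A] by simp
    have "emeasure (distr ?M path_space (shift t)) A = emeasure ?M (shift t -` A \<inter> paths)"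
      using sh A by (subst emeasure_distr) simp_all
    also have "\<dots> = (\<integral>\<^sup>+\<omega>. indicator D \<omega> * indicator (shift t -` A \<inter> paths) \<omega> \<partial>P z)"
      using D' vim by (subst emeasure_density) simp_all
    also have "\<dots> = (\<integral>\<^sup>+\<omega>. indicator (D \<inter> (shift t -` A \<inter> paths)) \<omega> \<partial>P z)"
      by (simp only: indicator_inter_arith)
    also have "\<dots> = emeasure (P z) (D \<inter> (shift t -` A \<inter> paths))"
      using D' vim by (intro nn_integral_indicator) simp
    also have "D \<inter> (shift t -` A \<inter> paths) = {\<omega> \<in> D. shift t \<omega> \<in> A}"
      using sets.sets_into_space[OF D'] by auto
    also have "emeasure (P z) \<dots> = (\<integral>\<^sup>+\<omega>\<in>D. emeasure (P (\<omega> t)) A \<partial>P z)"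
      by (rule markov[OF t D A])
    also have "\<dots> = (\<integral>\<^sup>+\<omega>. emeasure (P (\<omega> t)) A \<partial>?M)"
    proof (subst nn_integral_density)
      show "(\<lambda>\<omega>. emeasure (P (\<omega> t)) A) \<in> borel_measurable (P z)"
        using measurable_compose[OF K measurable_emeasure_subprob_algebra[OF A]] by simp
    qed (use D' in \<open>simp_all add: mult.commute\<close>)
    also have "\<dots> = emeasure (?M \<bind> (\<lambda>\<omega>. P (\<omega> t))) A"
      using not_empty by (intro emeasure_bind[OF _ K A, symmetric]) simp
    finally show "emeasure (distr ?M path_space (shift t)) A = emeasure (?M \<bind> (\<lambda>\<omega>. P (\<omega> t))) A" .
  qed
  have "(\<integral>\<^sup>+\<omega>\<in>D. f (shift t \<omega>) \<partial>P z) = (\<integral>\<^sup>+\<omega>. f (shift t \<omega>) \<partial>?M)"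
    using D' measurable_compose[OF sh f] by (subst nn_integral_density) (simp_all add: mult.commute)
  also have "\<dots> = (\<integral>\<^sup>+\<omega>. f \<omega> \<partial>distr ?M path_space (shift t))"
    using sh f by (subst nn_integral_distr) simp_all
  also have "\<dots> = (\<integral>\<^sup>+\<omega>. (\<integral>\<^sup>+\<omega>'. f \<omega>' \<partial>P (\<omega> t)) \<partial>?M)"
    unfolding eq by (rule nn_integral_bind[OF f K])
  also have "\<dots> = (\<integral>\<^sup>+\<omega>\<in>D. (\<integral>\<^sup>+\<omega>'. f \<omega>' \<partial>P (\<omega> t)) \<partial>P z)"
  proof (subst nn_integral_density)
    show "(\<lambda>\<omega>. \<integral>\<^sup>+\<omega>'. f \<omega>' \<partial>P (\<omega> t)) \<in> borel_measurable (P z)"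
      using measurable_compose[OF K nn_integral_measurable_subprob_algebra[OF f]] by simp
  qed (use D' in \<open>simp_all add: mult.commute\<close>)
  finally show ?thesis .
qed

text \<open>
  For an invariant event the shift disappears from the Markov property. In particular its
  probability is a harmonic function of the starting point.
\<close>

lemma markov_measure:
  assumes t: "t \<ge> 0" and D: "D \<in> sets (path_filtration (ennreal t))" and A: "A \<in> invariant_field id"
  shows "measure (P z) (D \<inter> A) = (LINT \<omega>:D|P z. measure (P (\<omega> t)) A)"
proof -
  interpret prob_space "P z" by (rule prob_space_P)
  note D' = sets_filtration_P[OF D] and A' = invariant_field_path_space[OF A]
  have m [measurable]: "(\<lambda>\<omega>. measure (P (\<omega> t)) A) \<in> borel_measurable path_space"
    by (rule measurable_compose[OF measurable_eval[OF t] measurable_measure_P[OF A']])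
  have "D \<subseteq> paths"
    using sets.sets_into_space[OF D] by simp
  then have "D \<inter> A = {\<omega> \<in> D. shift t \<omega> \<in> A}"
    using shift_mem_invariant_iff[OF A _ t] by auto
  then have "emeasure (P z) (D \<inter> A) = (\<integral>\<^sup>+\<omega>\<in>D. emeasure (P (\<omega> t)) A \<partial>P z)"
    using markov[OF t D A'] by simp
  also have "\<dots> = (\<integral>\<^sup>+\<omega>. ennreal (indicator D \<omega> * measure (P (\<omega> t)) A) \<partial>P z)"
    by (intro nn_integral_cong)
      (simp add: finite_measure.emeasure_eq_measure[OF prob_space.finite_measure[OF prob_space_P]]
        ennreal_mult' mult.commute flip: ennreal_indicator)
  also have "\<dots> = ennreal (LINT \<omega>:D|P z. measure (P (\<omega> t)) A)"
    unfolding set_lebesgue_integral_def real_scaleR_def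
  proof (rule nn_integral_eq_integral)
    show "integrable (P z) (\<lambda>\<omega>. indicator D \<omega> * measure (P (\<omega> t)) A)"
      by (rule integrable_const_bound[where B = 1])
        (use D' prob_space.prob_le_1[OF prob_space_P] in \<open>auto simp: indicator_def\<close>)
  qed simp
  finally show ?thesis
    unfolding emeasure_eq_measure by (simp add: set_lebesgue_integral_def integral_nonneg_AE)
qed

lemma measure_invariant_eq:
  assumes t: "t \<ge> 0" and A: "A \<in> invariant_field id"
  shows "measure (P z) A = (\<integral>\<omega>. measure (P (\<omega> t)) A \<partial>P z)"
proof -
  have "paths \<in> sets (path_filtration (ennreal t) :: (real \<Rightarrow> 'm) measure)"
    using sets.top[of "path_filtration (ennreal t)"] by simp
  from markov_measure[OF t this A, of z]
  have "measure (P z) A = (\<integral>\<omega>. indicator paths \<omega> *\<^sub>R measure (P (\<omega> t)) A \<partial>P z)"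
    using invariant_field_subset_paths[OF A] by (simp add: Int_absorb1 set_lebesgue_integral_def)
  also have "\<dots> = (\<integral>\<omega>. measure (P (\<omega> t)) A \<partial>P z)"
    by (rule Bochner_Integration.integral_cong) auto
  finally show ?thesis .
qed

lemma harmonic_measure_invariant:
  assumes A: "A \<in> invariant_field id"
  shows "harmonic P (\<lambda>z. measure (P z) A)"
  unfolding harmonic_def
proof (intro conjI allI impI)
  show "(\<lambda>z. measure (P z) A) \<in> borel_measurable borel"
    by (rule measurable_measure_P[OF invariant_field_path_space[OF A]])
  show "bounded (range (\<lambda>z. measure (P z) A))"
    unfolding bounded_iff using prob_space.prob_le_1[OF prob_space_P] by (intro exI[of _ 1]) auto
qed (rule measure_invariant_eq[OF _ A])

lemma integrable_bounded_eval:
  fixes H :: "'m \<Rightarrow> real"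
  assumes "H \<in> borel_measurable borel" "\<And>z. \<bar>H z\<bar> \<le> B" "t \<ge> 0" "D \<in> sets path_space"
  shows "integrable (P z) (\<lambda>\<omega>. indicator D \<omega> * H (\<omega> t))"
proof -
  interpret prob_space "P z" by (rule prob_space_P)
  have "(\<lambda>\<omega>. H (\<omega> t)) \<in> borel_measurable path_space"
    using assms by (intro measurable_compose[OF measurable_eval]) auto
  moreover have "0 \<le> B"
    using assms(2)[of z] by linarith
  ultimately show ?thesis
    using assms(2,4) by (intro integrable_const_bound[where B = B]) (auto simp: indicator_def)
qed

lemma integrable_eval:
  fixes H :: "'m \<Rightarrow> real"
  assumes "H \<in> borel_measurable borel" "\<And>z. \<bar>H z\<bar> \<le> B" "t \<ge> 0"
  shows "integrable (P z) (\<lambda>\<omega>. H (\<omega> t))"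
proof -
  interpret prob_space "P z" by (rule prob_space_P)
  have "(\<lambda>\<omega>. H (\<omega> t)) \<in> borel_measurable path_space"
    using assms by (intro measurable_compose[OF measurable_eval]) auto
  then show ?thesis
    using assms(2) by (intro integrable_const_bound[where B = B]) auto
qed

lemma harmonic_eq: "harmonic P H \<Longrightarrow> t \<ge> 0 \<Longrightarrow> H z = (\<integral>\<omega>. H (\<omega> t) \<partial>P z)"
  unfolding harmonic_def by blast

lemma harmonic_localized:
  assumes H: "harmonic P H" and H0: "\<And>z. 0 \<le> H z"
    and st: "0 \<le> s" "s \<le> t" and D: "D \<in> sets (path_filtration (ennreal s))"
  shows "(\<integral>\<^sup>+\<omega>\<in>D. ennreal (H (\<omega> t)) \<partial>P z) = (\<integral>\<^sup>+\<omega>\<in>D. ennreal (H (\<omega> s)) \<partial>P z)"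
proof -
  have Hm: "H \<in> borel_measurable borel"
    using H by (simp add: harmonic_def)
  obtain B where B: "\<And>z. \<bar>H z\<bar> \<le> B"
    using H by (auto simp: harmonic_def bounded_iff)
  define r where "r = t - s"
  have r: "r \<ge> 0" using st by (simp add: r_def)
  have mean: "(\<integral>\<^sup>+\<omega>. ennreal (H (\<omega> r)) \<partial>P y) = ennreal (H y)" for y
  proof -
    have "integrable (P y) (\<lambda>\<omega>. H (\<omega> r))"
      by (rule integrable_eval[OF Hm B r])
    then have "(\<integral>\<^sup>+\<omega>. ennreal (H (\<omega> r)) \<partial>P y) = ennreal (\<integral>\<omega>. H (\<omega> r) \<partial>P y)"
      using H0 by (intro nn_integral_eq_integral) auto
    also have "(\<integral>\<omega>. H (\<omega> r) \<partial>P y) = H y"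
      by (rule harmonic_eq[OF H r, symmetric])
    finally show ?thesis .
  qed
  have "(\<lambda>\<omega>. ennreal (H (\<omega> r))) \<in> borel_measurable path_space"
    using measurable_compose[OF measurable_eval[OF r] Hm] by simp
  from markov_nn_integral[OF st(1) D this, of z] show ?thesis
    using r by (simp add: mean) (simp add: r_def)
qed

text \<open>
  Let the time set grow by its largest element \<open>c\<close>. On the event \<open>D\<close> that the level is
  exceeded at \<open>c\<close> but not before, \<open>H (\<omega> T)\<close> has the same integral as \<open>H (\<omega> c)\<close>, which is
  larger than \<open>b\<close> there.
\<close>

lemma harmonic_maximal_inequality_finite:
  assumes H: "harmonic P H" and H0: "\<And>z. 0 \<le> H z" and b: "0 \<le> b"
    and S: "finite S" "\<And>s. s \<in> S \<Longrightarrow> 0 \<le> s \<and> s \<le> T"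
  shows "ennreal b * emeasure (P z) {\<omega> \<in> paths. \<exists>s\<in>S. H (\<omega> s) > b} \<le>
    (\<integral>\<^sup>+\<omega>\<in>{\<omega> \<in> paths. \<exists>s\<in>S. H (\<omega> s) > b}. ennreal (H (\<omega> T)) \<partial>P z)"
  using S
proof (induction S rule: finite_linorder_max_induct)
  case empty
  then show ?case by simp
next
  case (insert c S)
  have Hm: "H \<in> borel_measurable borel"
    using H by (simp add: harmonic_def)
  have c: "0 \<le> c" "c \<le> T" and S: "\<And>s. s \<in> S \<Longrightarrow> 0 \<le> s \<and> s \<le> c"
    using insert.prems insert.hyps(2) by (auto intro: less_imp_le)
  have T: "0 \<le> T" using c by simp
  define hit where "hit S = {\<omega> \<in> paths. \<exists>s\<in>S. H (\<omega> s) > b}" for S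
  define D where "D = {\<omega> \<in> paths. H (\<omega> c) > b} - hit S"
  have level: "{\<omega> \<in> paths. H (\<omega> s) > b} \<in> sets (path_filtration (ennreal c))" if "0 \<le> s" "s \<le> c" for s
  proof -
    have "(\<lambda>\<omega>. H (\<omega> s)) \<in> borel_measurable (path_filtration (ennreal c))"
      using that by (intro measurable_compose[OF measurable_eval_filtration Hm] ennreal_leI)
    then have "{\<omega> \<in> space (path_filtration (ennreal c)). H (\<omega> s) > b} \<in> sets (path_filtration (ennreal c))"
      by measurable
    then show ?thesis by simp
  qed
  have "hit S = (\<Union>s\<in>S. {\<omega> \<in> paths. H (\<omega> s) > b})"
    by (auto simp: hit_def)
  then have hitS: "hit S \<in> sets (path_filtration (ennreal c))"
    using level S insert.hyps(1) by auto
  then have D: "D \<in> sets (path_filtration (ennreal c))"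
    unfolding D_def using level[OF c(1)] by auto
  have hit_insert: "hit (insert c S) = hit S \<union> D" "hit S \<inter> D = {}"
    by (auto simp: hit_def D_def)
  note D' = sets_filtration_P[OF D] and hitS' = sets_filtration_P[OF hitS]
  have HT: "(\<lambda>\<omega>. ennreal (H (\<omega> T))) \<in> borel_measurable path_space"
    using measurable_compose[OF measurable_eval[OF T] Hm] by simp
  have "ennreal b * emeasure (P z) (hit (insert c S)) =
      ennreal b * emeasure (P z) (hit S) + ennreal b * emeasure (P z) D"
    unfolding hit_insert(1) using hit_insert(2) D' hitS'
    by (subst plus_emeasure[symmetric]) (simp_all add: distrib_left)
  also have "ennreal b * emeasure (P z) (hit S) \<le> (\<integral>\<^sup>+\<omega>\<in>hit S. ennreal (H (\<omega> T)) \<partial>P z)"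
    unfolding hit_def using S c by (intro insert.IH) (meson order_trans)
  also have "ennreal b * emeasure (P z) D = (\<integral>\<^sup>+\<omega>\<in>D. ennreal b \<partial>P z)"
    using D' by (simp add: nn_integral_cmult_indicator)
  also have "\<dots> \<le> (\<integral>\<^sup>+\<omega>\<in>D. ennreal (H (\<omega> c)) \<partial>P z)"
    by (intro nn_integral_mono) (auto simp: D_def indicator_def intro: ennreal_leI)
  also have "\<dots> = (\<integral>\<^sup>+\<omega>\<in>D. ennreal (H (\<omega> T)) \<partial>P z)"
    by (rule harmonic_localized[OF H H0 c D, symmetric])
  also have "(\<integral>\<^sup>+\<omega>\<in>hit S. ennreal (H (\<omega> T)) \<partial>P z) + (\<integral>\<^sup>+\<omega>\<in>D. ennreal (H (\<omega> T)) \<partial>P z) =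
      (\<integral>\<^sup>+\<omega>\<in>hit (insert c S). ennreal (H (\<omega> T)) \<partial>P z)"
    unfolding hit_insert(1) using HT D' hitS' hit_insert(2)
    by (subst nn_integral_disjoint_pair) simp_all
  finally show ?case
    unfolding hit_def by (simp add: add_mono)
qed

lemma harmonic_maximal_inequality:
  assumes H: "harmonic P H" and H0: "\<And>z. 0 \<le> H z" and b: "0 \<le> b"
  shows "b * measure (P z) {\<omega> \<in> paths. \<exists>q\<in>\<rat>. 0 \<le> q \<and> H (\<omega> q) > b} \<le> H z"
proof (cases "b = 0")
  case False
  then have b0: "b > 0" using b by simp
  interpret prob_space "P z" by (rule prob_space_P)
  have Hm: "H \<in> borel_measurable borel"
    using H by (simp add: harmonic_def)
  obtain B where B: "\<And>z. \<bar>H z\<bar> \<le> B"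
    using H by (auto simp: harmonic_def bounded_iff)
  define I where "I = {q \<in> \<rat>. 0 \<le> (q :: real)}"
  have level: "{\<omega> \<in> paths. H (\<omega> q) > b} \<in> sets path_space" if "q \<in> I" for q
  proof -
    have "(\<lambda>\<omega>. H (\<omega> q)) \<in> borel_measurable path_space"
      using that by (intro measurable_compose[OF measurable_eval Hm]) (simp add: I_def)
    then have "{\<omega> \<in> space path_space. H (\<omega> q) > b} \<in> sets path_space"
      by measurable
    then show ?thesis by simp
  qed
  have "measure (P z) (\<Union>q\<in>I. {\<omega> \<in> paths. H (\<omega> q) > b}) \<le> H z / b"
  proof (rule measure_UN_bound)
    show "countable I"
      unfolding I_def by (rule countable_subset[OF _ countable_rat]) auto
    show "{\<omega> \<in> paths. H (\<omega> q) > b} \<in> fmeasurable (P z)" if "q \<in> I" for q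
      using level[OF that] by (simp add: fmeasurable_eq_sets)
    fix S assume S: "S \<subseteq> I" "finite S"
    define T where "T = Max (insert 0 S)"
    have T: "0 \<le> s \<and> s \<le> T" if "s \<in> S" for s
      using that S by (auto simp: T_def I_def)
    have T0: "T \<ge> 0"
      using S by (auto simp: T_def)
    define hit where "hit = {\<omega> \<in> paths. \<exists>s\<in>S. H (\<omega> s) > b}"
    have "ennreal b * emeasure (P z) hit \<le> (\<integral>\<^sup>+\<omega>\<in>hit. ennreal (H (\<omega> T)) \<partial>P z)"
      unfolding hit_def using T by (intro harmonic_maximal_inequality_finite[OF H H0 b S(2)])
    also have "\<dots> \<le> (\<integral>\<^sup>+\<omega>. ennreal (H (\<omega> T)) \<partial>P z)"
      by (intro nn_integral_mono) (auto simp: indicator_def)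
    also have "\<dots> = ennreal (\<integral>\<omega>. H (\<omega> T) \<partial>P z)"
    proof (rule nn_integral_eq_integral)
      show "integrable (P z) (\<lambda>\<omega>. H (\<omega> T))"
        by (rule integrable_eval[OF Hm B T0])
    qed (use H0 in auto)
    also have "(\<integral>\<omega>. H (\<omega> T) \<partial>P z) = H z"
      by (rule harmonic_eq[OF H T0, symmetric])
    finally have "b * measure (P z) hit \<le> H z"
      using b H0[of z] by (simp add: emeasure_eq_measure flip: ennreal_mult)
    moreover have "(\<Union>q\<in>S. {\<omega> \<in> paths. H (\<omega> q) > b}) = hit"
      by (auto simp: hit_def)
    ultimately show "measure (P z) (\<Union>q\<in>S. {\<omega> \<in> paths. H (\<omega> q) > b}) \<le> H z / b"
      using b0 by (simp add: field_simps)
  qed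
  moreover have "(\<Union>q\<in>I. {\<omega> \<in> paths. H (\<omega> q) > b}) = {\<omega> \<in> paths. \<exists>q\<in>\<rat>. 0 \<le> q \<and> H (\<omega> q) > b}"
    by (auto simp: I_def)
  ultimately show ?thesis
    using b0 by (simp add: field_simps)
qed (simp add: H0)

lemma measurable_hit:
  assumes "H \<in> borel_measurable borel"
  shows "{\<omega> \<in> paths. \<exists>q\<in>\<rat>. 0 \<le> q \<and> H (\<omega> q) > (b::real)} \<in> sets path_space"
proof -
  have "{\<omega> \<in> paths. \<exists>q\<in>\<rat>. 0 \<le> q \<and> H (\<omega> q) > b} =
      (\<Union>q\<in>{q\<in>\<rat>. 0 \<le> q}. {\<omega> \<in> space path_space. H (\<omega> q) > b})"
    by auto
  also have "\<dots> \<in> sets path_space"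
  proof (rule sets.countable_UN'')
    show "countable {q\<in>\<rat>. 0 \<le> (q::real)}"
      by (rule countable_subset[OF _ countable_rat]) auto
    fix q :: real assume "q \<in> {q\<in>\<rat>. 0 \<le> q}"
    then have "(\<lambda>\<omega>. H (\<omega> q)) \<in> borel_measurable path_space"
      by (intro measurable_compose[OF measurable_eval assms]) simp
    then show "{\<omega> \<in> space path_space. H (\<omega> q) > b} \<in> sets path_space"
      by measurable
  qed
  finally show ?thesis .
qed

lemma not_eventually_in_imp_hit:
  assumes \<omega>: "\<omega> \<in> paths" and H: "continuous_on UNIV H" and n: "\<not> (\<forall>\<^sub>F t in at_top. H (\<omega> t) \<le> b)"
  shows "\<exists>q\<in>\<rat>. 0 \<le> q \<and> H (\<omega> q) > (b :: real)"
proof (rule ccontr)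
  assume "\<not> (\<exists>q\<in>\<rat>. 0 \<le> q \<and> H (\<omega> q) > b)"
  then have "H (\<omega> t) \<in> {..b}" if "t \<ge> 0" for t
    using path_closed_rational_times[OF \<omega> H closed_atMost, of 0 b t] that by (auto simp: not_less)
  then show False
    using n by (auto simp: eventually_at_top_linorder)
qed

text \<open>
  Suppose the probability \<open>u z\<close> were strictly between \<open>0\<close> and \<open>1\<close>, and choose \<open>a\<close> between \<open>u z\<close>
  and \<open>1\<close>. As \<open>u\<close> is a function of \<open>\<pi>\<close>, the event \<open>E\<close> that \<open>u\<close> eventually stays at or below \<open>a\<close> along
  the path belongs to the trivial field of \<open>\<pi>\<close>. If \<open>E\<close> is null, the level \<open>a\<close> is exceeded almost
  surely and the maximal inequality gives \<open>a \<le> u z\<close>. If \<open>E\<close> is almost sure, the Markov property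
  at large times shows that \<open>A\<close> fills at most the fraction \<open>a\<close> of every event observed up to a
  finite time, so that \<open>A\<close> is null.
\<close>

lemma factor_invariant_event_trivial:
  fixes \<pi> :: "'m \<Rightarrow> 'b::topological_space" and F :: "'b \<Rightarrow> real"
  assumes A: "A \<in> invariant_field id" and \<pi>: "continuous_on UNIV \<pi>" and F: "continuous_on UNIV F"
    and u: "\<And>z. measure (P z) A = F (\<pi> z)" and triv: "trivial_field (P z) (invariant_field \<pi>)"
  shows "measure (P z) A = 0 \<or> measure (P z) A = 1"
proof (rule ccontr)
  interpret prob_space "P z" by (rule prob_space_P)
  assume "\<not> (measure (P z) A = 0 \<or> measure (P z) A = 1)"
  then have p: "0 < measure (P z) A" "measure (P z) A < 1"
    using prob_le_1[of A] measure_nonneg[of "P z" A] by linarith+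
  then obtain a where a: "measure (P z) A < a" "a < 1"
    using dense by blast
  have a0: "a > 0" using a p by linarith
  define u where "u z = measure (P z) A" for z
  have u_eq: "u y = F (\<pi> y)" for y using u by (simp add: u_def)
  have u_cont: "continuous_on UNIV u"
    unfolding u_eq[abs_def] by (rule continuous_on_compose2[OF F \<pi>]) auto
  have u01: "0 \<le> u y" "u y \<le> 1" for y
    using prob_space.prob_le_1[OF prob_space_P] by (simp_all add: u_def)
  have um: "u \<in> borel_measurable borel"
    by (rule borel_measurable_continuous_onI[OF u_cont])
  define E where "E = eventually_in \<pi> (F -` {..a})"
  have "closed (F -` {..a})"
    by (rule closed_vimage[OF closed_atMost F])
  then have E: "E \<in> invariant_field \<pi>"
    unfolding E_def by (rule eventually_in_invariant[OF \<pi>])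
  have E_iff: "\<omega> \<in> E \<longleftrightarrow> \<omega> \<in> paths \<and> (\<forall>\<^sub>F t in at_top. u (\<omega> t) \<le> a)" for \<omega>
    by (simp add: E_def eventually_in_def u_eq)
  have Em: "E \<in> sets path_space"
    by (rule invariant_field_path_space[OF invariant_field_mono[OF borel_measurable_continuous_onI[OF \<pi>] E]])
  have "measure (P z) E = 0 \<or> measure (P z) E = 1"
    using triv E by (simp add: trivial_field_def)
  then show False
  proof
    assume E0: "measure (P z) E = 0"
    define hit where "hit = {\<omega> \<in> paths. \<exists>q\<in>\<rat>. 0 \<le> q \<and> u (\<omega> q) > a}"
    have hit_m: "hit \<in> sets path_space"
      unfolding hit_def by (rule measurable_hit[OF um])
    have "paths - E \<subseteq> hit"
      using not_eventually_in_imp_hit[OF _ u_cont] by (auto simp: E_iff hit_def)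
    then have "measure (P z) (paths - E) \<le> measure (P z) hit"
      using hit_m by (intro finite_measure_mono) auto
    then have "1 \<le> measure (P z) hit"
      using prob_compl[of E] E0 Em by simp
    then have "measure (P z) hit = 1"
      using prob_le_1[of hit] by linarith
    then have "a \<le> u z"
      using harmonic_maximal_inequality[OF harmonic_measure_invariant[OF A], of a z] a0
      by (simp add: hit_def u_def)
    with a show False by (simp add: u_def)
  next
    assume E1: "measure (P z) E = 1"
    have "AE \<omega> in P z. \<omega> \<in> E"
      using AE_in_set_eq_1[of E] E1 Em by simp
    then have ev: "AE \<omega> in P z. \<forall>\<^sub>F t in at_top. u (\<omega> t) \<le> a"
      by eventually_elim (simp add: E_iff)
    have "measure (P z) A = 0"
    proof (rule measure_eq_0_of_cylinder_bound[OF prob_space_P sets_P invariant_field_cylinder[OF A]])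
      fix t D assume t: "t \<ge> 0" and D: "D \<in> sets (path_filtration (ennreal t) :: (real \<Rightarrow> 'm) measure)"
      note D' = sets_filtration_P[OF D]
      have meas: "(\<lambda>\<omega>. indicator D \<omega> * max (u (\<omega> (t + real n))) a) \<in> borel_measurable (P z)" for n
      proof -
        have "(\<lambda>\<omega>. u (\<omega> (t + real n))) \<in> borel_measurable path_space"
          using t by (intro measurable_compose[OF measurable_eval um]) simp
        then show ?thesis
          using D' by simp
      qed
      have bd: "norm (indicator D \<omega> * max (u (\<omega> (t + real n))) a) \<le> 1" for \<omega> n
        using u01 a a0 by (auto simp: indicator_def)
      have le: "measure (P z) (D \<inter> A) \<le> (\<integral>\<omega>. indicator D \<omega> * max (u (\<omega> (t + real n))) a \<partial>P z)" for n
      proof -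
        have "D \<in> sets (path_filtration (ennreal (t + real n)))"
          by (rule path_filtration_mono[OF _ D]) simp
        then have "measure (P z) (D \<inter> A) = (\<integral>\<omega>. indicator D \<omega> * u (\<omega> (t + real n)) \<partial>P z)"
          using markov_measure[OF _ _ A, of "t + real n" D z] t
          by (simp add: set_lebesgue_integral_def u_def)
        also have "\<dots> \<le> (\<integral>\<omega>. indicator D \<omega> * max (u (\<omega> (t + real n))) a \<partial>P z)"
        proof (rule integral_mono)
          show "integrable (P z) (\<lambda>\<omega>. indicator D \<omega> * u (\<omega> (t + real n)))"
            using t u01 by (intro integrable_bounded_eval[OF um _ _ D', where B = 1]) auto
          show "integrable (P z) (\<lambda>\<omega>. indicator D \<omega> * max (u (\<omega> (t + real n))) a)"
            using meas bd by (intro integrable_const_bound[where B = 1]) auto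
        qed (auto simp: indicator_def)
        finally show ?thesis .
      qed
      have "(\<lambda>n. \<integral>\<omega>. indicator D \<omega> * max (u (\<omega> (t + real n))) a \<partial>P z) \<longlonglongrightarrow>
        (\<integral>\<omega>. indicator D \<omega> * a \<partial>P z)"
      proof (rule integral_dominated_convergence[where w = "\<lambda>_. 1"])
        show "AE \<omega> in P z. (\<lambda>n. indicator D \<omega> * max (u (\<omega> (t + real n))) a) \<longlonglongrightarrow> indicator D \<omega> * a"
          using ev
        proof eventually_elim
          case (elim \<omega>)
          have "filterlim (\<lambda>n. t + real n) at_top sequentially"
            by (rule filterlim_tendsto_add_at_top[OF tendsto_const filterlim_real_sequentially])
          then have "\<forall>\<^sub>F n in sequentially. u (\<omega> (t + real n)) \<le> a"
            using elim by (rule eventually_compose_filterlim[rotated])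
          then have "\<forall>\<^sub>F n in sequentially. indicator D \<omega> * max (u (\<omega> (t + real n))) a = indicator D \<omega> * a"
            by eventually_elim simp
          then show ?case by (rule tendsto_eventually)
        qed
      qed (use meas bd D' in auto)
      then have "measure (P z) (D \<inter> A) \<le> (\<integral>\<omega>. indicator D \<omega> * a \<partial>P z)"
        by (rule LIMSEQ_le_const) (use le in auto)
      also have "\<dots> = a * measure (P z) D"
        using D' sets.sets_into_space[OF D'] by (simp add: Int_absorb2)
      finally show "measure (P z) (D \<inter> A) \<le> a * measure (P z) D" .
    qed (use a a0 in auto)
    with p show False by simp
  qed
qed

text \<open>
  Otherwise, by the Markov property, the event would fill at most the fraction \<open>1 - e\<close> of each
  event observed up to a finite time.
\<close>

lemma invariant_event_nearly_sure_somewhere: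
  assumes A: "A \<in> invariant_field id" and pos: "measure (P z) A \<noteq> 0" and e: "0 < e" "e \<le> 1"
  shows "\<exists>y. measure (P y) A > 1 - e"
proof (rule ccontr)
  interpret prob_space "P z" by (rule prob_space_P)
  assume "\<not> (\<exists>y. measure (P y) A > 1 - e)"
  then have le: "measure (P y) A \<le> 1 - e" for y
    by (simp add: not_less)
  have "measure (P z) A = 0"
  proof (rule measure_eq_0_of_cylinder_bound[OF prob_space_P sets_P invariant_field_cylinder[OF A]])
    fix t D assume t: "t \<ge> 0" and D: "D \<in> sets (path_filtration (ennreal t) :: (real \<Rightarrow> 'm) measure)"
    note D' = sets_filtration_P[OF D]
    have "measure (P z) (D \<inter> A) = (\<integral>\<omega>. indicator D \<omega> * measure (P (\<omega> t)) A \<partial>P z)"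
      using markov_measure[OF t D A] by (simp add: set_lebesgue_integral_def)
    also have "\<dots> \<le> (\<integral>\<omega>. indicator D \<omega> * (1 - e) \<partial>P z)"
    proof (rule integral_mono)
      show "integrable (P z) (\<lambda>\<omega>. indicator D \<omega> * measure (P (\<omega> t)) A)"
        using measurable_measure_P[OF invariant_field_path_space[OF A]] prob_space.prob_le_1[OF prob_space_P] t D'
        by (intro integrable_bounded_eval[where B = 1]) auto
      show "integrable (P z) (\<lambda>\<omega>. indicator D \<omega> * (1 - e))"
        using D' by (intro integrable_mult_left integrable_real_indicator) (auto simp: emeasure_eq_measure)
    qed (use le in \<open>auto simp: indicator_def\<close>)
    also have "\<dots> = (1 - e) * measure (P z) D"
      using D' sets.sets_into_space[OF D'] by (simp add: Int_absorb2)
    finally show "measure (P z) (D \<inter> A) \<le> (1 - e) * measure (P z) D" .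
  qed (use e in auto)
  with pos show False by simp
qed

lemma exceedance_invariant:
  assumes H: "continuous_on UNIV H"
  shows "{\<omega> \<in> paths. \<not> (\<forall>\<^sub>F t in at_top. H (\<omega> t) \<le> (b :: real))} \<in> invariant_field id"
proof -
  have "closed (H -` {..b})"
    by (rule closed_vimage[OF closed_atMost H])
  then have "eventually_in id (H -` {..b}) \<in> sets (invariant_algebra id)"
    using eventually_in_invariant[OF continuous_on_id] by (simp add: id_def)
  from sets.compl_sets[OF this] have "paths - eventually_in id (H -` {..b}) \<in> invariant_field id"
    by simp
  moreover have "paths - eventually_in id (H -` {..b}) = {\<omega> \<in> paths. \<not> (\<forall>\<^sub>F t in at_top. H (\<omega> t) \<le> b)}"
    by (auto simp: eventually_in_def)
  ultimately show ?thesis by simp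
qed

lemma harmonic_ge_exceedance:
  assumes H: "harmonic P H" "\<And>z. 0 \<le> H z" "continuous_on UNIV H" and b: "0 \<le> b"
    and A: "A \<subseteq> {\<omega> \<in> paths. \<not> (\<forall>\<^sub>F t in at_top. H (\<omega> t) \<le> b)}"
  shows "b * measure (P z) A \<le> H z"
proof -
  interpret prob_space "P z" by (rule prob_space_P)
  have "A \<subseteq> {\<omega> \<in> paths. \<exists>q\<in>\<rat>. 0 \<le> q \<and> H (\<omega> q) > b}"
    using A not_eventually_in_imp_hit[OF _ H(3)] by blast
  moreover have "H \<in> borel_measurable borel"
    using H(1) by (simp add: harmonic_def)
  ultimately have "measure (P z) A \<le> measure (P z) {\<omega> \<in> paths. \<exists>q\<in>\<rat>. 0 \<le> q \<and> H (\<omega> q) > b}"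
    using measurable_hit by (intro finite_measure_mono) simp_all
  with b have "b * measure (P z) A \<le> b * measure (P z) {\<omega> \<in> paths. \<exists>q\<in>\<rat>. 0 \<le> q \<and> H (\<omega> q) > b}"
    by (rule mult_left_mono[rotated])
  also have "\<dots> \<le> H z"
    by (rule harmonic_maximal_inequality[OF H(1,2) b])
  finally show ?thesis .
qed

lemma harmonic_affine:
  assumes "harmonic P H"
  shows "harmonic P (\<lambda>z. c * H z + d)"
  unfolding harmonic_def
proof (intro conjI allI impI)
  have Hm [measurable]: "H \<in> borel_measurable borel"
    using assms by (simp add: harmonic_def)
  show "(\<lambda>z. c * H z + d) \<in> borel_measurable borel"
    by measurable
  obtain B where B: "\<And>z. \<bar>H z\<bar> \<le> B"
    using assms by (auto simp: harmonic_def bounded_iff)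
  have "\<bar>c * H z + d\<bar> \<le> \<bar>c\<bar> * B + \<bar>d\<bar>" for z
  proof -
    have "\<bar>c * H z + d\<bar> \<le> \<bar>c\<bar> * \<bar>H z\<bar> + \<bar>d\<bar>"
      by (metis abs_mult abs_triangle_ineq)
    also have "\<bar>c\<bar> * \<bar>H z\<bar> \<le> \<bar>c\<bar> * B"
      by (rule mult_left_mono[OF B]) simp
    finally show ?thesis by simp
  qed
  then show "bounded (range (\<lambda>z. c * H z + d))"
    unfolding bounded_iff by (intro exI[of _ "\<bar>c\<bar> * B + \<bar>d\<bar>"]) auto
  fix t :: real and z assume t: "t \<ge> 0"
  interpret prob_space "P z" by (rule prob_space_P)
  have "integrable (P z) (\<lambda>\<omega>. H (\<omega> t))"
    by (rule integrable_eval[OF Hm B t])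
  then have "(\<integral>\<omega>. c * H (\<omega> t) + d \<partial>P z) = c * (\<integral>\<omega>. H (\<omega> t) \<partial>P z) + d"
    using prob_space by simp
  then show "c * H z + d = (\<integral>\<omega>. c * H (\<omega> t) + d \<partial>P z)"
    by (simp flip: harmonic_eq[OF assms t])
qed

text \<open>
  Oscillation between \<open>a\<close> and \<open>b\<close> is an invariant event. If it had positive probability, it would
  have probability \<open>p\<close> close to \<open>1\<close> from some point \<open>y\<close>. The maximal inequality for \<open>H\<close> and for
  \<open>1 - H\<close> then gives \<open>b p \<le> H y\<close> and \<open>(1 - a) p \<le> 1 - H y\<close>, whose sum is impossible for \<open>p\<close> close
  to \<open>1\<close>.
\<close>

lemma harmonic_no_oscillation:
  assumes H: "harmonic P H" "\<And>z. 0 \<le> H z" "\<And>z. H z \<le> 1" "continuous_on UNIV H"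
    and ab: "0 \<le> a" "a < b" "b \<le> 1"
  shows "AE \<omega> in P z. (\<forall>\<^sub>F t in at_top. H (\<omega> t) \<le> b) \<or> (\<forall>\<^sub>F t in at_top. a \<le> H (\<omega> t))"
proof -
  interpret prob_space "P z" by (rule prob_space_P)
  define A1 where "A1 = {\<omega> \<in> paths. \<not> (\<forall>\<^sub>F t in at_top. H (\<omega> t) \<le> b)}"
  define A2 where "A2 = {\<omega> \<in> paths. \<not> (\<forall>\<^sub>F t in at_top. (- 1) * H (\<omega> t) + 1 \<le> 1 - a)}"
  have cont: "continuous_on UNIV (\<lambda>z. (- 1) * H z + 1)"
    by (intro continuous_on_add continuous_on_mult continuous_on_const H)
  have A1: "A1 \<in> sets (invariant_algebra id)" and A2: "A2 \<in> sets (invariant_algebra id)"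
    unfolding A1_def A2_def using exceedance_invariant[OF H(4)] exceedance_invariant[OF cont]
    by (simp_all only: sets_invariant_algebra)
  then have A: "A1 \<inter> A2 \<in> invariant_field id"
    using sets.Int[OF A1 A2] by simp
  have "measure (P z) (A1 \<inter> A2) = 0"
  proof (rule ccontr)
    assume pos: "measure (P z) (A1 \<inter> A2) \<noteq> 0"
    \<comment> \<open>with \<open>d = b - a\<close>, \<open>(1 + d) (1 - d / 4) = 1 + 3 d / 4 - d\<^sup>2 / 4 > 1\<close>\<close>
    define e where "e = (b - a) / 4"
    have e: "0 < e" "e \<le> 1" using ab by (auto simp: e_def)
    obtain y where y: "measure (P y) (A1 \<inter> A2) > 1 - e"
      using invariant_event_nearly_sure_somewhere[OF A pos e] by blast
    define p where "p = measure (P y) (A1 \<inter> A2)"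
    have "b * p \<le> H y"
      unfolding p_def using ab by (intro harmonic_ge_exceedance[OF H(1,2,4)]) (auto simp: A1_def)
    moreover have "(1 - a) * p \<le> (- 1) * H y + 1"
      unfolding p_def using ab H(3) by (intro harmonic_ge_exceedance[OF harmonic_affine[OF H(1)] _ cont]) (auto simp: A2_def)
    ultimately have "(1 + (b - a)) * p \<le> 1"
      by (simp add: algebra_simps)
    moreover have "(1 + (b - a)) * (1 - e) < (1 + (b - a)) * p"
      using y ab by (intro mult_strict_left_mono) (auto simp: p_def)
    ultimately have lt: "(1 + (b - a)) * (1 - e) < 1"
      by linarith
    define d where "d = b - a"
    have d: "0 < d" "d \<le> 1"
      using ab by (auto simp: d_def)
    have "(1 + d) * (1 - e) = 1 + 3 * d / 4 - d * d / 4"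
      by (simp add: e_def d_def field_simps)
    moreover have "d * d \<le> d * 1"
      using d by (intro mult_left_mono) auto
    ultimately show False
      using lt d unfolding d_def[symmetric] by linarith
  qed
  moreover have "A1 \<inter> A2 \<in> sets path_space"
    by (rule invariant_field_path_space[OF A])
  ultimately have "AE \<omega> in P z. \<omega> \<notin> A1 \<inter> A2"
    by (intro AE_not_in) (auto simp: null_sets_def emeasure_eq_measure)
  then show ?thesis
    using AE_space[of "P z"] by eventually_elim (auto simp: A1_def A2_def)
qed

text \<open>
  The limit superior of \<open>H\<close> along the path, for \<open>H\<close> with values in \<open>[0, 1]\<close>. It is written
  through the invariant events that \<open>H\<close> exceeds \<open>q\<close> at arbitrarily large times, so that replacing
  these events by events \<open>{g\<^sub>\<infinity> \<in> B\<^sub>q}\<close> turns it into a function of \<open>g\<^sub>\<infinity>\<close>.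
\<close>

definition exceedance_limsup :: "('m \<Rightarrow> real) \<Rightarrow> (real \<Rightarrow> 'm) \<Rightarrow> real" where
  "exceedance_limsup H \<omega> =
     (SUP q\<in>\<rat> \<inter> {0..1}. q * indicator {\<omega> \<in> paths. \<not> (\<forall>\<^sub>F t in at_top. H (\<omega> t) \<le> q)} \<omega>)"

lemma bdd_above_weighted_indicators:
  "bdd_above ((\<lambda>q. q * indicator (B q) x) ` (\<rat> \<inter> {0..1::real}))"
  by (rule bdd_aboveI[of _ 1]) (auto simp: indicator_def)

lemma unit_rats_nonempty: "\<rat> \<inter> {0..1::real} \<noteq> {}"
  using Rats_0 by force

lemma harmonic_limit:
  assumes H: "harmonic P H" "\<And>z. 0 \<le> H z" "\<And>z. H z \<le> 1" "continuous_on UNIV H"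
  shows "AE \<omega> in P z. (\<lambda>n. H (\<omega> (real n))) \<longlonglongrightarrow> exceedance_limsup H \<omega>"
proof -
  define I where "I = {(a, b). a \<in> \<rat> \<and> b \<in> \<rat> \<and> 0 \<le> a \<and> a < b \<and> b \<le> (1::real)}"
  have "I \<subseteq> \<rat> \<times> \<rat>"
    by (auto simp: I_def)
  then have "countable I"
    by (rule countable_subset) (intro countable_SIGMA countable_rat)
  have "AE \<omega> in P z. \<forall>i\<in>I. (\<forall>\<^sub>F t in at_top. H (\<omega> t) \<le> snd i) \<or> (\<forall>\<^sub>F t in at_top. fst i \<le> H (\<omega> t))"
    unfolding AE_ball_countable[OF \<open>countable I\<close>]
    by (intro ballI harmonic_no_oscillation H) (auto simp: I_def)
  then show ?thesis
    using AE_space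
  proof eventually_elim
    case (elim \<omega>)
    let ?Z = "exceedance_limsup H \<omega>"
    let ?z = "\<lambda>q. q * indicator {\<omega> \<in> paths. \<not> (\<forall>\<^sub>F t in at_top. H (\<omega> t) \<le> q)} \<omega>"
    have Z_ge: "?z q \<le> ?Z" if "q \<in> \<rat>" "0 \<le> q" "q \<le> 1" for q
      unfolding exceedance_limsup_def using that
      by (intro cSUP_upper bdd_above_weighted_indicators) auto
    have "((\<lambda>t. H (\<omega> t)) \<longlongrightarrow> ?Z) at_top"
    proof (rule order_tendstoI)
      fix c assume c: "?Z < c"
      show "\<forall>\<^sub>F t in at_top. H (\<omega> t) < c"
      proof (cases "c > 1")
        case True
        then show ?thesis
          using H(3) by (auto intro!: always_eventually intro: order.strict_trans1)
      next
        case False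
        obtain q where q: "q \<in> \<rat>" "?Z < q" "q < c"
          using Rats_dense_in_real[OF c] by blast
        have "0 \<le> ?Z"
          using Z_ge[of 0] by simp
        then have "?z q \<le> ?Z"
          using q False by (intro Z_ge) auto
        then have "?z q < q"
          using q(2) by linarith
        then have "\<forall>\<^sub>F t in at_top. H (\<omega> t) \<le> q"
        proof (rule contrapos_pp)
          assume "\<not> (\<forall>\<^sub>F t in at_top. H (\<omega> t) \<le> q)"
          then show "\<not> ?z q < q"
            using elim(2) by simp
        qed
        then show ?thesis
          by eventually_elim (use q in simp)
      qed
    next
      fix c assume c: "c < ?Z"
      show "\<forall>\<^sub>F t in at_top. c < H (\<omega> t)"
      proof (cases "c < 0")
        case True
        then show ?thesis
          using H(2) by (auto intro!: always_eventually intro: order.strict_trans2)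
      next
        case False
        obtain q where q: "q \<in> \<rat> \<inter> {0..1}" "c < ?z q"
          using less_cSUP_iff[OF unit_rats_nonempty bdd_above_weighted_indicators,
              THEN iffD1, OF c[unfolded exceedance_limsup_def]] by blast
        then have cq: "c < q" and nq: "\<not> (\<forall>\<^sub>F t in at_top. H (\<omega> t) \<le> q)"
          using False by (cases "\<forall>\<^sub>F t in at_top. H (\<omega> t) \<le> q"; cases "\<omega> \<in> paths"; simp)+
        obtain a where a: "a \<in> \<rat>" "c < a" "a < q"
          using Rats_dense_in_real[OF cq] by blast
        then have "(a, q) \<in> I"
          using q False by (auto simp: I_def)
        then have "\<forall>\<^sub>F t in at_top. a \<le> H (\<omega> t)"
          using elim(1) nq by force
        then show ?thesis
          by eventually_elim (use a in simp)
      qed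
    qed
    then show ?case
      by (rule filterlim_compose[OF _ filterlim_real_sequentially])
  qed
qed

lemma measurable_exceedance_limsup:
  assumes H: "continuous_on UNIV H"
  shows "exceedance_limsup H \<in> borel_measurable path_space"
  unfolding exceedance_limsup_def
proof (rule borel_measurable_cSUP)
  show "countable (\<rat> \<inter> {0..1::real})"
    by (rule countable_subset[OF _ countable_rat]) auto
  show "bdd_above ((\<lambda>q. q * indicator {\<omega> \<in> paths. \<not> (\<forall>\<^sub>F t in at_top. H (\<omega> t) \<le> q)} \<omega>) ` (\<rat> \<inter> {0..1}))" for \<omega>
    by (rule bdd_above_weighted_indicators)
  show "(\<lambda>\<omega>. q * indicator {\<omega> \<in> paths. \<not> (\<forall>\<^sub>F t in at_top. H (\<omega> t) \<le> q)} \<omega>) \<in> borel_measurable path_space" for q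
    using invariant_field_path_space[OF exceedance_invariant[OF H, of q]] by simp
qed

lemma harmonic_eq_integral_limsup:
  assumes H: "harmonic P H" "\<And>z. 0 \<le> H z" "\<And>z. H z \<le> 1" "continuous_on UNIV H"
  shows "H z = (\<integral>\<omega>. exceedance_limsup H \<omega> \<partial>P z)"
proof -
  interpret prob_space "P z" by (rule prob_space_P)
  have Hm: "H \<in> borel_measurable borel"
    using H(1) by (simp add: harmonic_def)
  have "(\<lambda>n. \<integral>\<omega>. H (\<omega> (real n)) \<partial>P z) \<longlonglongrightarrow> (\<integral>\<omega>. exceedance_limsup H \<omega> \<partial>P z)"
  proof (rule integral_dominated_convergence[where w = "\<lambda>_. 1"])
    show "exceedance_limsup H \<in> borel_measurable (P z)"
      using measurable_exceedance_limsup[OF H(4)] by simp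
    show "(\<lambda>\<omega>. H (\<omega> (real n))) \<in> borel_measurable (P z)" for n
      using measurable_compose[OF measurable_eval Hm, of "real n"] by simp
    show "AE \<omega> in P z. (\<lambda>n. H (\<omega> (real n))) \<longlonglongrightarrow> exceedance_limsup H \<omega>"
      by (rule harmonic_limit[OF H])
  qed (use H(2,3) in auto)
  moreover have "(\<integral>\<omega>. H (\<omega> (real n)) \<partial>P z) = H z" for n
    by (rule harmonic_eq[OF H(1), symmetric]) simp
  ultimately show ?thesis
    by (simp add: LIMSEQ_const_iff)
qed

end

section \<open>Invariant events and the limit of the group component\<close>

lemma ex_countable_dense:
  obtains D :: "'a::second_countable_topology set"
  where "countable D" "\<And>U. open U \<Longrightarrow> U \<noteq> {} \<Longrightarrow> \<exists>d\<in>D. d \<in> U"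
  using countable_dense_exists by metis

lemma continuous_eq_0_of_dense:
  fixes f :: "'a::topological_space \<Rightarrow> real"
  assumes f: "continuous_on UNIV f" and D: "\<And>U. open U \<Longrightarrow> U \<noteq> {} \<Longrightarrow> \<exists>d\<in>D. d \<in> U"
    and "\<And>d. d \<in> D \<Longrightarrow> f d = 0"
  shows "f x = 0"
proof (rule ccontr)
  assume "f x \<noteq> 0"
  moreover have "open (f -` (- {0}))"
    using f by (intro open_vimage) auto
  ultimately obtain d where "d \<in> D" "f d \<noteq> 0"
    using D[of "f -` (- {0})"] by auto
  then show False
    using assms(3) by simp
qed

locale equivariant_diffusion =
  fixes n m :: nat
    and atlasX :: "'x::{t2_space, second_countable_topology} chart set"
    and atlasG :: "'g::{t2_space, second_countable_topology} chart set"
    and gmult :: "'g \<Rightarrow> 'g \<Rightarrow> 'g" and gone :: 'g and ginv :: "'g \<Rightarrow> 'g"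
    and \<L> :: "('x \<times> 'g \<Rightarrow> real) \<Rightarrow> 'x \<times> 'g \<Rightarrow> real"
    and P :: "'x \<times> 'g \<Rightarrow> (real \<Rightarrow> 'x \<times> 'g) measure"
  assumes manifold_X: "smooth_manifold n atlasX"
    and lie_group_G: "lie_group m atlasG gmult gone ginv"
    and diffusion_P: "diffusion (n + m) (prod_atlas n atlasX atlasG) \<L> P"
    and convergence: "convergence_condition P"
    and equivariance: "equivariance_condition (n + m) (prod_atlas n atlasX atlasG) gmult \<L>"
    and regularity: "regularity_condition P"
    and trivial_x: "\<And>x g. trivial_field (P (x, g)) (invariant_field fst)"
begin

sublocale strong_markov_family P
  using diffusion_P by unfold_locales (simp add: diffusion_def)

sublocale G: group gmult gone ginv
  using lie_group_G by (simp add: lie_group_def)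

abbreviation act :: "'g \<Rightarrow> (real \<Rightarrow> 'x \<times> 'g) \<Rightarrow> real \<Rightarrow> 'x \<times> 'g" where
  "act g \<equiv> map_path (left_mult gmult g)"

lemma act_act: "act g (act h \<omega>) = act (gmult g h) \<omega>"
  unfolding map_path_map_path left_mult_left_mult(1)[OF G.group_axioms] ..

lemma act_in_paths: "\<omega> \<in> paths \<Longrightarrow> act g \<omega> \<in> paths"
  by (rule map_path_in_paths[OF continuous_left_mult[OF lie_group_G]])

lemma measurable_act: "act g \<in> path_space \<rightarrow>\<^sub>M path_space"
  by (rule measurable_map_path[OF continuous_left_mult[OF lie_group_G]])

lemma measure_translate:
  assumes "A \<in> sets path_space"
  shows "measure (P (x, gmult g h)) A = measure (P (x, h)) {\<omega> \<in> paths. act g \<omega> \<in> A}"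
proof -
  have "act g -` A \<inter> space (P (x, h)) = {\<omega> \<in> paths. act g \<omega> \<in> A}"
    by auto
  then show ?thesis
    unfolding diffusion_translate[OF manifold_X lie_group_G diffusion_P equivariance, of x g h]
    using measurable_act[of g] assms by (subst measure_distr) simp_all
qed

lemma AE_translate:
  assumes "{\<omega> \<in> paths. Q \<omega>} \<in> sets path_space"
  shows "(AE \<omega> in P (x, gmult g h). Q \<omega>) \<longleftrightarrow> (AE \<omega> in P (x, h). Q (act g \<omega>))"
  unfolding diffusion_translate[OF manifold_X lie_group_G diffusion_P equivariance, of x g h]
  using measurable_act[of g] assms by (intro AE_distr_iff) simp_all

lemma AE_convergent: "AE \<omega> in P z. \<omega> \<in> convergent_paths"
proof -
  obtain x g where z: "z = (x, g)"
    by (cases z)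
  have "AE \<omega> in P z. \<exists>l. ((\<lambda>t. snd (\<omega> t)) \<longlongrightarrow> l) at_top"
    using convergence unfolding convergence_condition_def z by blast
  with AE_space show ?thesis
    by eventually_elim (simp add: convergent_paths_def)
qed

lemma measurable_g_lim_algebra:
  "(g_lim :: (real \<Rightarrow> 'x \<times> 'g) \<Rightarrow> 'g) \<in> invariant_algebra id \<rightarrow>\<^sub>M borel"
proof -
  have "smooth_manifold m atlasG"
    using lie_group_G by (simp add: lie_group_def)
  from ex_compact_closure_basis[OF this] show ?thesis
    using measurable_g_lim_invariant by blast
qed

lemma g_lim_event_invariant:
  assumes "B \<in> sets borel"
  shows "{\<omega> \<in> paths. g_lim \<omega> \<in> B} \<in> invariant_field (id :: 'x \<times> 'g \<Rightarrow> 'x \<times> 'g)"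
proof -
  have "g_lim -` B \<inter> space (invariant_algebra (id :: 'x \<times> 'g \<Rightarrow> _)) = {\<omega> \<in> paths. g_lim \<omega> \<in> B}"
    by auto
  then show ?thesis
    using measurable_sets[OF measurable_g_lim_algebra assms] by simp
qed

lemma measurable_g_lim_cylinder:
  "(g_lim :: (real \<Rightarrow> 'x \<times> 'g) \<Rightarrow> 'g) \<in> path_filtration \<infinity> \<rightarrow>\<^sub>M borel"
proof (rule measurableI)
  fix B :: "'g set" assume "B \<in> sets borel"
  from invariant_field_cylinder[OF g_lim_event_invariant[OF this]]
  show "g_lim -` B \<inter> space (path_filtration \<infinity> :: (real \<Rightarrow> 'x \<times> 'g) measure) \<in> sets (path_filtration \<infinity>)"
    by (simp add: vimage_def Int_def conj_commute)
qed simp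

lemma measurable_id_cylinder:
  "(\<lambda>\<omega>. \<omega>) \<in> path_space \<rightarrow>\<^sub>M (path_filtration \<infinity> :: (real \<Rightarrow> 'x \<times> 'g) measure)"
  by (rule measurable_path_filtrationI) (auto intro: measurable_eval)

lemma measurable_g_lim [measurable]: "(g_lim :: (real \<Rightarrow> 'x \<times> 'g) \<Rightarrow> 'g) \<in> path_space \<rightarrow>\<^sub>M borel"
  using measurable_compose[OF measurable_id_cylinder measurable_g_lim_cylinder] by simp

lemma measurable_gmult [measurable (raw)]:
  assumes "f \<in> N \<rightarrow>\<^sub>M borel" "h \<in> N \<rightarrow>\<^sub>M borel"
  shows "(\<lambda>x. gmult (f x) (h x)) \<in> N \<rightarrow>\<^sub>M borel"
  using measurable_compose[OF borel_measurable_Pair[OF assms]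
      borel_measurable_continuous_onI[OF lie_group_continuous(1)[OF lie_group_G]]]
  by simp

lemma measurable_ginv [measurable (raw)]:
  assumes "f \<in> N \<rightarrow>\<^sub>M borel"
  shows "(\<lambda>x. ginv (f x)) \<in> N \<rightarrow>\<^sub>M borel"
  using measurable_compose[OF assms
      borel_measurable_continuous_onI[OF lie_group_continuous(2)[OF lie_group_G]]] .

lemma continuous_on_gmult:
  assumes "continuous_on S f" "continuous_on S h"
  shows "continuous_on S (\<lambda>x. gmult (f x) (h x))"
  using continuous_on_compose2[OF lie_group_continuous(1)[OF lie_group_G] continuous_on_Pair[OF assms]]
  by simp

lemma continuous_on_ginv: "continuous_on S f \<Longrightarrow> continuous_on S (\<lambda>x. ginv (f x))"
  using continuous_on_compose2[OF lie_group_continuous(2)[OF lie_group_G]] by blast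

lemma measurable_act_joint:
  assumes k: "k \<in> N \<rightarrow>\<^sub>M borel" and W: "W \<in> N \<rightarrow>\<^sub>M path_filtration \<infinity>"
  shows "(\<lambda>x. act (k x) (W x)) \<in> N \<rightarrow>\<^sub>M path_filtration \<infinity>"
proof (rule measurable_path_filtrationI)
  show "act (k x) (W x) \<in> paths" if "x \<in> space N" for x
    using measurable_space[OF W that] by (simp add: act_in_paths)
  fix s :: real assume s: "0 \<le> s"
  have ev: "(\<lambda>x. W x s) \<in> N \<rightarrow>\<^sub>M borel"
    by (rule measurable_compose[OF W measurable_eval_filtration[OF s]]) simp
  have "(\<lambda>x. (fst (W x s), gmult (k x) (snd (W x s)))) \<in> N \<rightarrow>\<^sub>M borel"
    using measurable_compose[OF ev borel_measurable_continuous_onI[OF continuous_on_fst[OF continuous_on_id]]]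
      measurable_compose[OF ev borel_measurable_continuous_onI[OF continuous_on_snd[OF continuous_on_id]]]
    by (intro borel_measurable_Pair measurable_gmult k)
  then show "(\<lambda>x. act (k x) (W x) s) \<in> N \<rightarrow>\<^sub>M borel"
    using s by (simp add: left_mult_def case_prod_beta)
qed

lemma g_lim_shift:
  fixes \<omega> :: "real \<Rightarrow> 'x \<times> 'g"
  assumes "\<omega> \<in> paths" "s \<ge> 0"
  shows "g_lim (shift s \<omega>) = g_lim \<omega>"
proof -
  have "{\<omega>' \<in> paths. g_lim \<omega>' \<in> {g_lim \<omega>}} \<in> invariant_field (id :: 'x \<times> 'g \<Rightarrow> _)"
    by (rule g_lim_event_invariant) simp
  from shift_mem_invariant_iff[OF this assms] show ?thesis
    using assms by simp
qed

lemma convergent_act: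
  assumes \<omega>: "\<omega> \<in> convergent_paths"
  shows "act g \<omega> \<in> convergent_paths" "g_lim (act g \<omega>) = gmult g (g_lim \<omega>)"
proof -
  have "isCont (gmult g) (g_lim \<omega>)"
    using continuous_on_gmult[OF continuous_on_const continuous_on_id, of UNIV g]
    by (simp add: continuous_on_eq_continuous_at)
  then have "((\<lambda>t. gmult g (snd (\<omega> t))) \<longlongrightarrow> gmult g (g_lim \<omega>)) at_top"
    by (rule isCont_tendsto_compose[OF _ tendsto_g_lim[OF \<omega>]])
  moreover have "\<forall>\<^sub>F t in at_top. gmult g (snd (\<omega> t)) = snd (act g \<omega> t)"
    using eventually_ge_at_top[of 0] by eventually_elim (simp add: left_mult_def case_prod_beta)
  ultimately have lim: "((\<lambda>t. snd (act g \<omega> t)) \<longlongrightarrow> gmult g (g_lim \<omega>)) at_top"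
    by (rule Lim_transform_eventually)
  then show "g_lim (act g \<omega>) = gmult g (g_lim \<omega>)"
    by (rule g_lim_eq)
  have "\<omega> \<in> paths"
    using \<omega> by (simp add: convergent_paths_def)
  with lim show "act g \<omega> \<in> convergent_paths"
    by (auto simp: convergent_paths_def act_in_paths)
qed

text \<open>
  The path translated to have limit \<open>h\<close> belongs to \<open>A\<close>. For \<open>h = g\<^sub>\<infinity>(\<omega>)\<close> this is \<open>\<omega> \<in> A\<close>.
\<close>

definition recentred :: "(real \<Rightarrow> 'x \<times> 'g) set \<Rightarrow> 'g \<Rightarrow> (real \<Rightarrow> 'x \<times> 'g) set" where
  "recentred A h = {\<omega> \<in> paths. act (gmult h (ginv (g_lim \<omega>))) \<omega> \<in> A}"

lemma recentred_invariant:
  assumes A: "A \<in> invariant_field id"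
  shows "recentred A h \<in> invariant_field id"
  unfolding invariant_field_iff
proof (intro conjI allI impI)
  have "(\<lambda>\<omega>. act (gmult h (ginv (g_lim \<omega>))) \<omega>) \<in> path_filtration \<infinity> \<rightarrow>\<^sub>M path_filtration \<infinity>"
    by (intro measurable_act_joint measurable_gmult measurable_ginv measurable_const
        measurable_g_lim_cylinder measurable_ident) simp_all
  from measurable_sets[OF this invariant_field_cylinder[OF A]]
  show "recentred A h \<in> sets (observed id 0)"
    unfolding sets_observed_id recentred_def by (simp add: vimage_def Int_def conj_commute)
  fix s :: real assume "s > 0"
  then have "shift s \<omega> \<in> recentred A h \<longleftrightarrow> \<omega> \<in> recentred A h" if "\<omega> \<in> paths" for \<omega>
    using shift_mem_invariant_iff[OF A act_in_paths[OF that], of s] that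
    by (simp add: recentred_def shift_in_paths g_lim_shift flip: shift_map_path)
  then show "{\<omega> \<in> paths. shift s \<omega> \<in> recentred A h} = recentred A h"
    by (auto simp: recentred_def)
qed

lemma recentred_act_iff:
  assumes \<omega>: "\<omega> \<in> convergent_paths"
  shows "act g \<omega> \<in> recentred A h \<longleftrightarrow> \<omega> \<in> recentred A h"
proof -
  have "gmult (gmult h (ginv (gmult g (g_lim \<omega>)))) g = gmult h (ginv (g_lim \<omega>))"
    by (simp add: G.inverse_distrib_swap G.assoc)
  moreover have "\<omega> \<in> paths"
    using \<omega> by (simp add: convergent_paths_def)
  ultimately show ?thesis
    by (simp add: recentred_def act_in_paths convergent_act[OF \<omega>] act_act)
qed

lemma continuous_measure_invariant:
  assumes "A \<in> invariant_field id"
  shows "continuous_on UNIV (\<lambda>z. measure (P z) A)"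
  using regularity harmonic_measure_invariant[OF assms] by (simp add: regularity_condition_def)

text \<open>
  Translating \<open>\<omega>\<close> and then moving its limit to \<open>h\<close> is the same as moving its limit to \<open>h\<close>
  directly, provided that the limit exists.
\<close>

lemma measure_recentred:
  assumes A: "A \<in> invariant_field id"
  shows "measure (P (x, g)) (recentred A h) = measure (P (x, gone)) (recentred A h)"
proof -
  interpret prob_space "P (x, gone)" by (rule prob_space_P)
  note m = invariant_field_path_space[OF recentred_invariant[OF A]]
  have "measure (P (x, gmult g gone)) (recentred A h) =
      measure (P (x, gone)) {\<omega> \<in> paths. act g \<omega> \<in> recentred A h}"
    by (rule measure_translate[OF m])
  also have "\<dots> = measure (P (x, gone)) (recentred A h)"
  proof (rule finite_measure_eq_AE)
    show "AE \<omega> in P (x, gone). \<omega> \<in> {\<omega> \<in> paths. act g \<omega> \<in> recentred A h} \<longleftrightarrow> \<omega> \<in> recentred A h"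
      using AE_convergent
      by eventually_elim (auto simp: recentred_act_iff convergent_paths_def)
    show "{\<omega> \<in> paths. act g \<omega> \<in> recentred A h} \<in> sets (P (x, gone))"
      using measurable_sets[OF measurable_act[of g] m] by (simp add: vimage_def Int_def conj_commute)
  qed (use m in simp)
  finally show ?thesis by simp
qed

lemma continuous_measure_recentred:
  assumes A: "A \<in> invariant_field id"
  shows "continuous_on UNIV (\<lambda>x. measure (P (x, gone)) (recentred A h))"
  using continuous_on_compose2[OF continuous_measure_invariant[OF recentred_invariant[OF A]],
      of UNIV "\<lambda>x. (x, gone)"]
  by (simp add: continuous_on_Pair)

lemma measure_recentred_trivial:
  assumes A: "A \<in> invariant_field id"
  shows "measure (P (x, g)) (recentred A h) = 0 \<or> measure (P (x, g)) (recentred A h) = 1"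
proof (rule factor_invariant_event_trivial[OF recentred_invariant[OF A], where \<pi> = fst
      and F = "\<lambda>x. measure (P (x, gone)) (recentred A h)"])
  show "measure (P z) (recentred A h) = measure (P (fst z, gone)) (recentred A h)" for z
    using measure_recentred[OF A, of "fst z" "snd z"] by simp
qed (use continuous_measure_recentred[OF A] trivial_x in \<open>auto intro: continuous_on_fst continuous_on_id\<close>)

definition limit_set :: "(real \<Rightarrow> 'x \<times> 'g) set \<Rightarrow> 'x \<Rightarrow> 'g set" where
  "limit_set A x = {h. measure (P (x, gone)) (recentred A h) = 1}"

lemma recentred_iff_limit_set:
  assumes A: "A \<in> invariant_field id"
  shows "AE \<omega> in P (x, g). \<omega> \<in> recentred A h \<longleftrightarrow> h \<in> limit_set A x"
proof -
  interpret prob_space "P (x, g)" by (rule prob_space_P)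
  have m: "recentred A h \<in> events"
    using invariant_field_path_space[OF recentred_invariant[OF A]] by simp
  show ?thesis
  proof (cases "h \<in> limit_set A x")
    case True
    then have "prob (recentred A h) = 1"
      using measure_recentred[OF A, of x g h] by (simp add: limit_set_def)
    then have "AE \<omega> in P (x, g). \<omega> \<in> recentred A h"
      using AE_in_set_eq_1[OF m] by simp
    with True show ?thesis by simp
  next
    case False
    then have "prob (recentred A h) = 0"
      using measure_recentred[OF A, of x g h] measure_recentred_trivial[OF A, of x g h]
      by (auto simp: limit_set_def)
    then have "AE \<omega> in P (x, g). \<omega> \<notin> recentred A h"
      using m by (intro AE_not_in) (simp add: null_sets_def emeasure_eq_measure)
    with False show ?thesis by simp
  qed
qed

lemma measurable_recentred_pair:
  assumes A: "A \<in> invariant_field id" and h: "h \<in> N \<rightarrow>\<^sub>M borel" and W: "W \<in> N \<rightarrow>\<^sub>M path_space"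
  shows "Measurable.pred N (\<lambda>x. W x \<in> recentred A (h x))"
proof -
  have W': "W \<in> N \<rightarrow>\<^sub>M path_filtration \<infinity>"
    using measurable_compose[OF W measurable_id_cylinder] by simp
  have "(\<lambda>x. act (gmult (h x) (ginv (g_lim (W x)))) (W x)) \<in> N \<rightarrow>\<^sub>M path_filtration \<infinity>"
    by (intro measurable_act_joint measurable_gmult measurable_ginv h W' measurable_compose[OF W measurable_g_lim])
  from measurable_sets[OF this invariant_field_cylinder[OF A]]
  have "{x \<in> space N. act (gmult (h x) (ginv (g_lim (W x)))) (W x) \<in> A} \<in> sets N"
    by (simp add: vimage_def Int_def conj_commute)
  moreover have "{x \<in> space N. act (gmult (h x) (ginv (g_lim (W x)))) (W x) \<in> A} =
      {x \<in> space N. W x \<in> recentred A (h x)}"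
    using measurable_space[OF W] by (auto simp: recentred_def)
  ultimately show ?thesis
    by (simp add: pred_def)
qed

lemma limit_set_borel:
  assumes A: "A \<in> invariant_field id"
  shows "limit_set A x \<in> sets borel"
proof -
  interpret prob_space "P (x, gone)" by (rule prob_space_P)
  let ?N = "borel \<Otimes>\<^sub>M P (x, gone) :: ('g \<times> (real \<Rightarrow> 'x \<times> 'g)) measure"
  have "Measurable.pred ?N (\<lambda>p. snd p \<in> recentred A (fst p))"
  proof (rule measurable_recentred_pair[OF A])
    show "snd \<in> ?N \<rightarrow>\<^sub>M path_space"
      using measurable_snd[of borel "P (x, gone)"] by (simp cong: measurable_cong_sets)
  qed simp
  then have "{p \<in> space ?N. snd p \<in> recentred A (fst p)} \<in> sets ?N"
    by (simp add: pred_def)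
  from measurable_emeasure_Pair[OF this]
  have "(\<lambda>h. emeasure (P (x, gone)) (Pair h -` {p \<in> space ?N. snd p \<in> recentred A (fst p)})) \<in> borel_measurable borel" .
  moreover have "Pair h -` {p \<in> space ?N. snd p \<in> recentred A (fst p)} = recentred A h" for h
    by (auto simp: space_pair_measure recentred_def)
  ultimately have m: "(\<lambda>h. emeasure (P (x, gone)) (recentred A h)) \<in> borel_measurable borel"
    by simp
  have "limit_set A x = {h \<in> space borel. emeasure (P (x, gone)) (recentred A h) = 1}"
    by (auto simp: limit_set_def emeasure_eq_measure)
  also have "\<dots> \<in> sets borel"
    using m by measurable
  finally show ?thesis .
qed

lemma AE_swap:
  assumes Q: "Measurable.pred (path_space \<Otimes>\<^sub>M path_space) (\<lambda>p. Q (fst p) (snd p))"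
    and AE: "AE \<omega> in P z. AE \<omega>' in P z'. Q \<omega> \<omega>'"
  shows "AE \<omega>' in P z'. AE \<omega> in P z. Q \<omega> \<omega>'"
proof -
  interpret Z: prob_space "P z" by (rule prob_space_P)
  interpret Z': prob_space "P z'" by (rule prob_space_P)
  interpret pair_sigma_finite "P z" "P z'" ..
  have "sets (P z \<Otimes>\<^sub>M P z') = sets (path_space \<Otimes>\<^sub>M path_space)"
    by (intro sets_pair_measure_cong) simp_all
  moreover from this have "space (P z \<Otimes>\<^sub>M P z') = space (path_space \<Otimes>\<^sub>M path_space)"
    by (rule sets_eq_imp_space_eq)
  ultimately have "{p \<in> space (P z \<Otimes>\<^sub>M P z'). Q (fst p) (snd p)} \<in> sets (P z \<Otimes>\<^sub>M P z')"
    using Q by (simp add: pred_def)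
  from AE_commute[OF this] AE show ?thesis by simp
qed

text \<open>
  A Borel set that is null for the law of \<open>g\<^sub>\<infinity>\<close> from a dense set of starting points is null from
  all of them, since the probability of \<open>{g\<^sub>\<infinity> \<in> C}\<close> is continuous in the starting point.
\<close>

lemma AE_g_lim_not_in_of_dense:
  assumes D: "\<And>U :: 'g set. open U \<Longrightarrow> U \<noteq> {} \<Longrightarrow> \<exists>d\<in>D. d \<in> U"
    and C: "C \<in> sets borel" and AE: "\<And>d. d \<in> D \<Longrightarrow> AE \<omega> in P (x, d). g_lim \<omega> \<notin> C"
  shows "AE \<omega> in P (x, h). g_lim \<omega> \<notin> C"
proof -
  define E :: "(real \<Rightarrow> 'x \<times> 'g) set" where "E = {\<omega> \<in> paths. g_lim \<omega> \<in> C}"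
  have E: "E \<in> invariant_field (id :: 'x \<times> 'g \<Rightarrow> _)"
    unfolding E_def by (rule g_lim_event_invariant[OF C])
  have iff: "measure (P z) E = 0 \<longleftrightarrow> (AE \<omega> in P z. g_lim \<omega> \<notin> C)" for z
  proof -
    have "measure (P z) E = 0 \<longleftrightarrow> (AE \<omega> in P z. \<omega> \<notin> E)"
      by (rule measure_eq_0_iff_AE[OF invariant_field_path_space[OF E]])
    also have "\<dots> \<longleftrightarrow> (AE \<omega> in P z. g_lim \<omega> \<notin> C)"
      by (rule AE_cong) (simp add: E_def)
    finally show ?thesis .
  qed
  have "continuous_on UNIV (\<lambda>h. measure (P (x, h)) E)"
    using continuous_on_compose2[OF continuous_measure_invariant[OF E], of UNIV "\<lambda>h. (x, h)"]
    by (simp add: continuous_on_Pair)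
  then have "measure (P (x, h)) E = 0"
    by (rule continuous_eq_0_of_dense[OF _ D]) (use AE iff in auto)
  then show ?thesis
    by (simp add: iff)
qed

text \<open>
  In the proof, \<open>\<omega>'\<close> is an auxiliary path, independent of \<open>\<omega>\<close>, whose inverse limit \<open>(g\<^sub>\<infinity>(\<omega>'))\<inverse>\<close>
  plays the role of the integration variable on \<open>G\<close>.
\<close>

lemma invariant_event_eq_limit_event:
  assumes A: "A \<in> invariant_field id"
  shows "AE \<omega> in P (x, g). \<omega> \<in> A \<longleftrightarrow> g_lim \<omega> \<in> limit_set A x"
proof -
  define B where "B = limit_set A x"
  have B: "B \<in> sets borel"
    unfolding B_def by (rule limit_set_borel[OF A])
  obtain D :: "'g set" where D: "countable D" "\<And>U. open U \<Longrightarrow> U \<noteq> {} \<Longrightarrow> \<exists>d\<in>D. d \<in> U"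
    using ex_countable_dense by blast
  define S where "S = sym_diff A {\<omega> \<in> paths. g_lim \<omega> \<in> B}"
  have "S \<in> sets (invariant_algebra id)"
    unfolding S_def using A g_lim_event_invariant[OF B]
    by (intro sets.Un sets.Diff) simp_all
  then have S: "S \<in> invariant_field id" by simp
  have S_iff: "\<omega> \<notin> S \<longleftrightarrow> (\<omega> \<in> A \<longleftrightarrow> g_lim \<omega> \<in> B)" if "\<omega> \<in> paths" for \<omega>
    using that by (auto simp: S_def)
  note S' = invariant_field_path_space[OF S]
  note v_iff = measure_eq_0_iff_AE[OF S']
  define R where "R h \<omega> \<longleftrightarrow> (\<omega> \<in> recentred A h \<longleftrightarrow> h \<in> B)" for h \<omega>
  have R_pred: "Measurable.pred N (\<lambda>p. R (h p) (W p))"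
    if "h \<in> N \<rightarrow>\<^sub>M borel" "W \<in> N \<rightarrow>\<^sub>M path_space" for N :: "'c measure" and h W
  proof -
    have "Measurable.pred N (\<lambda>p. h p \<in> B)"
      using that(1) B by measurable
    then show ?thesis
      unfolding R_def using measurable_recentred_pair[OF A that] by (intro pred_intros_logic)
  qed
  \<comment> \<open>Fubini: a random \<open>h\<close> independent of \<open>\<omega>\<close>\<close>
  have step1: "AE \<omega> in P (x, g). AE \<omega>' in P (x, d). R (ginv (g_lim \<omega>')) \<omega>" for d
  proof (rule AE_swap)
    show "Measurable.pred ((path_space :: (real \<Rightarrow> 'x \<times> 'g) measure) \<Otimes>\<^sub>M path_space)
        (\<lambda>p. R (ginv (g_lim (fst p))) (snd p))"
      by (intro R_pred measurable_ginv measurable_compose[OF measurable_fst measurable_g_lim] measurable_snd)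
    show "AE \<omega>' in P (x, d). AE \<omega> in P (x, g). R (ginv (g_lim \<omega>')) \<omega>"
      using recentred_iff_limit_set[OF A] by (simp add: R_def B_def)
  qed
  \<comment> \<open>Exchanging the quantifiers over starting points and over paths \<open>\<omega>\<close> is possible for a countable
    set of starting points; continuity then gives all of them for a fixed \<open>\<omega>\<close>.\<close>
  have "AE \<omega> in P (x, g). \<forall>d\<in>D. AE \<omega>' in P (x, d). R (ginv (g_lim \<omega>')) \<omega>"
    unfolding AE_ball_countable[OF D(1)] using step1 by blast
  then have step2: "AE \<omega> in P (x, g). \<forall>h. AE \<omega>' in P (x, h). R (ginv (g_lim \<omega>')) \<omega>"
    using AE_space
  proof eventually_elim
    case (elim \<omega>)
    have "Measurable.pred borel (\<lambda>l. R (ginv l) \<omega>)"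
      using elim(2) by (intro R_pred measurable_ginv measurable_const) simp_all
    then have C: "{l. \<not> R (ginv l) \<omega>} \<in> sets borel"
      unfolding pred_def by (simp add: Collect_neg_eq borel_comp)
    show ?case
      using AE_g_lim_not_in_of_dense[OF D(2) C] elim(1) by simp
  qed
  define good where "good k \<omega> \<longleftrightarrow> (act k \<omega> \<in> A \<longleftrightarrow> gmult k (g_lim \<omega>) \<in> B)" for k \<omega>
  \<comment> \<open>The change of variable \<open>h = k g\<^sub>\<infinity>(\<omega>)\<close>: starting \<open>\<omega>'\<close> at \<open>(g\<^sub>\<infinity>(\<omega>))\<inverse> h\<close> instead of \<open>h\<close> multiplies
    its inverse limit by \<open>g\<^sub>\<infinity>(\<omega>)\<close> on the right.\<close>
  have step3: "AE \<omega> in P (x, g). AE \<omega>' in P (x, h). good (ginv (g_lim \<omega>')) \<omega>" for h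
    using step2 AE_space AE_convergent
  proof eventually_elim
    case (elim \<omega>)
    define l where "l = g_lim \<omega>"
    have "Measurable.pred (path_space :: (real \<Rightarrow> 'x \<times> 'g) measure) (\<lambda>\<omega>'. R (ginv (g_lim \<omega>')) \<omega>)"
      using elim(2) by (intro R_pred measurable_ginv measurable_const measurable_g_lim) simp_all
    then have "{\<omega>' \<in> (paths :: (real \<Rightarrow> 'x \<times> 'g) set). R (ginv (g_lim \<omega>')) \<omega>} \<in> sets path_space"
      by (simp add: pred_def)
    from AE_translate[OF this, of x "ginv l" h] elim(1)
    have "AE \<omega>' in P (x, h). R (ginv (g_lim (act (ginv l) \<omega>'))) \<omega>"
      by blast
    then show ?case
      using AE_convergent
    proof eventually_elim
      case (elim \<omega>')
      have "ginv (g_lim (act (ginv l) \<omega>')) = gmult (ginv (g_lim \<omega>')) l"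
        by (simp add: convergent_act[OF elim(2)] G.inverse_distrib_swap)
      moreover have "gmult (gmult (ginv (g_lim \<omega>')) l) (ginv l) = ginv (g_lim \<omega>')"
        by (simp add: G.assoc)
      ultimately show ?case
        using elim(1) \<open>\<omega> \<in> space (P (x, g))\<close> by (simp add: R_def good_def recentred_def flip: l_def)
    qed
  qed
  \<comment> \<open>Fubini again: for almost every \<open>k\<close>, the path \<open>k \<cdot> \<omega>\<close> started at \<open>(x, g)\<close>, which is a path started
    at \<open>(x, k g)\<close>, avoids the symmetric difference \<open>S\<close>.\<close>
  have step4: "AE \<omega>' in P (x, h). measure (P (x, gmult (ginv (g_lim \<omega>')) g)) S = 0" for h
  proof -
    have "Measurable.pred (path_space \<Otimes>\<^sub>M (path_space :: (real \<Rightarrow> 'x \<times> 'g) measure)) (\<lambda>p. good (ginv (g_lim (snd p))) (fst p))"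
      (is "Measurable.pred ?PP _")
    proof -
      have fm: "fst \<in> path_space \<Otimes>\<^sub>M path_space \<rightarrow>\<^sub>M (path_space :: (real \<Rightarrow> 'x \<times> 'g) measure)"
        and sm: "snd \<in> path_space \<Otimes>\<^sub>M path_space \<rightarrow>\<^sub>M (path_space :: (real \<Rightarrow> 'x \<times> 'g) measure)"
        by (rule measurable_fst, rule measurable_snd)
      note gl = measurable_compose[OF sm measurable_g_lim]
      have "(\<lambda>p. act (ginv (g_lim (snd p))) (fst p)) \<in> ?PP \<rightarrow>\<^sub>M path_filtration \<infinity>"
        using measurable_compose[OF fm measurable_id_cylinder] by (intro measurable_act_joint measurable_ginv gl) simp
      from pred_sets2[OF invariant_field_cylinder[OF A] this]
      have "Measurable.pred ?PP (\<lambda>p. act (ginv (g_lim (snd p))) (fst p) \<in> A)" .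
      moreover have "Measurable.pred ?PP
          (\<lambda>p. gmult (ginv (g_lim (snd p))) (g_lim (fst p)) \<in> B)"
        by (rule pred_sets2[OF B])
          (intro measurable_gmult measurable_ginv gl measurable_compose[OF fm measurable_g_lim])
      ultimately show ?thesis
        unfolding good_def by (intro pred_intros_logic)
    qed
    from AE_swap[OF this step3]
    have "AE \<omega>' in P (x, h). AE \<omega> in P (x, g). good (ginv (g_lim \<omega>')) \<omega>" .
    then show ?thesis
    proof eventually_elim
      case (elim \<omega>')
      define k where "k = ginv (g_lim \<omega>')"
      have "AE \<omega> in P (x, g). act k \<omega> \<notin> S"
        using elim AE_space AE_convergent
      proof eventually_elim
        case (elim \<omega>)
        then show ?case
          by (simp add: S_iff act_in_paths convergent_act good_def flip: k_def)
      qed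
      moreover have "{\<omega> \<in> paths. \<omega> \<notin> S} \<in> sets path_space"
        using sets.compl_sets[OF S'] by (simp add: set_diff_eq)
      ultimately have "AE \<omega> in P (x, gmult k g). \<omega> \<notin> S"
        by (simp add: AE_translate)
      then show ?case
        unfolding v_iff k_def .
    qed
  qed
  \<comment> \<open>A single \<open>\<omega>'\<close> serves for all \<open>d\<close> in \<open>D\<close>, so that the points \<open>(d g\<^sub>\<infinity>(\<omega>'))\<inverse> g\<close> are dense; the value at
    \<open>(x, g)\<close> corresponds to the parameter \<open>(g\<^sub>\<infinity>(\<omega>'))\<inverse>\<close>.\<close>
  have "AE \<omega>' in P (x, gone). \<forall>d\<in>D. measure (P (x, gmult (ginv (gmult d (g_lim \<omega>'))) g)) S = 0"
    unfolding AE_ball_countable[OF D(1)]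
  proof
    fix d
    have "(\<lambda>\<omega>' :: real \<Rightarrow> 'x \<times> 'g. measure (P (x, gmult (ginv (g_lim \<omega>')) g)) S) \<in> borel_measurable path_space"
      by (rule measurable_compose[OF _ measurable_measure_P[OF S']])
        (intro borel_measurable_Pair measurable_gmult measurable_ginv measurable_const measurable_g_lim, simp_all)
    then have "{\<omega>' \<in> space (path_space :: (real \<Rightarrow> 'x \<times> 'g) measure). measure (P (x, gmult (ginv (g_lim \<omega>')) g)) S = 0} \<in> sets path_space"
      by measurable
    from AE_translate[of "\<lambda>\<omega>'. measure (P (x, gmult (ginv (g_lim \<omega>')) g)) S = 0" x d gone] this step4[of "gmult d gone"]
    have "AE \<omega>' in P (x, gone). measure (P (x, gmult (ginv (g_lim (act d \<omega>'))) g)) S = 0"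
      by simp
    then show "AE \<omega>' in P (x, gone). measure (P (x, gmult (ginv (gmult d (g_lim \<omega>'))) g)) S = 0"
      using AE_convergent by eventually_elim (simp add: convergent_act)
  qed
  then have "\<exists>\<omega>' :: real \<Rightarrow> 'x \<times> 'g. \<forall>d\<in>D. measure (P (x, gmult (ginv (gmult d (g_lim \<omega>'))) g)) S = 0"
    by (rule eventually_happens'[OF prob_space.ae_filter_bot[OF prob_space_P]])
  then obtain \<omega>' :: "real \<Rightarrow> 'x \<times> 'g"
    where \<omega>': "\<And>d. d \<in> D \<Longrightarrow> measure (P (x, gmult (ginv (gmult d (g_lim \<omega>'))) g)) S = 0"
    by blast
  have "continuous_on UNIV (\<lambda>y. measure (P (x, gmult (ginv (gmult y (g_lim \<omega>'))) g)) S)"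
    by (rule continuous_on_compose2[OF continuous_measure_invariant[OF S],
          where f = "\<lambda>y. (x, gmult (ginv (gmult y (g_lim \<omega>'))) g)"])
      (intro continuous_on_Pair continuous_on_gmult continuous_on_ginv continuous_on_const continuous_on_id, simp)
  then have "measure (P (x, gmult (ginv (gmult y (g_lim \<omega>'))) g)) S = 0" for y
    by (rule continuous_eq_0_of_dense[OF _ D(2)]) (assumption | rule \<omega>')+
  from this[of "ginv (g_lim \<omega>')"] have "measure (P (x, g)) S = 0"
    by simp
  then have "AE \<omega> in P (x, g). \<omega> \<notin> S"
    by (simp add: v_iff)
  with AE_space show ?thesis
    by eventually_elim (simp add: S_iff flip: B_def)
qed

lemma invariant_field_coincides: "coincide_up_to_null (P (x, g)) (invariant_field id) sigma_g_lim"
  unfolding coincide_up_to_null_def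
proof (intro conjI ballI)
  fix A assume A: "A \<in> invariant_field (id :: 'x \<times> 'g \<Rightarrow> _)"
  define E :: "(real \<Rightarrow> 'x \<times> 'g) set" where "E = {\<omega> \<in> paths. g_lim \<omega> \<in> limit_set A x}"
  have E: "E \<in> invariant_field (id :: 'x \<times> 'g \<Rightarrow> _)"
    unfolding E_def by (rule g_lim_event_invariant[OF limit_set_borel[OF A]])
  have "E \<in> sigma_g_lim"
    using limit_set_borel[OF A] by (auto simp: E_def sigma_g_lim_def)
  moreover have "AE \<omega> in P (x, g). \<omega> \<notin> sym_diff A E"
    using invariant_event_eq_limit_event[OF A, of x g] AE_space
    by eventually_elim (auto simp: E_def)
  moreover have "sym_diff A E \<in> sets (P (x, g))"
    using invariant_field_path_space[OF A] invariant_field_path_space[OF E] by simp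
  ultimately show "\<exists>B\<in>sigma_g_lim. sym_diff A B \<in> null_sets (P (x, g))"
    by (intro bexI[of _ E]) (simp_all add: AE_iff_null_sets)
next
  fix B :: "(real \<Rightarrow> 'x \<times> 'g) set" assume "B \<in> sigma_g_lim"
  then have "B \<in> invariant_field id"
    by (auto simp: sigma_g_lim_def intro: g_lim_event_invariant)
  then show "\<exists>A\<in>invariant_field id. sym_diff A B \<in> null_sets (P (x, g))"
    by (intro bexI[of _ B]) simp_all
qed

text \<open>
  Membership of \<open>h\<close> is decided by a continuous function of \<open>x\<close> with values in \<open>{0, 1}\<close>.
\<close>

lemma limit_set_eq:
  assumes A: "A \<in> invariant_field id" and X: "connected (UNIV :: 'x set)"
  shows "limit_set A x = limit_set A y"
proof -
  have "h \<in> limit_set A x \<longleftrightarrow> h \<in> limit_set A y" for h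
  proof -
    define F where "F x = measure (P (x, gone)) (recentred A h)" for x
    have F: "continuous_on UNIV F"
      unfolding F_def by (rule continuous_measure_recentred[OF A])
    have "F z = 0 \<or> F z = 1" for z
      unfolding F_def by (rule measure_recentred_trivial[OF A])
    then have eq: "F -` {1} = F -` {1/2<..}"
      by (force simp: vimage_def)
    have "closed (F -` {1})"
      using F by (intro closed_vimage) auto
    moreover have "open (F -` {1/2<..})"
      using F by (intro open_vimage) auto
    ultimately have "F -` {1} = {} \<or> F -` {1} = UNIV"
      using X unfolding connected_clopen eq by (auto simp: open_openin[symmetric])
    then show ?thesis
      by (auto simp: limit_set_def F_def)
  qed
  then show ?thesis by blast
qed

text \<open>
  The function \<open>\<psi>\<close> is \<open>exceedance_limsup H\<close> with each exceedance event replaced by the event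
  about \<open>g\<^sub>\<infinity>\<close> that it equals almost surely.
\<close>

lemma harmonic_representation_unit:
  assumes X: "connected (UNIV :: 'x set)"
    and H: "harmonic P H" "\<And>z. 0 \<le> H z" "\<And>z. H z \<le> 1"
  shows "\<exists>\<psi> :: 'g \<Rightarrow> real. \<psi> \<in> borel_measurable borel \<and> (\<forall>h. 0 \<le> \<psi> h \<and> \<psi> h \<le> 1) \<and>
    (\<forall>x g. H (x, g) = (\<integral>\<omega>. \<psi> (g_lim \<omega>) \<partial>P (x, g)))"
proof -
  have Hc: "continuous_on UNIV H"
    using regularity H(1) by (simp add: regularity_condition_def)
  define I where "I = \<rat> \<inter> {0..1::real}"
  have I: "countable I"
    unfolding I_def by (rule countable_subset[OF _ countable_rat]) auto
  define E where "E q = {\<omega> \<in> paths. \<not> (\<forall>\<^sub>F t in at_top. H (\<omega> t) \<le> q)}" for q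
  have E: "E q \<in> invariant_field id" for q
    unfolding E_def by (rule exceedance_invariant[OF Hc])
  define B where "B q = limit_set (E q) undefined" for q
  have B: "limit_set (E q) x = B q" for q x
    unfolding B_def by (rule limit_set_eq[OF E X])
  define \<psi> where "\<psi> h = (SUP q\<in>I. q * indicator (B q) h)" for h
  have bdd: "bdd_above ((\<lambda>q. q * indicator (B q) h) ` I)" for h
    unfolding I_def by (rule bdd_above_weighted_indicators)
  have "\<psi> \<in> borel_measurable borel"
    unfolding \<psi>_def
  proof (rule borel_measurable_cSUP[OF I _ bdd])
    show "(\<lambda>h. q * indicator (B q) h) \<in> borel_measurable borel" for q
      using limit_set_borel[OF E] by (simp add: B_def)
  qed
  moreover have "0 \<le> \<psi> h" for h
  proof -
    have "0 * indicator (B 0) h \<le> \<psi> h"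
      unfolding \<psi>_def by (intro cSUP_upper bdd) (simp add: I_def)
    then show ?thesis by simp
  qed
  moreover have "\<psi> h \<le> 1" for h
    unfolding \<psi>_def using unit_rats_nonempty by (intro cSUP_least) (auto simp: I_def indicator_def)
  moreover have "H (x, g) = (\<integral>\<omega>. \<psi> (g_lim \<omega>) \<partial>P (x, g))" for x g
  proof -
    have "AE \<omega> in P (x, g). \<forall>q\<in>I. \<omega> \<in> E q \<longleftrightarrow> g_lim \<omega> \<in> B q"
      unfolding AE_ball_countable[OF I] using invariant_event_eq_limit_event[OF E] by (simp add: B)
    then have "AE \<omega> in P (x, g). exceedance_limsup H \<omega> = \<psi> (g_lim \<omega>)"
    proof eventually_elim
      case (elim \<omega>)
      then show ?case
        unfolding exceedance_limsup_def \<psi>_def I_def[symmetric] E_def[symmetric]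
        by (intro SUP_cong) (auto simp: indicator_def)
    qed
    then have "(\<integral>\<omega>. exceedance_limsup H \<omega> \<partial>P (x, g)) = (\<integral>\<omega>. \<psi> (g_lim \<omega>) \<partial>P (x, g))"
      using measurable_exceedance_limsup[OF Hc] measurable_compose[OF measurable_g_lim calculation(1)]
      by (intro integral_cong_AE) simp_all
    then show ?thesis
      using harmonic_eq_integral_limsup[OF H Hc] by simp
  qed
  ultimately show ?thesis by blast
qed

lemma harmonic_representation:
  assumes X: "connected (UNIV :: 'x set)" and H: "harmonic P H"
  shows "\<exists>\<psi> :: 'g \<Rightarrow> real. \<psi> \<in> borel_measurable borel \<and> bounded (range \<psi>) \<and>
    (\<forall>x g. H (x, g) = (\<integral>\<omega>. \<psi> (g_lim \<omega>) \<partial>P (x, g)))"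
proof -
  obtain c where c: "c > 0" "\<And>z. \<bar>H z\<bar> \<le> c"
    using H unfolding harmonic_def bounded_pos by auto
  define H' where "H' z = (1 / (2 * c)) * H z + 1 / 2" for z
  have "harmonic P H'"
    unfolding H'_def by (rule harmonic_affine[OF H])
  moreover have "0 \<le> H' z" "H' z \<le> 1" for z
    using c(1) c(2)[of z] by (auto simp: H'_def field_simps abs_le_iff)
  ultimately obtain \<psi> where \<psi>: "\<psi> \<in> borel_measurable borel" "\<And>h. 0 \<le> \<psi> h \<and> \<psi> h \<le> 1"
    "\<And>x g. H' (x, g) = (\<integral>\<omega>. \<psi> (g_lim \<omega>) \<partial>P (x, g))"
    using harmonic_representation_unit[OF X] by blast
  define \<phi> where "\<phi> h = 2 * c * \<psi> h - c" for h
  have "\<phi> \<in> borel_measurable borel"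
    unfolding \<phi>_def using \<psi>(1) by measurable
  moreover have "bounded (range \<phi>)"
  proof -
    have "\<bar>\<phi> h\<bar> \<le> c" for h
      using \<psi>(2)[of h] c(1) by (auto simp: \<phi>_def abs_le_iff)
    then show ?thesis
      by (auto simp: bounded_iff)
  qed
  moreover have "H (x, g) = (\<integral>\<omega>. \<phi> (g_lim \<omega>) \<partial>P (x, g))" for x g
  proof -
    interpret prob_space "P (x, g)" by (rule prob_space_P)
    have "integrable (P (x, g)) (\<lambda>\<omega>. \<psi> (g_lim \<omega>))"
      using \<psi>(2) measurable_compose[OF measurable_g_lim \<psi>(1)]
      by (intro integrable_const_bound[where B = 1]) auto
    then have "(\<integral>\<omega>. \<phi> (g_lim \<omega>) \<partial>P (x, g)) = 2 * c * H' (x, g) - c"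
      unfolding \<phi>_def using prob_space by (simp add: \<psi>(3))
    then show ?thesis
      using c(1) by (simp add: H'_def field_simps)
  qed
  ultimately show ?thesis by blast
qed

end

theorem theorem1:
  fixes n m :: nat
    and atlasX :: "'x::{t2_space, second_countable_topology} chart set"
    and atlasG :: "'g::{t2_space, second_countable_topology} chart set"
    and gmult :: "'g \<Rightarrow> 'g \<Rightarrow> 'g" and gone :: 'g and ginv :: "'g \<Rightarrow> 'g"
    and \<L> :: "('x \<times> 'g \<Rightarrow> real) \<Rightarrow> 'x \<times> 'g \<Rightarrow> real"
    and P :: "'x \<times> 'g \<Rightarrow> (real \<Rightarrow> 'x \<times> 'g) measure"
  assumes manifold_X: "smooth_manifold n atlasX"
    and lie_group_G: "lie_group m atlasG gmult gone ginv"
    and connected_G: "connected (UNIV :: 'g set)"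
    and diffusion: "diffusion (n + m) (prod_atlas n atlasX atlasG) \<L> P"
    and devissage: "sub_diffusion n atlasX P"
    and convergence: "convergence_condition P"
    and equivariance: "equivariance_condition (n + m) (prod_atlas n atlasX atlasG) gmult \<L>"
    and regularity: "regularity_condition P"
    and trivial: "\<And>x g. trivial_field (P (x, g)) (invariant_field fst)"
  shows "(\<forall>x g. coincide_up_to_null (P (x, g)) (invariant_field id) sigma_g_lim) \<and>
    (connected (UNIV :: 'x set) \<longrightarrow>
      (\<forall>H. harmonic P H \<longrightarrow>
        (\<exists>\<psi> :: 'g \<Rightarrow> real. \<psi> \<in> borel_measurable borel \<and> bounded (range \<psi>) \<and>
          (\<forall>x g. H (x, g) = (\<integral>\<omega>. \<psi> (g_lim \<omega>) \<partial>P (x, g))))))"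
proof -
  interpret equivariant_diffusion n m atlasX atlasG gmult gone ginv \<L> P
    by unfold_locales fact+
  show ?thesis
    using invariant_field_coincides harmonic_representation by blast
qed

end
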